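(* Let $q=e^{2\pi i\tau}$ with $\Im\tau>0$, let $\eta(\tau)=q^{1/24}\prod_{j\ge1}(1-q^j)$ and $P(q)=1-24\sum_{j\ge1}\frac{jq^j}{1-q^j}$. Define $$z=\tfrac14\bigl(6P(q^{12})-3P(q^6)+2P(q^4)-P(q^2)\bigr)+2\eta(2\tau)\eta(4\tau)\eta(6\tau)\eta(12\tau),\qquad x=\frac{\eta(2\tau)\eta(4\tau)\eta(6\tau)\eta(12\tau)}{z}.$$ For $n\ge0$ let $$t(n)=\sum_{k=0}^{\lfloor n/2\rfloor}\binom{n}{2k}\binom{2k}{k}^2\binom{2n-4k}{n-2k}.$$ Then in a neighborhood of $x=0$ (i.e. for $q$ in a neighborhood of $0$), $$z=\sum_{n=0}^\infty t(n)x^n.$$ *)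

theory Defs
  imports "HOL-Analysis.Analysis"
begin

definition qpar :: "complex \<Rightarrow> complex" where
  "qpar \<tau> = exp (2 * of_real pi * \<i> * \<tau>)"

text \<open>The fractional power \<open>q\<^sup>1\<^sup>/\<^sup>2\<^sup>4\<close> means \<open>exp (2 \<pi> \<i> \<tau> / 24)\<close>, not a principal branch
  applied to \<open>q\<close>.\<close>

definition dedekind_eta :: "complex \<Rightarrow> complex" where
  "dedekind_eta \<tau> = exp (2 * of_real pi * \<i> * \<tau> / 24) * (\<Prod>j. 1 - qpar \<tau> ^ Suc j)"

definition ramanujan_P :: "complex \<Rightarrow> complex" where
  "ramanujan_P q = 1 - 24 * (\<Sum>j. of_nat (Suc j) * q ^ Suc j / (1 - q ^ Suc j))"

definition eta_product :: "complex \<Rightarrow> complex" where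
  "eta_product \<tau> =
     dedekind_eta (2 * \<tau>) * dedekind_eta (4 * \<tau>) * dedekind_eta (6 * \<tau>) * dedekind_eta (12 * \<tau>)"

definition z_fun :: "complex \<Rightarrow> complex" where
  "z_fun \<tau> = (let q = qpar \<tau> in
     1 / 4 * (6 * ramanujan_P (q ^ 12) - 3 * ramanujan_P (q ^ 6)
              + 2 * ramanujan_P (q ^ 4) - ramanujan_P (q ^ 2))
     + 2 * eta_product \<tau>)"

definition x_fun :: "complex \<Rightarrow> complex" where
  "x_fun \<tau> = eta_product \<tau> / z_fun \<tau>"

definition t_coeff :: "nat \<Rightarrow> nat" where
  "t_coeff n = (\<Sum>k=0..n div 2.
     (n choose (2 * k)) * ((2 * k) choose k)\<^sup>2 * ((2 * n - 4 * k) choose (n - 2 * k)))"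

end

theory Submission
  imports Defs "HOL-Complex_Analysis.Complex_Analysis" "HOL-Real_Asymp.Real_Asymp"
begin

text \<open>
  Write \<open>Q = q\<^sup>2\<close> and \<open>D = Q d/dQ\<close>. Since \<open>t(n) = \<Sum>\<^sub>j (n choose 2j) 2\<^sup>n\<^sup>-\<^sup>2\<^sup>j b(j)\<close> with
  \<open>b(j) = (2j choose j) \<Sum>\<^sub>k (j choose k)\<^sup>2 (2k choose k)\<close>, the claim reduces to \<open>Z = \<Sum> b(n) Y\<^sup>n\<close>,
  where \<open>Z = z - 2 \<eta>\<eta>\<eta>\<eta>\<close> and \<open>Y = (\<eta>\<eta>\<eta>\<eta> / Z)\<^sup>2\<close> are functions of \<open>Q\<close> of level 6. Let \<open>\<psi>\<close> be
  Ramanujan's theta function, \<open>w = Q \<psi>(Q\<^sup>3)\<^sup>4 / \<psi>(Q)\<^sup>4\<close> and \<open>N = \<psi>(Q)\<^sup>6 / \<psi>(Q\<^sup>3)\<^sup>2\<close>. With \<open>v\<^sup>2 = w(Q\<^sup>2)\<close>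
  one has \<open>w(Q) = v (1 - v) / (1 + 3v)\<close> and \<open>N(Q) = (1 + 3v)\<^sup>2 N(Q\<^sup>2)\<close>; these follow algebraically
  from the duplication formulas for theta functions once Legendre's cubic modular equation is known.

  Everything else is obtained from one principle: a function that is continuous at 0 and invariant
  under \<open>Q \<mapsto> Q\<^sup>2\<close> is constant near 0. Applied to \<open>D w / (N p(w))\<close> with \<open>p(w) = w (1 - w)(1 - 9w)\<close>,
  it gives \<open>D w = N p(w)\<close>, and hence \<open>Z = N (1 - 9w\<^sup>2)\<close>, because \<open>Z\<close> is the logarithmic derivative
  \<open>D u / u\<close> of the eta quotient \<open>u = w / ((1 - w)(1 - 9w))\<close>. Applied to \<open>T(w(Q)) / N(Q)\<close>, it gives
  \<open>T(w) = N\<close>, where \<open>T(w) = B(y) / (1 - 9w\<^sup>2)\<close>, \<open>B\<close> is the generating function of \<open>b\<close> and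
  \<open>y = p(w) / (1 - 9w\<^sup>2)\<^sup>2\<close>. The functional equation \<open>T(v (1 - v) / (1 + 3v)) = (1 + 3v)\<^sup>2 T(v\<^sup>2)\<close>
  needed here holds because both sides are squares of solutions of the same second-order
  differential equation.
\<close>

section \<open>Recurrences for the coefficients\<close>

definition a_coeff :: "nat \<Rightarrow> nat" where
  "a_coeff n = (\<Sum>k\<le>n. (n choose k)\<^sup>2 * ((2 * k) choose k))"

definition b_coeff :: "nat \<Rightarrow> nat" where
  "b_coeff n = ((2 * n) choose n) * a_coeff n"

lemma a_coeff_0 [simp]: "a_coeff 0 = 1"
  by (simp add: a_coeff_def)

lemma b_coeff_0 [simp]: "b_coeff 0 = 1"
  by (simp add: b_coeff_def)

lemma a_coeff_extend:
  assumes "n \<le> N"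
  shows "a_coeff n = (\<Sum>k\<le>N. (n choose k)\<^sup>2 * ((2 * k) choose k))"
  unfolding a_coeff_def using assms by (intro sum.mono_neutral_left) (auto simp: binomial_eq_0)

lemma central_binomial_Suc:
  "(of_nat k + 1) * of_nat ((2 * Suc k) choose Suc k) =
     2 * (2 * of_nat k + 1) * (of_nat ((2 * k) choose k) :: 'a::field_char_0)"
proof -
  define K where "K = (of_nat k :: 'a)"
  have "K + 1 \<noteq> 0" using of_nat_neq_0[of k, where ?'a = 'a] by (simp add: K_def add.commute)
  have quotient: "of_nat ((2 * m) choose m) = (fact (2 * m) / (fact m)\<^sup>2 :: 'a)" for m
    by (simp add: binomial_fact power2_eq_square mult_2)
  have fact_double: "fact (2 * Suc k) = 2 * (K + 1) * (2 * K + 1) * (fact (2 * k) :: 'a)"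
    by (simp add: K_def algebra_simps)
  have fact_Suc_K: "fact (Suc k) = (K + 1) * (fact k :: 'a)" by (simp add: K_def algebra_simps)
  show ?thesis unfolding quotient fact_double fact_Suc_K K_def[symmetric]
    using \<open>K + 1 \<noteq> 0\<close> by (simp add: power2_eq_square divide_simps) (simp add: algebra_simps)
qed

lemma binomial_Suc_right:
  "(of_nat j + 1) * of_nat (n choose Suc j) =
      (of_nat n - of_nat j) * (of_nat (n choose j) :: 'a::field_char_0)"
  using arg_cong[OF binomial_absorb_comp[of n j], of "of_nat :: nat \<Rightarrow> 'a"]
    arg_cong[OF binomial_absorption[of j n], of "of_nat :: nat \<Rightarrow> 'a"]
  by (cases "j \<le> n") (simp_all add: algebra_simps binomial_eq_0)

lemma binomial_pred_left:
  "of_nat n * of_nat ((n - 1) choose j) =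
      (of_nat n - of_nat j) * (of_nat (n choose j) :: 'a::field_char_0)"
  using arg_cong[OF binomial_absorb_comp[of n j], of "of_nat :: nat \<Rightarrow> 'a"]
  by (cases "j \<le> n") (simp_all add: binomial_eq_0)

lemma a_coeff_certificate:
  fixes N K x y :: "'a::field"
  assumes "K \<noteq> 0" "K * y = (N + 1 - K) * x"
  shows "(N + 1)\<^sup>2 * (x + y)\<^sup>2 - (10 * N\<^sup>2 + 10 * N + 3) * y\<^sup>2 + 9 * ((N - K) * y)\<^sup>2 =
    2 * (2 * K + 1) * (3 * K - 1 - 4 * N) * y\<^sup>2 - K * (3 * K - 4 - 4 * N) * x\<^sup>2"
proof -
  have "y = (N + 1 - K) * x / K" using assms by (simp add: field_simps)
  thus ?thesis using \<open>K \<noteq> 0\<close> by (simp add: field_simps) algebra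
qed

text \<open>The certificate \<open>G\<close> comes from Zeilberger's algorithm.\<close>

lemma a_coeff_telescoping_term:
  fixes n k :: nat
  defines "c \<equiv> \<lambda>k. of_nat ((2 * k) choose k) :: 'a::field_char_0"
  defines "G \<equiv> \<lambda>k. of_nat k * (3 * of_nat k - 4 - 4 * of_nat n) * (of_nat (n choose (k - 1)))\<^sup>2 *
      c k"
  shows "(of_nat n + 1)\<^sup>2 * ((of_nat (Suc n choose k))\<^sup>2 * c k)
       - (10 * (of_nat n)\<^sup>2 + 10 * of_nat n + 3) * ((of_nat (n choose k))\<^sup>2 * c k)
       + 9 * (of_nat n)\<^sup>2 * ((of_nat ((n - 1) choose k))\<^sup>2 * c k) = G (Suc k) - G k"
proof (cases k)
  case 0
  thus ?thesis by (simp add: G_def c_def power2_eq_square algebra_simps)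
next
  case (Suc j)
  define x where "x = (of_nat (n choose j) :: 'a)"
  define y where "y = (of_nat (n choose k) :: 'a)"
  define N where "N = (of_nat n :: 'a)"
  define K where "K = (of_nat k :: 'a)"
  have "K \<noteq> 0" using Suc by (simp add: K_def del: of_nat_Suc)
  have xy_ratio: "K * y = (N + 1 - K) * x"
    using binomial_Suc_right[of j n, where ?'a = 'a]
    by (simp add: x_def y_def N_def K_def Suc algebra_simps)
  have pred: "N * of_nat ((n - 1) choose k) = (N - K) * y"
    using binomial_pred_left[of n k, where ?'a = 'a] by (simp only: y_def N_def K_def)
  have pascal: "of_nat (Suc n choose k) = x + y" by (simp add: Suc x_def y_def)
  have c_Suc: "(K + 1) * c (Suc k) = 2 * (2 * K + 1) * c k"
    using central_binomial_Suc[of k, where ?'a = 'a] by (simp only: c_def K_def)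
  note certificate = a_coeff_certificate[OF \<open>K \<noteq> 0\<close> xy_ratio]
  have "G (Suc k) - G k = (3 * K - 1 - 4 * N) * y\<^sup>2 * ((K + 1) * c (Suc k))
      - K * (3 * K - 4 - 4 * N) * x\<^sup>2 * c k"
    by (simp add: G_def K_def N_def x_def y_def Suc algebra_simps)
  also have "\<dots> = c k * (2 * (2 * K + 1) * (3 * K - 1 - 4 * N) * y\<^sup>2 - K * (3 * K - 4 - 4 * N) * x\<^sup>2)"
    unfolding c_Suc by algebra
  also have "\<dots> = (N + 1)\<^sup>2 * ((x + y)\<^sup>2 * c k) - (10 * N\<^sup>2 + 10 * N + 3) * (y\<^sup>2 * c k)
       + 9 * N\<^sup>2 * ((of_nat ((n - 1) choose k))\<^sup>2 * c k)"
    unfolding certificate[symmetric] pred[symmetric] by algebra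
  finally show ?thesis unfolding pascal N_def y_def by (rule sym)
qed

lemma a_coeff_rec:
  "(of_nat n + 1)\<^sup>2 * of_nat (a_coeff (Suc n)) =
     (10 * (of_nat n)\<^sup>2 + 10 * of_nat n + 3) * of_nat (a_coeff n)
     - 9 * (of_nat n)\<^sup>2 * (of_nat (a_coeff (n - 1)) :: 'a::field_char_0)"
proof -
  let ?c = "\<lambda>k. of_nat ((2 * k) choose k) :: 'a"
  let ?G = "\<lambda>k. of_nat k * (3 * of_nat k - 4 - 4 * of_nat n) * (of_nat (n choose (k - 1)))\<^sup>2 * ?c k"
  have extend: "of_nat (a_coeff m) = (\<Sum>k\<le>Suc n. (of_nat (m choose k))\<^sup>2 * ?c k)" if "m \<le> Suc n" for m
    by (simp add: a_coeff_extend[OF that])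
  have "(of_nat n + 1)\<^sup>2 * of_nat (a_coeff (Suc n))
      - (10 * (of_nat n)\<^sup>2 + 10 * of_nat n + 3) * of_nat (a_coeff n)
       + 9 * (of_nat n)\<^sup>2 * of_nat (a_coeff (n - 1)) = (\<Sum>k\<le>Suc n. ?G (Suc k) - ?G k)"
    unfolding extend[of "Suc n", OF order_refl] extend[of n, OF le_SucI[OF order_refl]]
      extend[of "n - 1", OF le_trans[OF diff_le_self le_SucI[OF order_refl]]]
      sum_distrib_left sum_subtractf[symmetric] sum.distrib[symmetric]
    by (intro sum.cong refl a_coeff_telescoping_term)
  also have "\<dots> = ?G (Suc (Suc n)) - ?G 0"
    unfolding lessThan_Suc_atMost[symmetric] by (rule sum_lessThan_telescope)
  also have "\<dots> = 0" by (simp add: binomial_eq_0 del: binomial_Suc_Suc)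
  finally show ?thesis by (simp add: algebra_simps)
qed

lemma b_coeff_rec:
  "(of_nat n + 1) ^ 3 * of_nat (b_coeff (Suc n)) =
     2 * (2 * of_nat n + 1) * (10 * (of_nat n)\<^sup>2 + 10 * of_nat n + 3) * of_nat (b_coeff n)
     - 36 * of_nat n * (4 * (of_nat n)\<^sup>2 - 1) * (of_nat (b_coeff (n - 1)) :: 'a::field_char_0)"
proof -
  define N where "N = (of_nat n :: 'a)"
  let ?c = "\<lambda>k. of_nat ((2 * k) choose k) :: 'a" and ?a = "\<lambda>k. of_nat (a_coeff k) :: 'a"
  have "N * (N * ?c n) = N * (2 * (2 * N - 1) * ?c (n - 1))"
  proof (cases n)
    case (Suc m)
    thus ?thesis using central_binomial_Suc[of m, where ?'a = 'a] by (simp add: N_def algebra_simps)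
  qed (simp add: N_def)
  moreover have "(N + 1) * ?c (Suc n) = 2 * (2 * N + 1) * ?c n"
    unfolding N_def by (rule central_binomial_Suc)
  moreover have "(N + 1)\<^sup>2 * ?a (Suc n) = (10 * N\<^sup>2 + 10 * N + 3) * ?a n - 9 * N\<^sup>2 * ?a (n - 1)"
    unfolding N_def by (rule a_coeff_rec)
  ultimately have "(N + 1) ^ 3 * (?c (Suc n) * ?a (Suc n)) =
      2 * (2 * N + 1) * (10 * N\<^sup>2 + 10 * N + 3) * (?c n * ?a n)
      - 36 * N * (4 * N\<^sup>2 - 1) * (?c (n - 1) * ?a (n - 1))"
    by algebra
  thus ?thesis unfolding b_coeff_def N_def of_nat_mult .
qed

lemma central_binomial_le: "((2 * n) choose n) \<le> 4 ^ n"
  using binomial_le_pow2[of "2 * n" n] by (simp add: power_mult)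

lemma b_coeff_le: "b_coeff n \<le> 64 ^ n"
proof -
  have "a_coeff n \<le> (\<Sum>k\<le>n. (n choose k)\<^sup>2 * 4 ^ n)" unfolding a_coeff_def
  proof (intro sum_mono mult_left_mono)
    fix k assume "k \<in> {..n}"
    thus "((2 * k) choose k) \<le> 4 ^ n"
      using central_binomial_le[of k] power_increasing[of k n "4::nat"] by (auto intro: le_trans)
  qed simp
  also have "\<dots> = ((2 * n) choose n) * 4 ^ n"
    by (simp add: sum_distrib_right[symmetric] choose_square_sum)
  also have "\<dots> \<le> 4 ^ n * 4 ^ n" using central_binomial_le[of n] by simp
  finally have "b_coeff n \<le> 4 ^ n * (4 ^ n * 4 ^ n)" unfolding b_coeff_def
    using central_binomial_le[of n] by (intro mult_mono) auto
  also have "\<dots> = 64 ^ n" by (simp add: power_mult_distrib[symmetric])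
  finally show ?thesis .
qed

section \<open>The generating function of \<open>t_coeff\<close>\<close>

lemma b_coeff_double_sum:
  "b_coeff j = (\<Sum>k\<le>j. ((2 * j) choose (2 * k)) * ((2 * k) choose k)\<^sup>2 *
      ((2 * (j - k)) choose (j - k)))"
proof -
  have "((2 * j) choose j) * ((j choose k)\<^sup>2 * ((2 * k) choose k))
      = ((2 * j) choose (2 * k)) * ((2 * k) choose k)\<^sup>2 * ((2 * (j - k)) choose (j - k))"
        if "k \<le> j" for k
  proof -
    obtain i where j_eq: "j = k + i" using \<open>k \<le> j\<close> le_Suc_ex by blast
    have fact_quotient: "real (n choose r) = fact n / (fact r * fact (n - r))" if "r \<le> n" for n r
      by (rule binomial_fact[OF that])
    have "real (((2 * j) choose j) * ((j choose k)\<^sup>2 * ((2 * k) choose k)))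
        = real (((2 * j) choose (2 * k)) * ((2 * k) choose k)\<^sup>2 * ((2 * (j - k)) choose (j - k)))"
      unfolding of_nat_mult of_nat_power using j_eq
      by (simp add: fact_quotient divide_simps power2_eq_square algebra_simps)
    thus ?thesis by (simp only: of_nat_eq_iff)
  qed
  thus ?thesis unfolding b_coeff_def a_coeff_def sum_distrib_left by (intro sum.cong) auto
qed

lemma coeff_one_plus_monom_power:
  "coeff ((1 + monom 1 d :: nat poly) ^ j) n = (\<Sum>i\<le>j. if d * i = n then j choose i else 0)"
proof -
  have "(1 + monom 1 d :: nat poly) ^ j = (\<Sum>i\<le>j. of_nat (j choose i) * monom 1 d ^ i)"
    by (subst add.commute, subst binomial_ring) simp
  also have "\<dots> = (\<Sum>i\<le>j. monom (j choose i) (d * i))"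
    by (intro sum.cong refl) (simp add: monom_power of_nat_poly smult_monom mult.commute)
  finally show ?thesis by (simp add: coeff_sum coeff_monom)
qed

text \<open>Both sides are the coefficient of \<open>X\<^sup>m\<close> in \<open>(1 + X)\<^sup>2\<^sup>m = ((1 + X\<^sup>2) + 2X)\<^sup>m\<close>.\<close>

lemma central_binomial_expand:
  "((2 * m) choose m) = (\<Sum>i\<le>m div 2. (m choose (2 * i)) * ((2 * i) choose i) * 2 ^ (m - 2 * i))"
proof -
  let ?f = "\<lambda>j. coeff ((1 + monom 1 2 :: nat poly) ^ j) j"
  have "monom 2 1 = monom 1 1 + (monom 1 1 :: nat poly)" by (simp only: add_monom one_add_one)
  hence "(1 + monom 1 1 :: nat poly)\<^sup>2 = (1 + monom 1 2) + monom 2 1"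
    by (simp add: power2_eq_square algebra_simps mult_monom numeral_2_eq_2)
  hence "(1 + monom 1 1 :: nat poly) ^ (2 * m) = ((1 + monom 1 2) + monom 2 1) ^ m"
    by (simp add: power_mult)
  also have "\<dots> = (\<Sum>j\<le>m. monom ((m choose j) * 2 ^ (m - j)) (m - j) * (1 + monom 1 2) ^ j)"
    unfolding binomial_ring
    by (intro sum.cong refl)
       (simp add: monom_power of_nat_poly smult_monom mult_ac flip: smult_monom)
  finally have "coeff ((1 + monom 1 1 :: nat poly) ^ (2 * m)) m =
      (\<Sum>j\<le>m. (m choose j) * 2 ^ (m - j) * ?f j)"
    by (auto simp: coeff_sum coeff_monom_mult intro!: sum.cong)
  also have "\<dots> = (\<Sum>j | j \<le> m \<and> even j. (m choose j) * 2 ^ (m - j) * ?f j)"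
  proof (intro sum.mono_neutral_right ballI)
    fix j assume "j \<in> {..m} - {j. j \<le> m \<and> even j}"
    hence "?f j = 0" unfolding coeff_one_plus_monom_power by (intro sum.neutral) auto
    thus "(m choose j) * 2 ^ (m - j) * ?f j = 0" by simp
  qed auto
  also have "\<dots> = (\<Sum>i\<le>m div 2. (m choose (2 * i)) * 2 ^ (m - 2 * i) * ?f (2 * i))"
    by (intro sum.reindex_bij_witness[of _ "\<lambda>i. 2 * i" "\<lambda>j. j div 2"]) auto
  also have "\<dots> = (\<Sum>i\<le>m div 2. (m choose (2 * i)) * ((2 * i) choose i) * 2 ^ (m - 2 * i))"
    unfolding coeff_one_plus_monom_power by (intro sum.cong refl) simp
  finally show ?thesis unfolding coeff_one_plus_monom_power by simp
qed

lemma t_coeff_eq_b_coeff_sum: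
  "t_coeff n = (\<Sum>j\<le>n div 2. (n choose (2 * j)) * 2 ^ (n - 2 * j) * b_coeff j)"
proof -
  define h where "h = (\<lambda>k i. (n choose (2 * (k + i))) * 2 ^ (n - 2 * (k + i)) *
     (((2 * (k + i)) choose (2 * k)) * ((2 * k) choose k)\<^sup>2 * ((2 * i) choose i)))"
  have summand: "(n choose (2 * k)) * ((2 * k) choose k)\<^sup>2 * ((2 * n - 4 * k) choose (n - 2 * k)) =
      (\<Sum>i\<le>n div 2 - k. h k i)"
    if k_le: "k \<le> n div 2" for k
  proof -
    have "2 * n - 4 * k = 2 * (n - 2 * k)" "(n - 2 * k) div 2 = n div 2 - k" using k_le by auto
    hence "(n choose (2 * k)) * ((2 * k) choose k)\<^sup>2 * ((2 * n - 4 * k) choose (n - 2 * k))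
      = (\<Sum>i\<le>n div 2 - k. (n choose (2 * k)) * ((2 * k) choose k)\<^sup>2 *
           (((n - 2 * k) choose (2 * i)) * ((2 * i) choose i) * 2 ^ (n - 2 * k - 2 * i)))"
      by (simp only: central_binomial_expand[of "n - 2 * k"] sum_distrib_left)
    also have "\<dots> = (\<Sum>i\<le>n div 2 - k. h k i)"
    proof (intro sum.cong refl)
      fix i assume "i \<in> {..n div 2 - k}"
      hence "(n choose (2 * (k + i))) * ((2 * (k + i)) choose (2 * k)) =
          (n choose (2 * k)) * ((n - 2 * k) choose (2 * i))"
        using choose_mult[of "2 * k" "2 * (k + i)" n] k_le by simp
      thus "(n choose (2 * k)) * ((2 * k) choose k)\<^sup>2 *
           (((n - 2 * k) choose (2 * i)) * ((2 * i) choose i) * 2 ^ (n - 2 * k - 2 * i)) = h k i"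
        unfolding h_def by (simp add: algebra_simps)
    qed
    finally show ?thesis .
  qed
  have "t_coeff n = (\<Sum>k\<le>n div 2. \<Sum>i\<le>n div 2 - k. h k i)"
    unfolding t_coeff_def atLeast0AtMost by (intro sum.cong refl summand) simp
  also have "\<dots> = (\<Sum>j\<le>n div 2. \<Sum>k\<le>j. h k (j - k))"
    by (subst sum.Sigma, simp, simp, subst sum.Sigma, simp, simp)
       (rule sum.reindex_bij_witness[of _ "\<lambda>(j,k). (k, j - k)" "\<lambda>(k,i). (k + i, k)"], auto)
  also have "\<dots> = (\<Sum>j\<le>n div 2. (n choose (2 * j)) * 2 ^ (n - 2 * j) * b_coeff j)"
    unfolding b_coeff_double_sum sum_distrib_left
    by (intro sum.cong refl) (simp only: h_def le_add_diff_inverse atMost_iff)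
  finally show ?thesis .
qed

lemma negative_binomial_sums:
  fixes z :: complex
  assumes "norm z < 1"
  shows "(\<lambda>m. of_nat ((m + k) choose k) * z ^ m) sums (1 / (1 - z) ^ Suc k)"
proof -
  have z_bounds: "norm (- z) < 1" "1 - z \<noteq> 0" using assms by auto
  have "(1 + - z) powr - of_nat (Suc k) = 1 / (1 - z) ^ Suc k"
    using z_bounds by (simp add: powr_minus powr_nat' divide_inverse del: of_nat_Suc power_Suc)
  moreover have "(- 1) ^ m * ((of_nat (Suc k) + of_nat m - 1) gchoose m) * (- z) ^ m =
      of_nat ((m + k) choose k) * z ^ m" for m
  proof -
    have "(of_nat (Suc k) + of_nat m - 1 :: complex) gchoose m = of_nat ((m + k) choose m)"
      by (simp add: binomial_gbinomial add.commute)
    moreover have "(- z) ^ m = (- 1) ^ m * z ^ m" by (rule power_minus)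
    ultimately show ?thesis using binomial_symmetric[of k "m + k"]
      by (simp add: mult.left_commute flip: power_mult_distrib mult.assoc)
  qed
  ultimately show ?thesis
    using one_plus_neg_powr_powser[OF z_bounds(1), of "of_nat (Suc k)"] by (simp only:)
qed

lemma negative_binomial_has_sum:
  fixes z :: complex
  assumes "norm z < 1"
  shows "((\<lambda>m. of_nat ((m + k) choose k) * z ^ m) has_sum (1 / (1 - z) ^ Suc k)) UNIV"
    and "((\<lambda>m. real ((m + k) choose k) * norm z ^ m) has_sum (1 / (1 - norm z) ^ Suc k)) UNIV"
proof -
  have "(\<lambda>m. complex_of_real (real ((m + k) choose k) * norm z ^ m)) sums
      complex_of_real (1 / (1 - norm z) ^ Suc k)"
    using negative_binomial_sums[of "of_real (norm z)" k] assms by simp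
  hence norm_sums: "(\<lambda>m. real ((m + k) choose k) * norm z ^ m) sums (1 / (1 - norm z) ^ Suc k)"
    by (simp only: sums_of_real_iff)
  thus "((\<lambda>m. real ((m + k) choose k) * norm z ^ m) has_sum (1 / (1 - norm z) ^ Suc k)) UNIV"
    by (intro sums_nonneg_imp_has_sum) auto
  show "((\<lambda>m. of_nat ((m + k) choose k) * z ^ m) has_sum (1 / (1 - z) ^ Suc k)) UNIV"
    by (rule norm_summable_imp_has_sum[OF _ negative_binomial_sums[OF assms]])
       (use norm_sums in \<open>simp add: norm_mult norm_power sums_iff\<close>)
qed

lemma negative_binomial_double_summable:
  fixes a :: "nat \<Rightarrow> complex"
  assumes norm_cx: "norm (c * x) < 1"
    and a_summable: "summable (\<lambda>j. norm (a j) * (norm x / (1 - norm (c * x))) ^ j)"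
  shows "(\<lambda>(j, m). a j * x ^ j * (of_nat ((m + j) choose j) * (c * x) ^ m)) summable_on UNIV \<times> UNIV"
proof (rule abs_summable_summable, rule summable_on_SigmaI)
  let ?S = "\<lambda>j. 1 / (1 - norm (c * x)) * (norm (a j) * (norm x / (1 - norm (c * x))) ^ j)"
  show "((\<lambda>m. norm (case (j, m) of (j, m) \<Rightarrow>
      a j * x ^ j * (of_nat ((m + j) choose j) * (c * x) ^ m))) has_sum ?S j) UNIV" for j
    using has_sum_cmult_right[OF negative_binomial_has_sum(2)[OF norm_cx, of j],
        of "norm (a j * x ^ j)"]
    by (simp add: norm_mult norm_power power_divide power_mult_distrib mult_ac)
  show "?S summable_on UNIV"
    using norm_cx a_summable by (intro summable_nonneg_imp_summable_on summable_on_cmult_right) auto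
qed simp

text \<open>Euler's transformation: expand \<open>1 / (1 - c x)\<^sup>j\<^sup>+\<^sup>1\<close> and interchange the summations.\<close>

lemma binomial_transform_sums:
  fixes a :: "nat \<Rightarrow> complex"
  assumes norm_cx: "norm (c * x) < 1"
    and a_summable: "summable (\<lambda>j. norm (a j) * (norm x / (1 - norm (c * x))) ^ j)"
  shows "(\<lambda>n. (\<Sum>j\<le>n. of_nat (n choose j) * c ^ (n - j) * a j) * x ^ n) sums
           (1 / (1 - c * x) * (\<Sum>j. a j * (x / (1 - c * x)) ^ j))"
proof -
  define f where "f = (\<lambda>(j, m). a j * x ^ j * (of_nat ((m + j) choose j) * (c * x) ^ m))"
  define g where "g = (\<lambda>j. 1 / (1 - c * x) * (a j * (x / (1 - c * x)) ^ j))"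
  have total: "(f has_sum infsum f (UNIV \<times> UNIV)) (UNIV \<times> UNIV)"
    unfolding f_def by (intro has_sum_infsum negative_binomial_double_summable norm_cx a_summable)
  have row: "((\<lambda>m. f (j, m)) has_sum g j) UNIV" for j
    using has_sum_cmult_right[OF negative_binomial_has_sum(1)[OF norm_cx, of j], of "a j * x ^ j"]
    by (simp add: f_def g_def power_divide mult_ac)
  have "(g has_sum infsum f (UNIV \<times> UNIV)) UNIV" by (rule has_sum_SigmaD[OF total row])
  hence g_sums: "g sums infsum f (UNIV \<times> UNIV)" by (rule has_sum_imp_sums)
  have diagonals: "((\<lambda>(n, j). f (j, n - j)) has_sum infsum f (UNIV \<times> UNIV)) (SIGMA n:UNIV. {..n})"
    using total
    by (subst has_sum_reindex_bij_witness[of _ "\<lambda>(j, m). (m + j, j)" "\<lambda>(n, j). (j, n - j)"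
      "UNIV \<times> UNIV" f]) auto
  have diagonal: "((\<lambda>j. f (j, n - j))
      has_sum (\<Sum>j\<le>n. of_nat (n choose j) * c ^ (n - j) * a j) * x ^ n) {..n}" for n
  proof (rule has_sum_finiteI)
    have "x ^ n = x ^ j * x ^ (n - j)" if "j \<le> n" for j using that by (simp flip: power_add)
    thus "(\<Sum>j\<le>n. of_nat (n choose j) * c ^ (n - j) * a j) * x ^ n = (\<Sum>j\<le>n. f (j, n - j))"
      unfolding sum_distrib_right by (intro sum.cong refl) (simp add: f_def power_mult_distrib)
  qed simp
  have "((\<lambda>n. (\<Sum>j\<le>n. of_nat (n choose j) * c ^ (n - j) * a j) * x ^ n)
      has_sum infsum f (UNIV \<times> UNIV)) UNIV"
    by (rule has_sum_SigmaD[OF diagonals]) (use diagonal in simp)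
  moreover have "infsum f (UNIV \<times> UNIV) = 1 / (1 - c * x) * (\<Sum>j. a j * (x / (1 - c * x)) ^ j)"
  proof -
    have nonzero: "1 - c * x \<noteq> 0" using norm_cx by auto
    hence "(\<lambda>j. a j * (x / (1 - c * x)) ^ j) sums ((1 - c * x) * infsum f (UNIV \<times> UNIV))"
      using sums_mult[OF g_sums, of "1 - c * x"] by (simp add: g_def)
    thus ?thesis using nonzero by (simp add: sums_iff)
  qed
  ultimately show ?thesis by (simp add: has_sum_imp_sums)
qed

lemma t_coeff_eq_binomial_transform:
  "t_coeff n = (\<Sum>j\<le>n. (n choose j) * 2 ^ (n - j) * (if even j then b_coeff (j div 2) else 0))"
proof -
  have "(\<Sum>j\<le>n. (n choose j) * 2 ^ (n - j) * (if even j then b_coeff (j div 2) else 0)) =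
      (\<Sum>j | j \<le> n \<and> even j. (n choose j) * 2 ^ (n - j) * b_coeff (j div 2))"
    by (intro sum.mono_neutral_cong_right) auto
  also have "\<dots> = (\<Sum>i\<le>n div 2. (n choose (2 * i)) * 2 ^ (n - 2 * i) * b_coeff i)"
    by (intro sum.reindex_bij_witness[of _ "\<lambda>i. 2 * i" "\<lambda>j. j div 2"]) auto
  finally show ?thesis by (simp only: t_coeff_eq_b_coeff_sum)
qed

lemma t_coeff_sums:
  fixes x :: complex
  assumes "norm x < 1 / 10"
  shows "(\<lambda>n. of_nat (t_coeff n) * x ^ n) sums
           (1 / (1 - 2 * x) * (\<Sum>j. of_nat (b_coeff j) * ((x / (1 - 2 * x))\<^sup>2) ^ j))"
proof -
  define a where "a = (\<lambda>j. if even j then of_nat (b_coeff (j div 2)) else 0 :: complex)"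
  have "norm (a j) \<le> 8 ^ j" for j
  proof (cases "even j")
    case True
    then obtain i where "j = 2 * i" by (elim evenE)
    moreover have "real (b_coeff i) \<le> (8\<^sup>2) ^ i" using b_coeff_le[of i] by (simp flip: of_nat_le_iff)
    ultimately show ?thesis by (simp add: a_def power_mult)
  qed (simp add: a_def)
  define r where "r = norm x / (1 - norm (2 * x))"
  have r_bounds: "0 \<le> r" "8 * r < 1" using assms by (auto simp: r_def norm_mult field_simps)
  have "summable (\<lambda>j. norm (a j) * r ^ j)"
  proof (rule summable_comparison_test')
    show "norm (norm (a j) * r ^ j) \<le> (8 * r) ^ j" for j
      using \<open>norm (a j) \<le> 8 ^ j\<close> r_bounds by (simp add: power_mult_distrib mult_right_mono)
    show "summable (\<lambda>j. (8 * r) ^ j)" by (rule summable_geometric) (use r_bounds in simp)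
  qed
  hence "(\<lambda>n. (\<Sum>j\<le>n. of_nat (n choose j) * 2 ^ (n - j) * a j) * x ^ n) sums
      (1 / (1 - 2 * x) * (\<Sum>j. a j * (x / (1 - 2 * x)) ^ j))"
    unfolding r_def using assms by (intro binomial_transform_sums) (auto simp: norm_mult)
  moreover have "(\<Sum>j\<le>n. of_nat (n choose j) * 2 ^ (n - j) * a j) = of_nat (t_coeff n)" for n
    unfolding t_coeff_eq_binomial_transform a_def of_nat_sum by (intro sum.cong refl) simp
  moreover have "(\<Sum>j. a j * y ^ j) = (\<Sum>j. of_nat (b_coeff j) * (y\<^sup>2) ^ j)" for y
  proof -
    have "(\<Sum>i. a (2 * i) * y ^ (2 * i)) = (\<Sum>j. a j * y ^ j)"
      by (rule suminf_mono_reindex) (auto simp: strict_mono_def a_def)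
    thus ?thesis by (simp add: a_def power_mult)
  qed
  ultimately show ?thesis by simp
qed

section \<open>Derivations and symmetric squares\<close>

definition deriv_along ::
    "(complex \<Rightarrow> complex) \<Rightarrow> (complex \<Rightarrow> complex) \<Rightarrow> complex \<Rightarrow> complex \<Rightarrow> bool" where
  "deriv_along P f d z \<longleftrightarrow> (\<exists>D. (f has_field_derivative D) (at z) \<and> d = P z * D)"

lemma deriv_alongI: "(f has_field_derivative D) (at z) \<Longrightarrow> d = P z * D \<Longrightarrow> deriv_along P f d z"
  unfolding deriv_along_def by blast

lemma deriv_alongE:
  assumes "deriv_along P f d z"
  obtains D where "(f has_field_derivative D) (at z)" "d = P z * D"
  using assms unfolding deriv_along_def by blast

lemma deriv_along_eq_rhs: "deriv_along P f d z \<Longrightarrow> d = d' \<Longrightarrow> deriv_along P f d' z"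
  by simp

lemma deriv_along_const: "deriv_along P (\<lambda>z. c) 0 z"
  by (rule deriv_alongI[OF DERIV_const]) simp

lemma deriv_along_ident: "deriv_along P (\<lambda>z. z) (P z) z"
  by (rule deriv_alongI[OF DERIV_ident]) simp

lemma deriv_along_add:
  "deriv_along P f a z \<Longrightarrow> deriv_along P g b z \<Longrightarrow> deriv_along P (\<lambda>z. f z + g z) (a + b) z"
  by (elim deriv_alongE, rule deriv_alongI[OF DERIV_add]) (auto simp: algebra_simps)

lemma deriv_along_diff:
  "deriv_along P f a z \<Longrightarrow> deriv_along P g b z \<Longrightarrow> deriv_along P (\<lambda>z. f z - g z) (a - b) z"
  by (elim deriv_alongE, rule deriv_alongI[OF DERIV_diff]) (auto simp: algebra_simps)

lemma deriv_along_mult: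
  "deriv_along P f a z \<Longrightarrow> deriv_along P g b z \<Longrightarrow> deriv_along P (\<lambda>z. f z * g z) (a * g z + f z * b) z"
  by (elim deriv_alongE, rule deriv_alongI[OF DERIV_mult]) (auto simp: algebra_simps)

lemma deriv_along_divide:
  "deriv_along P f a z \<Longrightarrow> deriv_along P g b z \<Longrightarrow> g z \<noteq> 0 \<Longrightarrow>
     deriv_along P (\<lambda>z. f z / g z) ((a * g z - f z * b) / (g z)\<^sup>2) z"
  by (elim deriv_alongE, rule deriv_alongI[OF DERIV_divide])
     (auto simp: algebra_simps power2_eq_square)

lemma deriv_along_power:
  "deriv_along P f a z \<Longrightarrow> deriv_along P (\<lambda>z. f z ^ n) (of_nat n * f z ^ (n - 1) * a) z"
  by (elim deriv_alongE, rule deriv_alongI[OF DERIV_power]) (auto simp: algebra_simps)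

lemmas deriv_along_eq_intros =
  deriv_along_const[THEN deriv_along_eq_rhs] deriv_along_ident[THEN deriv_along_eq_rhs]
  deriv_along_add[THEN deriv_along_eq_rhs] deriv_along_diff[THEN deriv_along_eq_rhs]
  deriv_along_mult[THEN deriv_along_eq_rhs] deriv_along_divide[THEN deriv_along_eq_rhs]
  deriv_along_power[THEN deriv_along_eq_rhs]

lemma deriv_along_compose:
  assumes "deriv_along P f d (g z)" "deriv_along P' g (c * P (g z)) z"
  shows "deriv_along P' (\<lambda>z. f (g z)) (c * d) z"
proof -
  obtain D where f_deriv: "(f has_field_derivative D) (at (g z))" "d = P (g z) * D"
    using assms(1) by (rule deriv_alongE)
  obtain E where g_deriv: "(g has_field_derivative E) (at z)" "c * P (g z) = P' z * E"
    using assms(2) by (rule deriv_alongE)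
  show ?thesis
    by (rule deriv_alongI[OF DERIV_chain2[OF f_deriv(1) g_deriv(1)]])
       (use f_deriv(2) g_deriv(2) in algebra)
qed

lemma deriv_along_scale: "deriv_along P f d z \<Longrightarrow> deriv_along (\<lambda>z. P z * k z) f (k z * d) z"
  by (auto simp: deriv_along_def)

lemma deriv_along_unique: "deriv_along P f a z \<Longrightarrow> deriv_along P f b z \<Longrightarrow> a = b"
  by (metis deriv_alongE DERIV_unique)

lemma deriv_along_cong:
  assumes "deriv_along P f d z" "\<forall>\<^sub>F w in nhds z. f w = g w"
  shows "deriv_along P g d z"
  using assms DERIV_cong_ev[OF refl assms(2) refl] unfolding deriv_along_def by simp

lemma deriv_along_imp_isCont: "deriv_along P f d z \<Longrightarrow> isCont f z"
  by (metis deriv_alongE DERIV_isCont)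

lemma deriv_along_zero_imp_constant:
  assumes "\<forall>\<^sub>F z in nhds 0. deriv_along P f 0 z" "\<forall>\<^sub>F z in at 0. P z \<noteq> 0"
  shows "\<forall>\<^sub>F z in nhds 0. f z = f 0"
proof -
  have "\<forall>\<^sub>F z in nhds 0. deriv_along P f 0 z \<and> (z \<noteq> 0 \<longrightarrow> P z \<noteq> 0)"
    using assms by (simp add: eventually_conj_iff eventually_at_filter)
  then obtain r where "r > 0" and r_ball: "\<And>z. norm z < r \<Longrightarrow> deriv_along P f 0 z \<and> (z \<noteq> 0 \<longrightarrow> P z \<noteq> 0)"
    by (auto simp: eventually_nhds_metric)
  have cont: "isCont f z" if "norm z < r" for z :: complex
    using r_ball[OF that] deriv_along_imp_isCont by blast
  have "f z = f 0" if "norm z < r" for z :: complex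
  proof (rule has_derivative_zero_unique_strong_convex[of "ball 0 r" "{0}" f 0])
    show "continuous_on (ball 0 r) f"
      using cont by (auto intro!: continuous_at_imp_continuous_on)
    fix x :: complex assume "x \<in> ball 0 r - {0}"
    hence "(f has_field_derivative 0) (at x)" using r_ball[of x] by (auto elim!: deriv_alongE)
    thus "(f has_derivative (\<lambda>h. 0)) (at x within ball 0 r)"
      by (simp add: has_field_derivative_def lambda_zero has_derivative_at_withinI)
  qed (use \<open>r > 0\<close> that in auto)
  thus ?thesis using \<open>r > 0\<close>
    unfolding eventually_nhds_metric dist_0_norm dist_commute[of _ 0] by blast
qed

lemma isCont_imp_eventually_nonzero:
  fixes f :: "'a::t2_space \<Rightarrow> 'b::{t1_space, zero}"
  assumes "isCont f a" "f a \<noteq> 0"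
  shows "\<forall>\<^sub>F z in nhds a. f z \<noteq> 0"
  using assms by (metis isCont_def tendsto_at_iff_tendsto_nhds tendsto_imp_eventually_ne)

definition sym_square_at ::
    "(complex \<Rightarrow> complex) \<Rightarrow> (complex \<Rightarrow> complex) \<Rightarrow> (complex \<Rightarrow> complex) \<Rightarrow> (complex \<Rightarrow> complex) \<Rightarrow>
      (complex \<Rightarrow> complex) \<Rightarrow> complex \<Rightarrow> bool" where
  "sym_square_at P \<rho> T T1 T2 z \<longleftrightarrow> deriv_along P T (T1 z) z \<and> deriv_along P T1 (T2 z) z \<and>
     2 * T z * T2 z - (T1 z)\<^sup>2 = 4 * \<rho> z * (T z)\<^sup>2"

text \<open>\<open>sym_square P \<rho> T\<close> says that, near 0, \<open>T\<close> is the square of a solution \<open>g\<close> of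
  \<open>(P d/dz)\<^sup>2 g = \<rho> g\<close>, without choosing a branch of \<open>g\<close>.\<close>

definition sym_square ::
    "(complex \<Rightarrow> complex) \<Rightarrow> (complex \<Rightarrow> complex) \<Rightarrow> (complex \<Rightarrow> complex) \<Rightarrow> bool" where
  "sym_square P \<rho> T \<longleftrightarrow> (\<exists>T1 T2. \<forall>\<^sub>F z in nhds 0. sym_square_at P \<rho> T T1 T2 z)"

lemma sym_squareI: "\<forall>\<^sub>F z in nhds 0. sym_square_at P \<rho> T T1 T2 z \<Longrightarrow> sym_square P \<rho> T"
  unfolding sym_square_def by blast

lemma sym_squareE:
  assumes "sym_square P \<rho> T"
  obtains T1 T2 where "\<forall>\<^sub>F z in nhds 0. sym_square_at P \<rho> T T1 T2 z"
  using assms unfolding sym_square_def by blast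

lemma sym_square_isCont: "sym_square P \<rho> T \<Longrightarrow> isCont T 0"
  unfolding sym_square_def sym_square_at_def
  by (auto dest!: eventually_nhds_x_imp_x intro: deriv_along_imp_isCont)

text \<open>With \<open>T = g\<^sup>2\<close> and \<open>U = h\<^sup>2\<close>, the function \<open>W\<close> below is \<open>2 g h\<close> times the Wronskian of
  \<open>g\<close> and \<open>h\<close>. That Wronskian is constant, and zero because \<open>P\<close> vanishes at 0.\<close>

lemma sym_square_wronskian_zero:
  assumes T_eqn: "\<forall>\<^sub>F z in nhds 0. sym_square_at P \<rho> T T1 T2 z"
    and U_eqn: "\<forall>\<^sub>F z in nhds 0. sym_square_at P \<rho> U U1 U2 z"
    and P_at_0: "P 0 = 0" "\<forall>\<^sub>F z in at 0. P z \<noteq> 0" and nonzero: "\<forall>\<^sub>F z in nhds 0. T z \<noteq> 0 \<and> U z \<noteq> 0"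
  shows "\<forall>\<^sub>F z in nhds 0. T z * U1 z = T1 z * U z"
proof -
  define W where "W = (\<lambda>z. T z * U1 z - T1 z * U z)"
  define V where "V = (\<lambda>z. (W z)\<^sup>2 / (T z * U z))"
  have "\<forall>\<^sub>F z in nhds 0. deriv_along P V 0 z"
    using T_eqn[unfolded sym_square_at_def] U_eqn[unfolded sym_square_at_def] nonzero
  proof eventually_elim
    case (elim z)
    have W_deriv: "deriv_along P W (T z * U2 z - T2 z * U z) z"
      unfolding W_def using elim by (auto intro!: deriv_along_eq_intros simp: algebra_simps)
    have "2 * W z * (T z * U2 z - T2 z * U z) * (T z * U z) = (W z)\<^sup>2 * (T1 z * U z + T z * U1 z)"
      unfolding W_def using elim by algebra
    thus ?case unfolding V_def using elim W_deriv
      by (auto intro!: deriv_along_eq_intros simp: algebra_simps)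
  qed
  hence V_const: "\<forall>\<^sub>F z in nhds 0. V z = V 0" by (rule deriv_along_zero_imp_constant[OF _ P_at_0(2)])
  have "V 0 = 0"
    using eventually_nhds_x_imp_x[OF T_eqn] eventually_nhds_x_imp_x[OF U_eqn] P_at_0(1)
    by (auto simp: V_def W_def sym_square_at_def deriv_along_def)
  show ?thesis using V_const nonzero
  proof eventually_elim
    case (elim z)
    hence "V z = 0" using \<open>V 0 = 0\<close> by simp
    hence "W z = 0" using elim by (simp add: V_def)
    thus ?case by (simp add: W_def)
  qed
qed

lemma sym_square_proportional:
  assumes "sym_square P \<rho> T" "sym_square P \<rho> U"
    and P_at_0: "P 0 = 0" "\<forall>\<^sub>F z in at 0. P z \<noteq> 0" and nonzero: "T 0 \<noteq> 0" "U 0 \<noteq> 0"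
  shows "\<forall>\<^sub>F z in nhds 0. T z * U 0 = T 0 * U z"
proof -
  obtain T1 T2 where T_eqn: "\<forall>\<^sub>F z in nhds 0. sym_square_at P \<rho> T T1 T2 z"
    using assms(1) by (rule sym_squareE)
  obtain U1 U2 where U_eqn: "\<forall>\<^sub>F z in nhds 0. sym_square_at P \<rho> U U1 U2 z"
    using assms(2) by (rule sym_squareE)
  have TU_nonzero: "\<forall>\<^sub>F z in nhds 0. T z \<noteq> 0 \<and> U z \<noteq> 0"
    using sym_square_isCont[OF assms(1)] sym_square_isCont[OF assms(2)] nonzero
    by (intro eventually_conj isCont_imp_eventually_nonzero)
  have "\<forall>\<^sub>F z in nhds 0. deriv_along P (\<lambda>z. T z / U z) 0 z"
    using sym_square_wronskian_zero[OF T_eqn U_eqn P_at_0 TU_nonzero] T_eqn U_eqn TU_nonzero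
    unfolding sym_square_at_def
    by eventually_elim (auto intro!: deriv_along_eq_intros simp: algebra_simps)
  hence "\<forall>\<^sub>F z in nhds 0. T z / U z = T 0 / U 0"
    by (rule deriv_along_zero_imp_constant[OF _ P_at_0(2)])
  thus ?thesis using TU_nonzero by eventually_elim (use nonzero in \<open>simp add: frac_eq_eq\<close>)
qed

lemma liouville_identity:
  fixes c :: "'a::field_char_0"
  assumes "c \<noteq> 0"
  shows "c ^ 4 * (2 * (t / c) * (c * t2 - t1 * c1 / c - t * (c2 / c\<^sup>2 - 2 * c1\<^sup>2 / c ^ 3))
      - (t1 - t * c1 / c\<^sup>2)\<^sup>2) =
     c ^ 4 * (2 * t * t2 - t1\<^sup>2) - (2 * c * c2 - 3 * c1\<^sup>2) * t\<^sup>2"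
  using assms by (simp add: field_simps eval_nat_numeral)

text \<open>Liouville's transformation of the second-order equation; the last assumption expresses
  \<open>\<rho>'\<close> by \<open>\<rho>\<close> and a Schwarzian derivative.\<close>

lemma sym_square_at_transform:
  assumes T_eqn: "sym_square_at P \<rho> T T1 T2 (g z)"
    and derivs: "deriv_along P' g (c z * P (g z)) z" "deriv_along P' c (c1 z) z"
      "deriv_along P' c1 (c2 z) z"
    and c_nonzero: "c z \<noteq> 0"
    and potential: "4 * (c z)\<^sup>2 * \<rho>' z = 4 * c z ^ 4 * \<rho> (g z) - 2 * c z * c2 z + 3 * (c1 z)\<^sup>2"
  shows "sym_square_at P' \<rho>' (\<lambda>z. T (g z) / c z) (\<lambda>z. T1 (g z) - T (g z) * c1 z / (c z)\<^sup>2)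
    (\<lambda>z. c z * T2 (g z) - T1 (g z) * c1 z / c z
       - T (g z) * (c2 z / (c z)\<^sup>2 - 2 * (c1 z)\<^sup>2 / c z ^ 3)) z"
    (is "sym_square_at P' \<rho>' ?U ?U1 ?U2 z")
  unfolding sym_square_at_def
proof (intro conjI)
  have T_g_derivs: "deriv_along P' (\<lambda>z. T (g z)) (c z * T1 (g z)) z"
      "deriv_along P' (\<lambda>z. T1 (g z)) (c z * T2 (g z)) z"
    using T_eqn derivs(1) deriv_along_compose[of P _ _ g z P' "c z"]
    unfolding sym_square_at_def by blast+
  show "deriv_along P' ?U (?U1 z) z"
    using T_g_derivs derivs c_nonzero
    by (auto intro!: deriv_along_eq_intros simp: field_simps power2_eq_square)
  show "deriv_along P' ?U1 (?U2 z) z"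
    using T_g_derivs derivs c_nonzero
    by (auto intro!: deriv_along_eq_intros simp: field_simps power2_eq_square power3_eq_cube)
  have "c z ^ 4 * (2 * ?U z * ?U2 z - (?U1 z)\<^sup>2) = 4 * (c z)\<^sup>2 * \<rho>' z * (T (g z))\<^sup>2"
    unfolding liouville_identity[OF c_nonzero]
    using T_eqn[unfolded sym_square_at_def] potential by algebra
  also have "\<dots> = c z ^ 4 * (4 * \<rho>' z * (?U z)\<^sup>2)"
    using c_nonzero by (simp add: field_simps eval_nat_numeral)
  finally show "2 * ?U z * ?U2 z - (?U1 z)\<^sup>2 = 4 * \<rho>' z * (?U z)\<^sup>2"
    using c_nonzero by simp
qed

lemma sym_square_transform:
  assumes "sym_square P \<rho> T" and g_0: "g 0 = 0" and c_0: "c 0 \<noteq> 0"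
    and derivs: "\<forall>\<^sub>F z in nhds 0. deriv_along P' g (c z * P (g z)) z \<and> deriv_along P' c (c1 z) z \<and>
        deriv_along P' c1 (c2 z) z"
    and potential: "\<forall>\<^sub>F z in nhds 0. 4 * (c z)\<^sup>2 * \<rho>' z =
        4 * c z ^ 4 * \<rho> (g z) - 2 * c z * c2 z + 3 * (c1 z)\<^sup>2"
  shows "sym_square P' \<rho>' (\<lambda>z. T (g z) / c z)"
proof -
  obtain T1 T2 where T_eqn: "\<forall>\<^sub>F z in nhds 0. sym_square_at P \<rho> T T1 T2 z"
    using assms(1) by (rule sym_squareE)
  have "isCont g 0" "isCont c 0"
    using eventually_nhds_x_imp_x[OF derivs] by (blast intro: deriv_along_imp_isCont)+
  hence "filterlim g (nhds 0) (nhds 0)"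
    using g_0 by (metis isCont_def tendsto_at_iff_tendsto_nhds)
  note T_g_eqn = eventually_compose_filterlim[OF T_eqn this]
  have "\<forall>\<^sub>F z in nhds 0. c z \<noteq> 0"
    by (rule isCont_imp_eventually_nonzero[OF \<open>isCont c 0\<close> c_0])
  with T_g_eqn derivs potential
  have "\<forall>\<^sub>F z in nhds 0. sym_square_at P' \<rho>' (\<lambda>z. T (g z) / c z)
      (\<lambda>z. T1 (g z) - T (g z) * c1 z / (c z)\<^sup>2)
      (\<lambda>z. c z * T2 (g z) - T1 (g z) * c1 z / c z
         - T (g z) * (c2 z / (c z)\<^sup>2 - 2 * (c1 z)\<^sup>2 / c z ^ 3)) z"
    by eventually_elim (blast intro: sym_square_at_transform)
  thus ?thesis by (rule sym_squareI)
qed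

section \<open>The generating function of \<open>b_coeff\<close>\<close>

lemma powser_deriv_along:
  fixes c :: "nat \<Rightarrow> complex"
  assumes c_summable: "\<And>y. norm y < r \<Longrightarrow> summable (\<lambda>n. c n * y ^ n)" and norm_y: "norm y < r"
  shows "summable (\<lambda>n. of_nat n * c n * y ^ n)"
    and "deriv_along (\<lambda>y. y) (\<lambda>y. \<Sum>n. c n * y ^ n) (\<Sum>n. of_nat n * c n * y ^ n) y"
proof -
  have "summable (\<lambda>n. diffs c n * y ^ n)" by (rule termdiff_converges[OF norm_y c_summable])
  hence "(\<lambda>n. y * (diffs c n * y ^ n)) sums (y * (\<Sum>n. diffs c n * y ^ n))"
    by (intro sums_mult summable_sums)
  moreover have "y * (diffs c n * y ^ n) = of_nat (Suc n) * c (Suc n) * y ^ Suc n" for n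
    by (simp add: diffs_def mult_ac)
  ultimately have shifted: "(\<lambda>n. of_nat (Suc n) * c (Suc n) * y ^ Suc n) sums
      (y * (\<Sum>n. diffs c n * y ^ n))"
    by (simp only:)
  have "(\<lambda>n. of_nat n * c n * y ^ n) sums (y * (\<Sum>n. diffs c n * y ^ n))"
    using shifted by (subst (asm) sums_Suc_iff) simp
  thus "summable (\<lambda>n. of_nat n * c n * y ^ n)"
    and "deriv_along (\<lambda>y. y) (\<lambda>y. \<Sum>n. c n * y ^ n) (\<Sum>n. of_nat n * c n * y ^ n) y"
    by (auto simp: sums_iff intro: deriv_alongI[OF termdiffs_strong'[OF c_summable norm_y]])
qed

definition b_series :: "nat \<Rightarrow> complex \<Rightarrow> complex" where
  "b_series k y = (\<Sum>n. of_nat n ^ k * of_nat (b_coeff n) * y ^ n)"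

lemma b_series_at_0 [simp]: "b_series k 0 = (if k = 0 then 1 else 0)"
  unfolding b_series_def by (subst powser_zero) auto

lemma summable_b_series:
  "norm y < 1 / 64 \<Longrightarrow> summable (\<lambda>n. of_nat n ^ k * of_nat (b_coeff n) * y ^ n)" for y :: complex
proof (induction k arbitrary: y)
  case 0
  show ?case
  proof (rule summable_comparison_test'[of "\<lambda>n. (64 * norm y) ^ n" 0])
    show "summable (\<lambda>n. (64 * norm y) ^ n)" using 0 by (intro summable_geometric) simp
    fix n
    have "real (b_coeff n) \<le> 64 ^ n" using b_coeff_le[of n] by (simp flip: of_nat_le_iff)
    thus "norm (of_nat n ^ 0 * of_nat (b_coeff n) * y ^ n) \<le> (64 * norm y) ^ n"
      by (simp add: norm_mult norm_power power_mult_distrib mult_right_mono)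
  qed
next
  case (Suc k)
  from powser_deriv_along(1)[OF Suc.IH Suc.prems] show ?case by (simp add: mult.assoc)
qed

lemma b_series_deriv_along:
  assumes "norm y < 1 / 64"
  shows "deriv_along (\<lambda>y. y) (b_series k) (b_series (Suc k) y) y"
  using powser_deriv_along(2)[OF summable_b_series assms]
  unfolding b_series_def[abs_def] by (simp add: mult.assoc)

lemma b_series_ode:
  assumes norm_y: "norm y < 1 / 64"
  shows "b_series 3 y
     - y * (40 * b_series 3 y + 60 * b_series 2 y + 32 * b_series 1 y + 6 * b_series 0 y)
     + y\<^sup>2 * (144 * b_series 3 y + 432 * b_series 2 y + 396 * b_series 1 y + 108 * b_series 0 y) = 0"
proof -
  define b where "b = (\<lambda>n. of_nat (b_coeff n) :: complex)"
  have series: "(\<lambda>n. of_nat n ^ k * b n * y ^ n) sums b_series k y" for k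
    unfolding b_def b_series_def by (rule summable_sums[OF summable_b_series[OF norm_y]])
  have cubic_sums: "(\<lambda>n. (\<alpha> * of_nat n ^ 3 + \<beta> * of_nat n ^ 2 + \<gamma> * of_nat n + \<delta>) * b n * y ^ n)
      sums (\<alpha> * b_series 3 y + \<beta> * b_series 2 y + \<gamma> * b_series 1 y + \<delta> * b_series 0 y)" for \<alpha> \<beta> \<gamma> \<delta>
    using sums_add[OF sums_add[OF sums_add[OF
        sums_mult[OF series[of 3], of \<alpha>] sums_mult[OF series[of 2], of \<beta>]]
        sums_mult[OF series[of 1], of \<gamma>]] sums_mult[OF series[of 0], of \<delta>]]
    by (simp add: algebra_simps)
  have leading: "(\<lambda>n. (of_nat n + 1) ^ 3 * b (Suc n) * y ^ Suc n) sums b_series 3 y"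
    using series[of 3] sums_Suc_iff[of "\<lambda>n. of_nat n ^ 3 * b n * y ^ n"] by (simp add: add.commute)
  have middle:
    "(\<lambda>n. 2 * (2 * of_nat n + 1) * (10 * (of_nat n)\<^sup>2 + 10 * of_nat n + 3) * b n * y ^ Suc n) sums
      (y * (40 * b_series 3 y + 60 * b_series 2 y + 32 * b_series 1 y + 6 * b_series 0 y))"
    using sums_mult[OF cubic_sums[of 40 60 32 6], of y]
    by (rule sums_cong[THEN iffD1, rotated]) (simp, algebra)
  have "(\<lambda>n. 36 * (of_nat n + 1) * (4 * (of_nat n + 1)\<^sup>2 - 1) * b n * y ^ Suc (Suc n)) sums
      (y\<^sup>2 * (144 * b_series 3 y + 432 * b_series 2 y + 396 * b_series 1 y + 108 * b_series 0 y))"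
    using sums_mult[OF cubic_sums[of 144 432 396 108], of "y\<^sup>2"]
    by (rule sums_cong[THEN iffD1, rotated]) (simp, algebra)
  hence trailing: "(\<lambda>n. 36 * of_nat n * (4 * (of_nat n)\<^sup>2 - 1) * b (n - 1) * y ^ Suc n) sums
      (y\<^sup>2 * (144 * b_series 3 y + 432 * b_series 2 y + 396 * b_series 1 y + 108 * b_series 0 y))"
    using sums_Suc_iff[of "\<lambda>n. 36 * of_nat n * (4 * (of_nat n)\<^sup>2 - 1) * b (n - 1) * y ^ Suc n"]
    by (simp add: add.commute)
  have "(\<lambda>n. (of_nat n + 1) ^ 3 * b (Suc n) * y ^ Suc n) sums
      (y * (40 * b_series 3 y + 60 * b_series 2 y + 32 * b_series 1 y + 6 * b_series 0 y)
       - y\<^sup>2 * (144 * b_series 3 y + 432 * b_series 2 y + 396 * b_series 1 y + 108 * b_series 0 y))"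
    using sums_diff[OF middle trailing] unfolding b_def b_coeff_rec by (simp add: algebra_simps)
  from sums_unique2[OF leading this] show ?thesis by (simp add: algebra_simps)
qed

text \<open>The third-order equation is a symmetric square, whence it has a quadratic first integral.\<close>

lemma b_series_first_integral:
  "\<forall>\<^sub>F y in nhds 0. 2 * b_series 0 y *
      ((1 - 40 * y + 144 * y\<^sup>2) * b_series 2 y + (144 * y\<^sup>2 - 20 * y) * b_series 1 y)
     - (1 - 40 * y + 144 * y\<^sup>2) * (b_series 1 y)\<^sup>2 = 4 * (3 * y - 27 * y\<^sup>2) * (b_series 0 y)\<^sup>2"
proof -
  define J where "J = (\<lambda>y. 2 * b_series 0 y *
      ((1 - 40 * y + 144 * y\<^sup>2) * b_series 2 y + (144 * y\<^sup>2 - 20 * y) * b_series 1 y)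
     - (1 - 40 * y + 144 * y\<^sup>2) * (b_series 1 y)\<^sup>2 - 4 * (3 * y - 27 * y\<^sup>2) * (b_series 0 y)\<^sup>2)"
  have "deriv_along (\<lambda>y. y) J 0 y" if norm_y: "norm y < 1 / 64" for y
  proof -
    have b_derivs: "deriv_along (\<lambda>y. y) (b_series 0) (b_series 1 y) y"
      "deriv_along (\<lambda>y. y) (b_series 1) (b_series 2 y) y"
      "deriv_along (\<lambda>y. y) (b_series 2) (b_series 3 y) y"
      using b_series_deriv_along[OF norm_y, of 0] b_series_deriv_along[OF norm_y, of 1]
        b_series_deriv_along[OF norm_y, of 2]
      by (simp_all add: numeral_2_eq_2 numeral_3_eq_3)
    have "deriv_along (\<lambda>y. y) J (2 * b_series 0 y *
        (b_series 3 y
         - y * (40 * b_series 3 y + 60 * b_series 2 y + 32 * b_series 1 y + 6 * b_series 0 y)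
         + y\<^sup>2 * (144 * b_series 3 y + 432 * b_series 2 y + 396 * b_series 1 y +
         108 * b_series 0 y))) y"
      unfolding J_def
      by (rule deriv_along_eq_rhs, (rule deriv_along_eq_intros b_derivs refl)+) (simp, algebra)
    thus ?thesis unfolding b_series_ode[OF norm_y] by simp
  qed
  hence "\<forall>\<^sub>F y in nhds 0. deriv_along (\<lambda>y. y) J 0 y"
    unfolding eventually_nhds_metric by (intro exI[of _ "1 / 64"]) simp
  hence "\<forall>\<^sub>F y in nhds 0. J y = J 0"
    by (rule deriv_along_zero_imp_constant) (simp add: eventually_at_filter)
  thus ?thesis by eventually_elim (simp add: J_def)
qed

lemma sym_square_b_series:
  "sym_square (\<lambda>y. y * csqrt (1 - 40 * y + 144 * y\<^sup>2)) (\<lambda>y. 3 * y - 27 * y\<^sup>2) (b_series 0)"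
proof -
  define s where "s = (\<lambda>y::complex. 1 - 40 * y + 144 * y\<^sup>2)"
  define V where "V = (\<lambda>y. y * csqrt (s y))"
  have "filterlim (\<lambda>y. Re (s y)) (nhds (Re (s 0))) (nhds 0)"
    unfolding s_def by (intro tendsto_intros filterlim_ident)
  hence Re_s: "\<forall>\<^sub>F y in nhds 0. Re (s y) > 0" by (rule order_tendstoD) (simp add: s_def)
  have small: "\<forall>\<^sub>F y in nhds 0. norm (y :: complex) < 1 / 64"
    unfolding eventually_nhds_metric by (intro exI[of _ "1 / 64"]) simp
  have "\<forall>\<^sub>F y in nhds 0. sym_square_at V (\<lambda>y. 3 * y - 27 * y\<^sup>2) (b_series 0)
      (\<lambda>y. csqrt (s y) * b_series 1 y)
      (\<lambda>y. s y * b_series 2 y + (144 * y\<^sup>2 - 20 * y) * b_series 1 y) y"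
    using Re_s small b_series_first_integral
  proof eventually_elim
    case (elim y)
    have b_derivs: "deriv_along V (b_series 0) (csqrt (s y) * b_series 1 y) y"
      "deriv_along V (b_series 1) (csqrt (s y) * b_series 2 y) y"
      using b_series_deriv_along[OF elim(2), of 0] b_series_deriv_along[OF elim(2), of 1]
      unfolding V_def by (auto intro!: deriv_along_scale simp: numeral_2_eq_2)
    have "s y \<notin> \<real>\<^sub>\<le>\<^sub>0" "csqrt (s y) \<noteq> 0" using elim(1) by (auto elim!: nonpos_Reals_cases)
    from this(1)
    have "((\<lambda>y. csqrt (s y)) has_field_derivative ((288 * y - 40) / (2 * csqrt (s y)))) (at y)"
      unfolding s_def by (auto intro!: derivative_eq_intros)
    hence csqrt_deriv: "deriv_along V (\<lambda>y. csqrt (s y)) (144 * y\<^sup>2 - 20 * y) y"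
      by (rule deriv_alongI)
         (use \<open>csqrt (s y) \<noteq> 0\<close> in \<open>simp add: V_def field_simps power2_eq_square\<close>)
    have "deriv_along V (\<lambda>y. csqrt (s y) * b_series 1 y)
        (s y * b_series 2 y + (144 * y\<^sup>2 - 20 * y) * b_series 1 y) y"
      by (rule deriv_along_eq_rhs[OF deriv_along_mult[OF csqrt_deriv b_derivs(2)]])
         (simp flip: power2_eq_square mult.assoc)
    thus ?case using b_derivs(1) elim(3) by (simp add: sym_square_at_def power_mult_distrib s_def)
  qed
  thus ?thesis unfolding V_def s_def by (rule sym_squareI)
qed

section \<open>A quadratic transformation\<close>

definition p_cubic :: "complex \<Rightarrow> complex" where "p_cubic w = w * (1 - w) * (1 - 9 * w)"

definition y_of :: "complex \<Rightarrow> complex" where "y_of w = p_cubic w / (1 - 9 * w\<^sup>2)\<^sup>2"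

definition T_fun :: "complex \<Rightarrow> complex" where "T_fun w = b_series 0 (y_of w) / (1 - 9 * w\<^sup>2)"

lemma T_fun_at_0 [simp]: "T_fun 0 = 1"
  by (simp add: T_fun_def y_of_def p_cubic_def)

lemma p_cubic_deriv_along: "deriv_along p_cubic p_cubic (p_cubic w * (1 - 20 * w + 27 * w\<^sup>2)) w"
  unfolding p_cubic_def by (rule deriv_along_eq_rhs, (rule deriv_along_eq_intros refl)+) algebra

lemma y_of_deriv_along:
  assumes "1 - 9 * w\<^sup>2 \<noteq> 0"
  shows "deriv_along p_cubic y_of (y_of w * ((1 - 2 * w + 9 * w\<^sup>2) * (1 - 18 * w + 9 * w\<^sup>2))
      / (1 - 9 * w\<^sup>2)) w"
proof -
  define d where "d = (\<lambda>w::complex. 1 - 9 * w\<^sup>2)"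
  have nonzero: "d w \<noteq> 0" using assms by (simp add: d_def)
  have d_deriv: "deriv_along p_cubic d (- 18 * w * p_cubic w) w"
    unfolding d_def by (rule deriv_along_eq_rhs, (rule deriv_along_eq_intros refl)+) simp
  have y_of: "y_of = (\<lambda>w. p_cubic w / (d w)\<^sup>2)" by (simp add: fun_eq_iff y_of_def d_def)
  have "deriv_along p_cubic y_of
      (p_cubic w * ((1 - 20 * w + 27 * w\<^sup>2) * d w + 36 * w * p_cubic w) / d w ^ 3) w"
    unfolding y_of using nonzero
    by (auto intro!: deriv_along_eq_intros p_cubic_deriv_along[THEN deriv_along_eq_rhs]
        d_deriv[THEN deriv_along_eq_rhs] simp: field_simps eval_nat_numeral)
  moreover have "(1 - 20 * w + 27 * w\<^sup>2) * d w + 36 * w * p_cubic w =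
      (1 - 2 * w + 9 * w\<^sup>2) * (1 - 18 * w + 9 * w\<^sup>2)"
    unfolding d_def p_cubic_def by algebra
  ultimately show ?thesis by (elim deriv_along_eq_rhs) (simp add: y_of_def d_def eval_nat_numeral)
qed

lemma csqrt_discriminant_y_of:
  "\<forall>\<^sub>F w in nhds 0. csqrt (1 - 40 * y_of w + 144 * (y_of w)\<^sup>2)
     = (1 - 2 * w + 9 * w\<^sup>2) * (1 - 18 * w + 9 * w\<^sup>2) / (1 - 9 * w\<^sup>2)\<^sup>2"
proof -
  define l where "l = (\<lambda>w::complex. (1 - 2 * w + 9 * w\<^sup>2) * (1 - 18 * w + 9 * w\<^sup>2) / (1 - 9 * w\<^sup>2)\<^sup>2)"
  have "filterlim (\<lambda>w. Re (l w)) (nhds (Re (l 0))) (nhds 0)"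
    unfolding l_def by (intro tendsto_intros filterlim_ident) simp
  hence "\<forall>\<^sub>F w in nhds 0. Re (l w) > 0" by (rule order_tendstoD) (simp add: l_def)
  moreover have "\<forall>\<^sub>F w in nhds 0. 1 - 9 * w\<^sup>2 \<noteq> (0::complex)"
    by (rule isCont_imp_eventually_nonzero) auto
  ultimately show ?thesis
  proof eventually_elim
    case (elim w)
    have "1 - 40 * y_of w + 144 * (y_of w)\<^sup>2 = (l w)\<^sup>2"
    proof -
      have "((1 - 2 * w + 9 * w\<^sup>2) * (1 - 18 * w + 9 * w\<^sup>2))\<^sup>2
          = (1 - 9 * w\<^sup>2) ^ 4 - 40 * p_cubic w * (1 - 9 * w\<^sup>2)\<^sup>2 + 144 * (p_cubic w)\<^sup>2"
        unfolding p_cubic_def by algebra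
      hence "(l w)\<^sup>2 = ((1 - 9 * w\<^sup>2) ^ 4 - 40 * p_cubic w * (1 - 9 * w\<^sup>2)\<^sup>2 + 144 * (p_cubic w)\<^sup>2)
          / (1 - 9 * w\<^sup>2) ^ 4"
        by (simp add: l_def power_divide flip: power_mult)
      moreover have "(d ^ 4 - 40 * p * d\<^sup>2 + 144 * p\<^sup>2) / d ^ 4 = 1 - 40 * (p / d\<^sup>2) + 144 * (p / d\<^sup>2)\<^sup>2"
        if "d \<noteq> 0" for d p :: complex
        using that by (simp add: field_simps eval_nat_numeral)
      ultimately show ?thesis using elim(2) by (simp add: y_of_def)
    qed
    thus ?case using csqrt_square[of "l w"] elim(1) unfolding l_def by simp
  qed
qed

lemma potential_y_of:
  fixes w :: complex
  assumes "1 - 9 * w\<^sup>2 \<noteq> 0"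
  shows "4 * (1 - 9 * w\<^sup>2)\<^sup>2 * (p_cubic w * (3 - 9 * w)) =
      4 * (1 - 9 * w\<^sup>2) ^ 4 * (3 * y_of w - 27 * (y_of w)\<^sup>2)
      - 2 * (1 - 9 * w\<^sup>2) * (- 18 * p_cubic w * (p_cubic w + w * (1 - 20 * w + 27 * w\<^sup>2)))
      + 3 * (- 18 * w * p_cubic w)\<^sup>2"
proof -
  have "p_cubic w = y_of w * (1 - 9 * w\<^sup>2)\<^sup>2" unfolding y_of_def using assms by simp
  moreover have "4 * (1 - 9 * w\<^sup>2)\<^sup>2 * (p_cubic w * (3 - 9 * w)) =
      12 * (1 - 9 * w\<^sup>2)\<^sup>2 * p_cubic w - 108 * (p_cubic w)\<^sup>2
      - 2 * (1 - 9 * w\<^sup>2) * (- 18 * p_cubic w * (p_cubic w + w * (1 - 20 * w + 27 * w\<^sup>2)))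
      + 3 * (- 18 * w * p_cubic w)\<^sup>2"
    unfolding p_cubic_def by algebra
  ultimately show ?thesis by algebra
qed

lemma sym_square_T_fun: "sym_square p_cubic (\<lambda>w. p_cubic w * (3 - 9 * w)) T_fun"
  unfolding T_fun_def[abs_def]
proof (rule sym_square_transform[OF sym_square_b_series])
  have nonzero: "\<forall>\<^sub>F w in nhds 0. 1 - 9 * w\<^sup>2 \<noteq> (0::complex)"
    by (rule isCont_imp_eventually_nonzero) auto
  show "\<forall>\<^sub>F w in nhds 0. deriv_along p_cubic y_of
        ((1 - 9 * w\<^sup>2) * (y_of w * csqrt (1 - 40 * y_of w + 144 * (y_of w)\<^sup>2))) w \<and>
      deriv_along p_cubic (\<lambda>w. 1 - 9 * w\<^sup>2) (- 18 * w * p_cubic w) w \<and>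
      deriv_along p_cubic (\<lambda>w. - 18 * w * p_cubic w)
        (- 18 * p_cubic w * (p_cubic w + w * (1 - 20 * w + 27 * w\<^sup>2))) w"
    using nonzero csqrt_discriminant_y_of
  proof eventually_elim
    case (elim w)
    have "deriv_along p_cubic y_of
        ((1 - 9 * w\<^sup>2) * (y_of w * csqrt (1 - 40 * y_of w + 144 * (y_of w)\<^sup>2))) w"
      by (rule deriv_along_eq_rhs[OF y_of_deriv_along[OF elim(1)]])
         (use elim in \<open>simp add: power2_eq_square\<close>)
    moreover have "deriv_along p_cubic (\<lambda>w. 1 - 9 * w\<^sup>2) (- 18 * w * p_cubic w) w"
      by (rule deriv_along_eq_rhs, (rule deriv_along_eq_intros refl)+) simp
    moreover have "deriv_along p_cubic (\<lambda>w. - 18 * w * p_cubic w)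
        (- 18 * p_cubic w * (p_cubic w + w * (1 - 20 * w + 27 * w\<^sup>2))) w"
      by (rule deriv_along_eq_rhs,
          (rule deriv_along_mult deriv_along_const deriv_along_ident p_cubic_deriv_along)+) algebra
    ultimately show ?case by blast
  qed
  show "\<forall>\<^sub>F w in nhds 0. 4 * (1 - 9 * w\<^sup>2)\<^sup>2 * (p_cubic w * (3 - 9 * w)) =
      4 * (1 - 9 * w\<^sup>2) ^ 4 * (3 * y_of w - 27 * (y_of w)\<^sup>2)
      - 2 * (1 - 9 * w\<^sup>2) * (- 18 * p_cubic w * (p_cubic w + w * (1 - 20 * w + 27 * w\<^sup>2)))
      + 3 * (- 18 * w * p_cubic w)\<^sup>2"
    using nonzero by eventually_elim (rule potential_y_of)
qed (simp_all add: y_of_def p_cubic_def)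

definition R_map :: "complex \<Rightarrow> complex" where "R_map v = v * (1 - v) / (1 + 3 * v)"

definition p_pullback :: "complex \<Rightarrow> complex" where
  "p_pullback v = v * (1 - v\<^sup>2) * (1 - 3 * v) / (1 + 3 * v)"

lemma R_map_factors:
  assumes "1 + 3 * v \<noteq> 0"
  shows "1 - R_map v = (1 + v)\<^sup>2 / (1 + 3 * v)" "1 - 9 * R_map v = (1 - 3 * v)\<^sup>2 / (1 + 3 * v)"
  using assms by (simp_all add: R_map_def field_simps power2_eq_square)

lemma p_cubic_R_map:
  assumes "1 + 3 * v \<noteq> 0"
  shows "p_cubic (R_map v) = v * (1 - v) * (1 + v)\<^sup>2 * (1 - 3 * v)\<^sup>2 / (1 + 3 * v) ^ 3"
  unfolding p_cubic_def R_map_factors[OF assms] by (simp add: R_map_def power3_eq_cube)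

lemma R_map_deriv_along:
  assumes "1 + 3 * v \<noteq> 0"
  shows "deriv_along p_pullback R_map (p_cubic (R_map v)) v"
proof (rule deriv_alongI)
  show "(R_map has_field_derivative (1 - 3 * v) * (1 + v) / (1 + 3 * v)\<^sup>2) (at v)"
    unfolding R_map_def[abs_def] using assms
    by (auto intro!: derivative_eq_intros simp: field_simps power2_eq_square)
  show "p_cubic (R_map v) = p_pullback v * ((1 - 3 * v) * (1 + v) / (1 + 3 * v)\<^sup>2)"
    unfolding p_cubic_R_map[OF assms] p_pullback_def using assms
    by (simp add: field_simps power2_eq_square power3_eq_cube)
qed

lemma eventually_one_plus_nonzero: "\<forall>\<^sub>F v in nhds 0. 1 + c * v \<noteq> (0::complex)"
  by (rule isCont_imp_eventually_nonzero) auto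

lemma sym_square_T_fun_R_map:
  "sym_square p_pullback (\<lambda>v. p_cubic (R_map v) * (3 - 9 * R_map v)) (\<lambda>v. T_fun (R_map v))"
proof -
  have "\<forall>\<^sub>F v in nhds 0. deriv_along p_pullback R_map (1 * p_cubic (R_map v)) v \<and>
      deriv_along p_pullback (\<lambda>v. 1) 0 v \<and> deriv_along p_pullback (\<lambda>v. 0) 0 v"
    using eventually_one_plus_nonzero[of 3]
    by eventually_elim (simp add: R_map_deriv_along deriv_along_const)
  from sym_square_transform[OF sym_square_T_fun _ _ this] show ?thesis by (simp add: R_map_def)
qed

lemma square_deriv_along:
  assumes "1 + 3 * v \<noteq> 0"
  shows "deriv_along p_pullback (\<lambda>v. v\<^sup>2) (2 / (1 + 3 * v)\<^sup>2 * p_cubic (v\<^sup>2)) v"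
proof (rule deriv_along_eq_rhs[OF deriv_along_power[OF deriv_along_ident]])
  have "p_cubic (v\<^sup>2) = v\<^sup>2 * (1 - v\<^sup>2) * (1 - 3 * v) * (1 + 3 * v)" unfolding p_cubic_def by algebra
  thus "of_nat 2 * v ^ (2 - 1) * p_pullback v = 2 / (1 + 3 * v)\<^sup>2 * p_cubic (v\<^sup>2)"
    using assms by (simp add: p_pullback_def power2_eq_square)
qed

lemma potential_R_map:
  fixes v :: complex
  defines "K \<equiv> v * (1 - v\<^sup>2) * (1 - 3 * v)" and "K' \<equiv> 1 - 6 * v - 3 * v\<^sup>2 + 12 * v ^ 3"
  assumes "1 + 3 * v \<noteq> 0"
  shows "16 * ((1 + 3 * v) ^ 4 * (p_cubic (R_map v) * (3 - 9 * R_map v))) =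
     64 * (p_cubic (v\<^sup>2) * (3 - 9 * v\<^sup>2)) + 48 * (K * (K' * (1 + 3 * v) - 12 * K)) + 432 * K\<^sup>2"
proof -
  define t where "t = 1 + 3 * v"
  have t_nonzero: "t \<noteq> 0" using assms(3) by (simp add: t_def)
  have "3 - 9 * R_map v = 3 * (1 + 3 * v\<^sup>2) / t"
    unfolding R_map_def t_def using assms(3) by (simp add: field_simps power2_eq_square)
  hence "t ^ 4 * (p_cubic (R_map v) * (3 - 9 * R_map v)) =
      3 * v * (1 - v) * (1 + v)\<^sup>2 * (1 - 3 * v)\<^sup>2 * (1 + 3 * v\<^sup>2)"
    unfolding p_cubic_R_map[OF assms(3)] t_def[symmetric]
    using t_nonzero by (simp add: eval_nat_numeral)
  thus ?thesis unfolding p_cubic_def K_def K'_def t_def by algebra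
qed

lemma inverse_square_derivs_along:
  fixes t K K' :: "complex \<Rightarrow> complex"
  defines "t \<equiv> \<lambda>v. 1 + 3 * v" and "K \<equiv> \<lambda>v. v * (1 - v\<^sup>2) * (1 - 3 * v)"
    and "K' \<equiv> \<lambda>v. 1 - 6 * v - 3 * v\<^sup>2 + 12 * v ^ 3"
  assumes nonzero: "t v \<noteq> 0"
  shows "deriv_along p_pullback (\<lambda>v. 2 / (t v)\<^sup>2) (- 12 * K v / t v ^ 4) v"
    and "deriv_along p_pullback (\<lambda>v. - 12 * K v / t v ^ 4)
        (- 12 * K v * (K' v * t v - 12 * K v) / t v ^ 6) v"
proof -
  have pullback: "p_pullback v = K v / t v" by (simp add: p_pullback_def K_def t_def)
  have t_deriv: "deriv_along p_pullback t (3 * K v / t v) v"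
    by (rule deriv_alongI[of _ 3]) (auto simp: pullback t_def intro!: derivative_eq_intros)
  have K_deriv: "deriv_along p_pullback K (K v * K' v / t v) v"
    by (rule deriv_alongI[of _ "K' v"])
       (auto simp: pullback K_def K'_def algebra_simps eval_nat_numeral
          intro!: derivative_eq_intros)
  show "deriv_along p_pullback (\<lambda>v. 2 / (t v)\<^sup>2) (- 12 * K v / t v ^ 4) v"
    by (rule deriv_along_eq_rhs,
        (rule deriv_along_divide deriv_along_const deriv_along_power t_deriv)+)
       (use nonzero in \<open>simp_all add: field_simps eval_nat_numeral\<close>)
  show "deriv_along p_pullback (\<lambda>v. - 12 * K v / t v ^ 4)
      (- 12 * K v * (K' v * t v - 12 * K v) / t v ^ 6) v"
    by (rule deriv_along_eq_rhs,
        (rule deriv_along_divide deriv_along_mult deriv_along_const deriv_along_power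
          t_deriv K_deriv)+)
       (use nonzero in \<open>simp_all add: field_simps eval_nat_numeral\<close>)
qed

lemma sym_square_T_fun_square:
  "sym_square p_pullback (\<lambda>v. p_cubic (R_map v) * (3 - 9 * R_map v))
      (\<lambda>v. T_fun (v\<^sup>2) / (2 / (1 + 3 * v)\<^sup>2))"
proof (rule sym_square_transform[OF sym_square_T_fun])
  define t where "t = (\<lambda>v::complex. 1 + 3 * v)"
  define K where "K = (\<lambda>v::complex. v * (1 - v\<^sup>2) * (1 - 3 * v))"
  define K' where "K' = (\<lambda>v::complex. 1 - 6 * v - 3 * v\<^sup>2 + 12 * v ^ 3)"
  define c1 where "c1 = (\<lambda>v. - 12 * K v / t v ^ 4)"
  define c2 where "c2 = (\<lambda>v. - 12 * K v * (K' v * t v - 12 * K v) / t v ^ 6)"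
  have nonzero: "\<forall>\<^sub>F v in nhds 0. t v \<noteq> 0" unfolding t_def by (rule eventually_one_plus_nonzero)
  thus "\<forall>\<^sub>F v in nhds 0. deriv_along p_pullback (\<lambda>v. v\<^sup>2) (2 / (1 + 3 * v)\<^sup>2 * p_cubic (v\<^sup>2)) v \<and>
      deriv_along p_pullback (\<lambda>v. 2 / (1 + 3 * v)\<^sup>2) (c1 v) v \<and> deriv_along p_pullback c1 (c2 v) v"
    unfolding c1_def c2_def t_def K_def K'_def
    by eventually_elim (intro conjI square_deriv_along inverse_square_derivs_along)
  show "\<forall>\<^sub>F v in nhds 0. 4 * (2 / (1 + 3 * v)\<^sup>2)\<^sup>2 * (p_cubic (R_map v) * (3 - 9 * R_map v)) =
      4 * (2 / (1 + 3 * v)\<^sup>2) ^ 4 * (p_cubic (v\<^sup>2) * (3 - 9 * v\<^sup>2))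
      - 2 * (2 / (1 + 3 * v)\<^sup>2) * c2 v + 3 * (c1 v)\<^sup>2"
    using nonzero
  proof eventually_elim
    case (elim v)
    have "4 * (2 / (t v)\<^sup>2)\<^sup>2 * (p_cubic (R_map v) * (3 - 9 * R_map v)) =
        16 * (t v ^ 4 * (p_cubic (R_map v) * (3 - 9 * R_map v))) / t v ^ 8"
      using elim by (simp add: power_divide eval_nat_numeral)
    also have "16 * (t v ^ 4 * (p_cubic (R_map v) * (3 - 9 * R_map v))) =
        64 * (p_cubic (v\<^sup>2) * (3 - 9 * v\<^sup>2)) + 48 * (K v * (K' v * t v - 12 * K v)) + 432 * (K v)\<^sup>2"
      using potential_R_map[of v] elim unfolding t_def K_def K'_def by blast
    also have "\<dots> / t v ^ 8 = 4 * (2 / (t v)\<^sup>2) ^ 4 * (p_cubic (v\<^sup>2) * (3 - 9 * v\<^sup>2))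
        - 2 * (2 / (t v)\<^sup>2) * c2 v + 3 * (c1 v)\<^sup>2"
      unfolding c1_def c2_def
      by (simp add: power_divide add_divide_distrib power_mult_distrib flip: power_mult power_add)
    finally show ?case unfolding t_def .
  qed
qed simp_all

lemma T_fun_functional_equation: "\<forall>\<^sub>F v in nhds 0. T_fun (R_map v) = (1 + 3 * v)\<^sup>2 * T_fun (v\<^sup>2)"
proof -
  have "\<forall>\<^sub>F v in nhds 0. 1 + 3 * v \<noteq> 0 \<and> 1 + (- 3) * v \<noteq> 0 \<and> 1 + 1 * v \<noteq> 0 \<and>
      1 + (- 1) * v \<noteq> (0::complex)"
    by (intro eventually_conj eventually_one_plus_nonzero)
  hence "\<forall>\<^sub>F v in at 0. p_pullback v \<noteq> 0"
    unfolding eventually_at_filter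
  proof eventually_elim
    case (elim v)
    have "1 - v\<^sup>2 = (1 + v) * (1 - v)" by (simp add: algebra_simps power2_eq_square)
    thus ?case using elim by (simp add: p_pullback_def)
  qed
  from sym_square_proportional[OF sym_square_T_fun_R_map sym_square_T_fun_square _ this]
  have "\<forall>\<^sub>F v in nhds 0. T_fun (R_map v) * (1 / 2) = T_fun (v\<^sup>2) / (2 / (1 + 3 * v)\<^sup>2)"
    by (simp add: p_pullback_def R_map_def)
  thus ?thesis by eventually_elim simp
qed

section \<open>Jacobi's triple product\<close>

definition qpoch :: "complex \<Rightarrow> complex \<Rightarrow> nat \<Rightarrow> complex" where
  "qpoch a q n = (\<Prod>k<n. 1 - a * q ^ k)"

definition qpoch_inf :: "complex \<Rightarrow> complex \<Rightarrow> complex" where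
  "qpoch_inf a q = (\<Prod>k. 1 - a * q ^ k)"

lemma qpoch_0 [simp]: "qpoch a q 0 = 1"
  by (simp add: qpoch_def)

lemma qpoch_Suc: "qpoch a q (Suc n) = qpoch a q n * (1 - a * q ^ n)"
  by (simp add: qpoch_def)

lemma convergent_qpoch:
  fixes a q :: complex
  assumes "norm q < 1"
  shows "convergent_prod (\<lambda>k. 1 - a * q ^ k)"
proof -
  have "summable (\<lambda>k. norm (- a * q ^ k))"
    using assms by (simp add: norm_mult norm_power summable_mult summable_geometric)
  hence "convergent_prod (\<lambda>k. 1 + - a * q ^ k)"
    by (intro abs_convergent_prod_imp_convergent_prod summable_imp_abs_convergent_prod) simp
  thus ?thesis by simp
qed

lemma qpoch_LIMSEQ: "norm q < 1 \<Longrightarrow> qpoch a q \<longlonglongrightarrow> qpoch_inf a q"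
  using convergent_prod_LIMSEQ[OF convergent_qpoch[of q a]]
  by (simp add: qpoch_def[abs_def] qpoch_inf_def LIMSEQ_lessThan_iff_atMost)

lemma mult_power_neq_1:
  fixes a q :: complex
  assumes "norm q < 1" "norm a < 1"
  shows "a * q ^ k \<noteq> 1"
proof
  assume "a * q ^ k = 1"
  hence "norm a * norm q ^ k = 1" by (metis norm_mult norm_one norm_power)
  moreover have "norm a * norm q ^ k \<le> norm a" using assms by (intro mult_left_le power_le_one) auto
  ultimately show False using assms by simp
qed

lemma qpoch_nonzero: "norm q < 1 \<Longrightarrow> norm a < 1 \<Longrightarrow> qpoch a q n \<noteq> 0"
  by (simp add: qpoch_def mult_power_neq_1)

lemma qpoch_inf_nonzero: "norm q < 1 \<Longrightarrow> norm a < 1 \<Longrightarrow> qpoch_inf a q \<noteq> 0"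
  unfolding qpoch_inf_def
  by (rule prodinf_nonzero[OF convergent_qpoch])
     (use mult_power_neq_1[of q a] in \<open>simp_all add: eq_commute[of 1]\<close>)

lemma norm_power_less_1: "norm (q::complex) < 1 \<Longrightarrow> n > 0 \<Longrightarrow> norm (q ^ n) < 1"
  by (simp add: norm_power power_less_one_iff)

lemma qpoch_inf_Suc:
  assumes "norm q < 1"
  shows "qpoch_inf a q = (1 - a) * qpoch_inf (a * q) q"
proof (rule LIMSEQ_unique)
  have "qpoch a q (Suc n) = (1 - a) * qpoch (a * q) q n" for n
    unfolding qpoch_def by (subst prod.lessThan_Suc_shift) (simp add: mult.assoc)
  moreover have "(\<lambda>n. (1 - a) * qpoch (a * q) q n) \<longlonglongrightarrow> (1 - a) * qpoch_inf (a * q) q"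
    by (intro tendsto_mult_left qpoch_LIMSEQ assms)
  ultimately show "(\<lambda>n. qpoch a q (Suc n)) \<longlonglongrightarrow> (1 - a) * qpoch_inf (a * q) q" by simp
qed (intro LIMSEQ_Suc qpoch_LIMSEQ assms)

lemma qpoch_inf_mult_uminus:
  assumes "norm q < 1"
  shows "qpoch_inf a q * qpoch_inf (- a) q = qpoch_inf (a\<^sup>2) (q\<^sup>2)"
proof (rule LIMSEQ_unique)
  have "qpoch a q n * qpoch (- a) q n = qpoch (a\<^sup>2) (q\<^sup>2) n" for n
    unfolding qpoch_def prod.distrib[symmetric]
    by (intro prod.cong refl) (simp add: algebra_simps power2_eq_square power_mult_distrib)
  thus "qpoch (a\<^sup>2) (q\<^sup>2) \<longlonglongrightarrow> qpoch_inf a q * qpoch_inf (- a) q"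
    using tendsto_mult[OF qpoch_LIMSEQ[OF assms] qpoch_LIMSEQ[OF assms], of a "- a"] by simp
qed (intro qpoch_LIMSEQ norm_power_less_1 assms, simp)

lemma qpoch_inf_even_odd:
  assumes "norm q < 1"
  shows "qpoch_inf a q = qpoch_inf a (q\<^sup>2) * qpoch_inf (a * q) (q\<^sup>2)"
proof (rule LIMSEQ_unique)
  have "qpoch a q (2 * n) = qpoch a (q\<^sup>2) n * qpoch (a * q) (q\<^sup>2) n" for n
    by (induction n) (simp_all add: qpoch_Suc mult_ac flip: power_mult)
  moreover have "(\<lambda>n. qpoch a (q\<^sup>2) n * qpoch (a * q) (q\<^sup>2) n)
      \<longlonglongrightarrow> qpoch_inf a (q\<^sup>2) * qpoch_inf (a * q) (q\<^sup>2)"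
    by (intro tendsto_mult qpoch_LIMSEQ norm_power_less_1 assms) simp_all
  ultimately show "(\<lambda>n. qpoch a q (2 * n)) \<longlonglongrightarrow> qpoch_inf a (q\<^sup>2) * qpoch_inf (a * q) (q\<^sup>2)" by simp
  show "(\<lambda>n. qpoch a q (2 * n)) \<longlonglongrightarrow> qpoch_inf a q"
    by (rule filterlim_compose[OF qpoch_LIMSEQ[OF assms] filterlim_subseq])
       (simp add: strict_mono_def)
qed

definition central_qbinom :: "complex \<Rightarrow> nat \<Rightarrow> int \<Rightarrow> complex" where
  "central_qbinom p n j = (if \<bar>j\<bar> \<le> int n
     then qpoch p p (2 * n) / (qpoch p p (nat (int n - j)) * qpoch p p (nat (int n + j))) else 0)"

lemma central_qbinom_uminus: "central_qbinom p n (- j) = central_qbinom p n j"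
  by (simp add: central_qbinom_def mult.commute)

lemma central_qbinom_pred:
  assumes norm_p: "norm p < 1" and j_range: "\<bar>j\<bar> \<le> int n"
  shows "(1 - p ^ nat (int n - j + 1)) * central_qbinom p n (j - 1) =
      (1 - p ^ nat (int n + j)) * central_qbinom p n j"
proof (cases "j = - int n")
  case False
  define a where "a = nat (int n - j)"
  define b where "b = nat (int n + j - 1)"
  have "nat (int n - j + 1) = Suc a" "nat (int n - (j - 1)) = Suc a" "nat (int n - j) = a"
    "nat (int n + (j - 1)) = b" "nat (int n + j) = Suc b" "\<bar>j - 1\<bar> \<le> int n"
    using j_range False by (auto simp: a_def b_def)
  moreover have "1 - p ^ Suc k \<noteq> 0" for k using mult_power_neq_1[OF norm_p norm_p] by simp
  ultimately show ?thesis
    using j_range qpoch_nonzero[OF norm_p norm_p]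
    by (simp add: central_qbinom_def qpoch_Suc field_simps)
qed (simp add: central_qbinom_def)

lemma central_qbinom_succ:
  assumes norm_p: "norm p < 1" and j_range: "\<bar>j\<bar> \<le> int n"
  shows "(1 - p ^ nat (int n + j + 1)) * central_qbinom p n (j + 1) =
    (1 - p ^ nat (int n - j)) * central_qbinom p n j"
  using central_qbinom_pred[OF norm_p, of "- j" n] j_range central_qbinom_uminus[of p n "j + 1"]
  by (simp add: central_qbinom_uminus del: power_Suc)

lemma central_qbinom_Suc:
  assumes norm_p: "norm p < 1" and j_range: "\<bar>j\<bar> \<le> int n + 1"
  shows "central_qbinom p (Suc n) j = (1 + p ^ (2 * n + 1)) * central_qbinom p n j +
     p ^ nat (int n + 1 - j) * central_qbinom p n (j - 1) +
     p ^ nat (int n + 1 + j) * central_qbinom p n (j + 1)"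
proof -
  consider (top) "j = int n + 1" | (bottom) "j = - int n - 1" | (inner) "\<bar>j\<bar> \<le> int n"
    using j_range by linarith
  thus ?thesis
  proof cases
    case inner
    define a b x where "a = nat (int n - j)" and "b = nat (int n + j)"
      and "x = central_qbinom p n j"
    have n_eq: "2 * n = a + b" using inner by (auto simp: a_def b_def)
    have nat_eqs: "nat (int n + 1 - j) = Suc a" "nat (int n + 1 + j) = Suc b"
      "nat (int n - j + 1) = Suc a"
      "nat (int n + j + 1) = Suc b" "nat (1 + int n - j) = Suc a" "nat (1 + int n + j) = Suc b"
      "nat (int n - j) = a" "nat (int n + j) = b"
      using inner by (auto simp: a_def b_def)
    have factors: "1 - p ^ Suc a \<noteq> 0" "1 - p ^ Suc b \<noteq> 0"
      using mult_power_neq_1[OF norm_p norm_p] by simp_all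
    have pred: "central_qbinom p n (j - 1) = (1 - p ^ b) * x / (1 - p ^ Suc a)"
      using central_qbinom_pred[OF norm_p inner] factors
      unfolding nat_eqs x_def by (simp add: field_simps)
    have succ: "central_qbinom p n (j + 1) = (1 - p ^ a) * x / (1 - p ^ Suc b)"
      using central_qbinom_succ[OF norm_p inner] factors
      unfolding nat_eqs x_def by (simp add: field_simps)
    have "central_qbinom p (Suc n) j =
        (1 - p ^ (a + b + 1)) * (1 - p ^ (a + b + 2)) * x / ((1 - p ^ Suc a) * (1 - p ^ Suc b))"
      using inner factors qpoch_nonzero[OF norm_p norm_p]
      by (simp add: central_qbinom_def nat_eqs x_def qpoch_Suc n_eq) (simp add: mult_ac)
    also have "(1 - p ^ (a + b + 1)) * (1 - p ^ (a + b + 2)) =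
        (1 + p ^ (a + b + 1)) * ((1 - p ^ Suc a) * (1 - p ^ Suc b)) +
        p ^ Suc a * (1 - p ^ b) * (1 - p ^ Suc b) + p ^ Suc b * (1 - p ^ a) * (1 - p ^ Suc a)"
      unfolding power_add power_Suc by algebra
    finally show ?thesis
      unfolding nat_eqs pred succ x_def[symmetric] n_eq using factors by (simp add: field_simps)
  qed (use qpoch_nonzero[OF norm_p norm_p] in
      \<open>simp_all add: central_qbinom_def nat_add_distrib nat_mult_distrib\<close>)
qed

lemma theta_term_shift:
  fixes q z :: complex
  assumes "z \<noteq> 0" "\<bar>j\<bar> \<le> int n"
  shows "q ^ nat (j\<^sup>2) * z powi j * (q ^ (2 * n + 1) * z) =
     (q\<^sup>2) ^ nat (int n - j) * (q ^ nat ((j + 1)\<^sup>2) * z powi (j + 1))"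
proof -
  have "int (nat (j\<^sup>2) + (2 * n + 1)) = 2 * (int n - j) + (j + 1)\<^sup>2"
    by (simp add: power2_eq_square algebra_simps)
  also have "\<dots> = int (2 * nat (int n - j) + nat ((j + 1)\<^sup>2))" using assms by simp
  finally have "nat (j\<^sup>2) + (2 * n + 1) = 2 * nat (int n - j) + nat ((j + 1)\<^sup>2)"
    by (simp only: of_nat_eq_iff)
  hence "q ^ nat (j\<^sup>2) * q ^ (2 * n + 1) = (q\<^sup>2) ^ nat (int n - j) * q ^ nat ((j + 1)\<^sup>2)"
    unfolding power_mult[symmetric] power_add[symmetric] by (rule arg_cong)
  thus ?thesis using assms by (simp add: power_int_add mult_ac)
qed

lemma sum_int_window_shift:
  fixes f :: "int \<Rightarrow> 'a::comm_monoid_add"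
  assumes "\<And>j. \<bar>j\<bar> > int n \<Longrightarrow> f j = 0" "\<bar>d\<bar> \<le> 1"
  shows "(\<Sum>j\<in>{- int n..int n}. f j) = (\<Sum>j\<in>{- int (Suc n)..int (Suc n)}. f (j + d))"
proof -
  have "(\<Sum>j\<in>{- int n..int n}. f j) = (\<Sum>j\<in>{- int (Suc n) + d..int (Suc n) + d}. f j)"
    using assms by (intro sum.mono_neutral_left) auto
  also have "\<dots> = (\<Sum>j\<in>{- int (Suc n)..int (Suc n)}. f (j + d))"
    by (rule sum.reindex_bij_witness[of _ "\<lambda>j. j + d" "\<lambda>j. j - d"]) auto
  finally show ?thesis .
qed

lemma theta_window_sum_mult:
  fixes q z :: complex
  assumes z_nonzero: "z \<noteq> 0" and c_outside: "\<And>j. \<bar>j\<bar> > int n \<Longrightarrow> c j = 0"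
  shows "(\<Sum>j\<in>{- int n..int n}. c j * (q ^ nat (j\<^sup>2) * z powi j)) * (q ^ (2 * n + 1) * z) =
    (\<Sum>j\<in>{- int (Suc n)..int (Suc n)}.
       (q\<^sup>2) ^ nat (int n + 1 - j) * c (j - 1) * (q ^ nat (j\<^sup>2) * z powi j))"
proof -
  define u where "u = (\<lambda>j::int. q ^ nat (j\<^sup>2) * z powi j)"
  have "u j * (q ^ (2 * n + 1) * z) = (q\<^sup>2) ^ nat (int n - j) * u (j + 1)"
    if "j \<in> {- int n..int n}" for j
    unfolding u_def by (rule theta_term_shift[OF z_nonzero]) (use that in auto)
  hence "(\<Sum>j\<in>{- int n..int n}. c j * u j) * (q ^ (2 * n + 1) * z) =
      (\<Sum>j\<in>{- int n..int n}. c j * ((q\<^sup>2) ^ nat (int n - j) * u (j + 1)))"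
    unfolding sum_distrib_right by (intro sum.cong refl) (simp only: mult.assoc)
  also have "\<dots> = (\<Sum>j\<in>{- int (Suc n)..int (Suc n)}. (q\<^sup>2) ^ nat (int n + 1 - j) * c (j - 1) * u j)"
    by (subst sum_int_window_shift[where d = "- 1"]) (auto simp: c_outside algebra_simps)
  finally show ?thesis unfolding u_def .
qed

lemma theta_window_sum_divide:
  fixes q z :: complex
  assumes z_nonzero: "z \<noteq> 0" and c_outside: "\<And>j. \<bar>j\<bar> > int n \<Longrightarrow> c j = 0"
  shows "(\<Sum>j\<in>{- int n..int n}. c j * (q ^ nat (j\<^sup>2) * z powi j)) * (q ^ (2 * n + 1) / z) =
    (\<Sum>j\<in>{- int (Suc n)..int (Suc n)}.
       (q\<^sup>2) ^ nat (int n + 1 + j) * c (j + 1) * (q ^ nat (j\<^sup>2) * z powi j))"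
proof -
  have reflect: "(\<Sum>j\<in>{- int m..int m}. f (- j)) = (\<Sum>j\<in>{- int m..int m}. f j)"
    for f :: "int \<Rightarrow> complex" and m
    by (rule sum.reindex_bij_witness[of _ uminus uminus]) auto
  have inverse_powi: "inverse z powi i = z powi (- i)" for i
    by (simp add: power_int_inverse power_int_minus)
  show ?thesis
    using theta_window_sum_mult[of "inverse z" n "\<lambda>j. c (- j)" q] z_nonzero c_outside
    by (subst (1 2) reflect[symmetric]) (simp add: inverse_powi divide_inverse)
qed

lemma finite_triple_product:
  fixes q z :: complex
  assumes norm_q: "norm q < 1" and z_nonzero: "z \<noteq> 0"
  shows "qpoch (- (q * z)) (q\<^sup>2) n * qpoch (- (q / z)) (q\<^sup>2) n =
    (\<Sum>j\<in>{- int n..int n}. central_qbinom (q\<^sup>2) n j * (q ^ nat (j\<^sup>2) * z powi j))"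
proof (induction n)
  case 0
  show ?case by (simp add: central_qbinom_def)
next
  case (Suc n)
  define p c u where "p = q\<^sup>2" and "c = central_qbinom p n"
    and "u = (\<lambda>j::int. q ^ nat (j\<^sup>2) * z powi j)"
  let ?I = "\<lambda>n. {- int n..int n}"
  have norm_p: "norm p < 1" unfolding p_def by (rule norm_power_less_1[OF norm_q]) simp
  have c_outside: "c j = 0" if "\<bar>j\<bar> > int n" for j
    using that by (simp add: c_def central_qbinom_def)
  have up: "(\<Sum>j\<in>?I n. c j * u j) * (q ^ (2 * n + 1) * z) =
      (\<Sum>j\<in>?I (Suc n). p ^ nat (int n + 1 - j) * c (j - 1) * u j)"
    unfolding p_def u_def by (rule theta_window_sum_mult[OF z_nonzero c_outside])
  have down: "(\<Sum>j\<in>?I n. c j * u j) * (q ^ (2 * n + 1) / z) =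
      (\<Sum>j\<in>?I (Suc n). p ^ nat (int n + 1 + j) * c (j + 1) * u j)"
    unfolding p_def u_def by (rule theta_window_sum_divide[OF z_nonzero c_outside])
  have middle: "(\<Sum>j\<in>?I n. c j * u j) = (\<Sum>j\<in>?I (Suc n). c j * u j)"
    by (subst sum_int_window_shift[where d = 0]) (auto simp: c_outside)
  have "qpoch (- (q * z)) p (Suc n) * qpoch (- (q / z)) p (Suc n) =
      (\<Sum>j\<in>?I n. c j * u j) * ((1 + q ^ (2 * n + 1) * z) * (1 + q ^ (2 * n + 1) / z))"
    using Suc unfolding p_def c_def u_def by (simp add: qpoch_Suc mult_ac flip: power_mult)
  also have "(1 + q ^ (2 * n + 1) * z) * (1 + q ^ (2 * n + 1) / z) =
      (1 + p ^ (2 * n + 1)) + q ^ (2 * n + 1) * z + q ^ (2 * n + 1) / z"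
    using z_nonzero by (simp add: p_def field_simps flip: power_mult power_add)
  also have "(\<Sum>j\<in>?I n. c j * u j) * \<dots> = (\<Sum>j\<in>?I (Suc n). ((1 + p ^ (2 * n + 1)) * c j +
      p ^ nat (int n + 1 - j) * c (j - 1) + p ^ nat (int n + 1 + j) * c (j + 1)) * u j)"
    unfolding distrib_left up down unfolding middle
    by (simp add: distrib_left distrib_right sum.distrib sum_distrib_left mult_ac)
  also have "\<dots> = (\<Sum>j\<in>?I (Suc n). central_qbinom p (Suc n) j * u j)"
    unfolding c_def by (intro sum.cong refl) (subst central_qbinom_Suc[OF norm_p], auto)
  finally show ?case unfolding p_def u_def .
qed

lemma tendsto_infsum_dominated:
  fixes f :: "nat \<Rightarrow> 'a \<Rightarrow> 'b::{banach, second_countable_topology}"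
  assumes lim: "\<And>x. x \<in> A \<Longrightarrow> (\<lambda>n. f n x) \<longlonglongrightarrow> g x"
    and bound: "\<And>n x. x \<in> A \<Longrightarrow> norm (f n x) \<le> h x" and h_summable: "h summable_on A"
  shows "(\<lambda>n. \<Sum>\<^sub>\<infinity>x\<in>A. f n x) \<longlonglongrightarrow> (\<Sum>\<^sub>\<infinity>x\<in>A. g x)"
proof -
  have "norm (g x) \<le> h x" if "x \<in> A" for x
    by (rule LIMSEQ_le_const2[OF tendsto_norm[OF lim[OF that]]]) (use bound that in blast)
  hence norms: "(\<lambda>x. norm (g x)) summable_on A" "(\<lambda>x. norm (f n x)) summable_on A" for n
    using bound by (auto intro!: summable_on_comparison_test[OF h_summable])
  have "h x \<ge> 0" if "x \<in> A" for x by (rule order_trans[OF norm_ge_zero bound[OF that, of 0]])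
  hence "(\<lambda>x. norm (h x)) summable_on A" using h_summable by (simp cong: summable_on_cong)
  hence h_integrable: "integrable (count_space A) h"
    unfolding abs_summable_equivalent by (simp add: abs_summable_on_def)
  have "(\<lambda>n. infsetsum (f n) A) \<longlonglongrightarrow> infsetsum g A"
    unfolding infsetsum_def
    by (rule integral_dominated_convergence[where w = h])
       (use h_integrable lim bound in \<open>auto simp: AE_count_space\<close>)
  moreover have "infsetsum g A = infsum g A" "infsetsum (f n) A = infsum (f n) A" for n
    using norms by (auto intro!: infsetsum_infsum simp flip: abs_summable_equivalent)
  ultimately show ?thesis by simp
qed

lemma summable_on_int_if_nat:
  fixes f :: "int \<Rightarrow> real"
  assumes "\<And>n. f n \<ge> 0" "summable (\<lambda>n. f (int n))" "summable (\<lambda>n. f (- int n))"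
  shows "f summable_on UNIV"
proof -
  have "f summable_on range int" "f summable_on range (\<lambda>n. - int n)"
    using assms
    by (auto simp: summable_on_reindex inj_def o_def intro!: summable_nonneg_imp_summable_on)
  hence "f summable_on (range int \<union> range (\<lambda>n. - int n))" by (rule summable_on_union)
  moreover have "range int \<union> range (\<lambda>n. - int n) = UNIV"
  proof -
    have "j \<in> range int \<union> range (\<lambda>n. - int n)" for j by (cases j rule: int_cases2) auto
    thus ?thesis by blast
  qed
  ultimately show ?thesis by simp
qed

lemma theta_abs_summable:
  fixes q z :: complex
  assumes norm_q: "norm q < 1"
  shows "(\<lambda>j::int. norm (q ^ nat (j\<^sup>2) * z powi j)) summable_on UNIV"
proof (rule summable_on_int_if_nat)
  have summable: "summable (\<lambda>n. norm (q ^ n\<^sup>2 * w ^ n))" for w :: complex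
  proof (rule summable_comparison_test_ev)
    have "(\<lambda>n. norm q ^ n * norm w) \<longlonglongrightarrow> 0 * norm w"
      using norm_q by (intro tendsto_mult_right LIMSEQ_power_zero) simp
    hence "\<forall>\<^sub>F n in sequentially. norm q ^ n * norm w < 1 / 2" by (intro order_tendstoD) auto
    thus "\<forall>\<^sub>F n in sequentially. norm (norm (q ^ n\<^sup>2 * w ^ n)) \<le> (1 / 2) ^ n"
    proof eventually_elim
      case (elim n)
      have "norm (q ^ n\<^sup>2 * w ^ n) = (norm q ^ n * norm w) ^ n"
        by (simp add: norm_mult norm_power power_mult_distrib power2_eq_square power_mult)
      also have "\<dots> \<le> (1 / 2) ^ n" using elim by (intro power_mono) auto
      finally show ?case by simp
    qed
  qed (rule summable_geometric, simp)
  show "summable (\<lambda>n. norm (q ^ nat ((int n)\<^sup>2) * z powi int n))"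
    using summable[of z] by (simp add: nat_power_eq)
  show "summable (\<lambda>n. norm (q ^ nat ((- int n)\<^sup>2) * z powi (- int n)))"
    using summable[of "inverse z"] by (simp add: nat_power_eq power_int_minus power_inverse)
qed simp

lemma central_qbinom_bounded:
  assumes "norm p < 1"
  obtains C where "\<And>n j. norm (central_qbinom p n j) \<le> C"
proof -
  have nonzero: "qpoch_inf p p \<noteq> 0" by (rule qpoch_inf_nonzero[OF assms assms])
  have "qpoch p p \<longlonglongrightarrow> qpoch_inf p p" by (rule qpoch_LIMSEQ[OF assms])
  then obtain C where qpoch_le: "\<And>n. norm (qpoch p p n) \<le> C"
    by (metis BseqE convergentI convergent_imp_Bseq)
  have "(\<lambda>n. inverse (qpoch p p n)) \<longlonglongrightarrow> inverse (qpoch_inf p p)"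
    by (rule tendsto_inverse[OF qpoch_LIMSEQ[OF assms] nonzero])
  then obtain D where inverse_qpoch_le: "\<And>n. norm (inverse (qpoch p p n)) \<le> D"
    by (metis BseqE convergentI convergent_imp_Bseq)
  have nonneg: "C \<ge> 0" "D \<ge> 0"
    using qpoch_le[of 0] inverse_qpoch_le[of 0] by (auto intro: order_trans[OF norm_ge_zero])
  have "norm (central_qbinom p n j) \<le> C * (D * D)" for n j
  proof (cases "\<bar>j\<bar> \<le> int n")
    case True
    hence "norm (central_qbinom p n j) = norm (qpoch p p (2 * n)) *
        (norm (inverse (qpoch p p (nat (int n - j)))) *
        norm (inverse (qpoch p p (nat (int n + j)))))"
      by (simp add: central_qbinom_def norm_mult norm_divide norm_inverse divide_inverse)
    also have "\<dots> \<le> C * (D * D)" using qpoch_le inverse_qpoch_le nonneg by (intro mult_mono) auto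
    finally show ?thesis .
  qed (use nonneg in \<open>simp add: central_qbinom_def\<close>)
  thus ?thesis by (rule that)
qed

lemma central_qbinom_LIMSEQ:
  assumes "norm p < 1"
  shows "(\<lambda>n. central_qbinom p n j) \<longlonglongrightarrow> inverse (qpoch_inf p p)"
proof -
  have at_top: "filterlim (\<lambda>n. 2 * n :: nat) at_top at_top"
    "filterlim (\<lambda>n. nat (int n + i)) at_top at_top" for i :: int
    by (rule filterlim_subseq, simp add: strict_mono_def) real_asymp
  have nonzero: "qpoch_inf p p \<noteq> 0" by (rule qpoch_inf_nonzero[OF assms assms])
  have "(\<lambda>n. qpoch p p (2 * n) / (qpoch p p (nat (int n + - j)) * qpoch p p (nat (int n + j))))
      \<longlonglongrightarrow> qpoch_inf p p / (qpoch_inf p p * qpoch_inf p p)"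
    using nonzero
    by (intro tendsto_divide tendsto_mult filterlim_compose[OF qpoch_LIMSEQ[OF assms]] at_top) auto
  moreover have "\<forall>\<^sub>F n in sequentially. qpoch p p (2 * n)
      / (qpoch p p (nat (int n + - j)) * qpoch p p (nat (int n + j))) = central_qbinom p n j"
    using eventually_ge_at_top[of "nat \<bar>j\<bar>"] by eventually_elim (simp add: central_qbinom_def)
  ultimately have "(\<lambda>n. central_qbinom p n j) \<longlonglongrightarrow> qpoch_inf p p / (qpoch_inf p p * qpoch_inf p p)"
    by (rule Lim_transform_eventually)
  thus ?thesis using nonzero by (simp add: field_simps)
qed

lemma infsum_central_qbinom_theta:
  fixes q z :: complex
  assumes "norm q < 1" "z \<noteq> 0"
  shows "(\<Sum>\<^sub>\<infinity>j. central_qbinom (q\<^sup>2) n j * (q ^ nat (j\<^sup>2) * z powi j)) =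
    qpoch (- (q * z)) (q\<^sup>2) n * qpoch (- (q / z)) (q\<^sup>2) n"
proof -
  have "(\<Sum>\<^sub>\<infinity>j. central_qbinom (q\<^sup>2) n j * (q ^ nat (j\<^sup>2) * z powi j)) =
      (\<Sum>\<^sub>\<infinity>j\<in>{- int n..int n}. central_qbinom (q\<^sup>2) n j * (q ^ nat (j\<^sup>2) * z powi j))"
    by (rule infsum_cong_neutral) (auto simp: central_qbinom_def)
  thus ?thesis unfolding finite_triple_product[OF assms] by simp
qed

theorem jacobi_triple_product:
  fixes q z :: complex
  assumes norm_q: "norm q < 1" and z_nonzero: "z \<noteq> 0"
  shows "((\<lambda>j::int. q ^ nat (j\<^sup>2) * z powi j) has_sum
     (qpoch_inf (q\<^sup>2) (q\<^sup>2) * qpoch_inf (- (q * z)) (q\<^sup>2) * qpoch_inf (- (q / z)) (q\<^sup>2))) UNIV"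
proof -
  define p where "p = q\<^sup>2"
  have norm_p: "norm p < 1" unfolding p_def by (rule norm_power_less_1[OF norm_q]) simp
  define u where "u = (\<lambda>j::int. q ^ nat (j\<^sup>2) * z powi j)"
  have u_summable: "(\<lambda>j. norm (u j)) summable_on UNIV"
    unfolding u_def by (rule theta_abs_summable[OF norm_q])
  obtain C where qbinom_le: "\<And>n j. norm (central_qbinom p n j) \<le> C"
    using central_qbinom_bounded[OF norm_p] by blast
  have "(\<lambda>n. \<Sum>\<^sub>\<infinity>j. central_qbinom p n j * u j) \<longlonglongrightarrow> (\<Sum>\<^sub>\<infinity>j. inverse (qpoch_inf p p) * u j)"
  proof (rule tendsto_infsum_dominated)
    show "(\<lambda>n. central_qbinom p n j * u j) \<longlonglongrightarrow> inverse (qpoch_inf p p) * u j" for j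
      by (intro tendsto_mult_right central_qbinom_LIMSEQ norm_p)
    show "norm (central_qbinom p n j * u j) \<le> C * norm (u j)" for n j
      unfolding norm_mult by (intro mult_right_mono qbinom_le norm_ge_zero)
  qed (intro summable_on_cmult_right u_summable)
  hence "(\<lambda>n. qpoch (- (q * z)) p n * qpoch (- (q / z)) p n)
      \<longlonglongrightarrow> (\<Sum>\<^sub>\<infinity>j. inverse (qpoch_inf p p) * u j)"
    unfolding p_def u_def infsum_central_qbinom_theta[OF norm_q z_nonzero] .
  moreover have "(\<lambda>n. qpoch (- (q * z)) p n * qpoch (- (q / z)) p n)
      \<longlonglongrightarrow> qpoch_inf (- (q * z)) p * qpoch_inf (- (q / z)) p"
    by (intro tendsto_mult qpoch_LIMSEQ norm_p)
  ultimately have "inverse (qpoch_inf p p) * (\<Sum>\<^sub>\<infinity>j. u j) =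
      qpoch_inf (- (q * z)) p * qpoch_inf (- (q / z)) p"
    by (simp add: LIMSEQ_unique infsum_cmult_right')
  hence "(\<Sum>\<^sub>\<infinity>j. u j) = qpoch_inf p p * qpoch_inf (- (q * z)) p * qpoch_inf (- (q / z)) p"
    using qpoch_inf_nonzero[OF norm_p norm_p] by (simp add: field_simps)
  thus ?thesis using has_sum_infsum[OF abs_summable_summable[OF u_summable]]
    unfolding p_def u_def by simp
qed

section \<open>The Euler product\<close>

definition euler_prod :: "complex \<Rightarrow> complex" where "euler_prod q = qpoch_inf q q"

lemma euler_prod_nonzero: "norm q < 1 \<Longrightarrow> euler_prod q \<noteq> 0"
  unfolding euler_prod_def by (rule qpoch_inf_nonzero)

lemma euler_prod_power_nonzero: "norm q < 1 \<Longrightarrow> n > 0 \<Longrightarrow> euler_prod (q ^ n) \<noteq> 0"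
  by (intro euler_prod_nonzero norm_power_less_1)

lemma euler_prod_0 [simp]: "euler_prod 0 = 1"
  by (simp add: euler_prod_def qpoch_inf_def)

lemma euler_prod_uniform_limit:
  assumes "r < 1"
  shows "uniform_limit (cball 0 r) (\<lambda>n q. \<Prod>k<n. 1 - q ^ Suc k) euler_prod sequentially"
proof (cases "r \<ge> 0")
  case True
  have "uniformly_convergent_on (cball 0 r) (\<lambda>N q. \<Sum>n<N. norm ((1 - (q::complex) ^ Suc n) - 1))"
  proof (rule Weierstrass_m_test')
    show "norm (norm ((1 - q ^ Suc n) - 1)) \<le> r ^ Suc n" if "q \<in> cball 0 r" for n and q :: complex
      using that power_mono[of "norm q" r "Suc n"] by (simp add: norm_power norm_mult)
    show "summable (\<lambda>n. r ^ Suc n)" using True assms by (simp add: summable_geometric)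
  qed
  hence "uniformly_convergent_on (cball 0 r) (\<lambda>N q. \<Prod>n<N. 1 - (q::complex) ^ Suc n)"
    by (intro uniformly_convergent_on_prod') (auto intro!: continuous_intros)
  then obtain l where l_limit: "uniform_limit (cball 0 r)
      (\<lambda>n q. \<Prod>k<n. 1 - (q::complex) ^ Suc k) l sequentially"
    by (auto simp: uniformly_convergent_on_def)
  have "l q = euler_prod q" if "q \<in> cball 0 r" for q
  proof (rule LIMSEQ_unique[OF tendsto_uniform_limitI[OF l_limit that]])
    show "(\<lambda>n. \<Prod>k<n. 1 - q ^ Suc k) \<longlonglongrightarrow> euler_prod q"
      using qpoch_LIMSEQ[of q q] that assms by (simp add: qpoch_def[abs_def] euler_prod_def)
  qed
  thus ?thesis using l_limit
    by (subst uniform_limit_cong'[where g = "\<lambda>n q. \<Prod>k<n. 1 - q ^ Suc k" and i = l]) auto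
qed simp

lemma euler_prod_holomorphic: "euler_prod holomorphic_on ball 0 1"
proof (rule holomorphic_uniform_sequence[OF open_ball])
  show "(\<lambda>q. \<Prod>k<n. 1 - q ^ Suc k) holomorphic_on ball 0 1" for n by (intro holomorphic_intros)
  fix x :: complex assume norm_x: "x \<in> ball 0 1"
  define d where "d = (1 - norm x) / 2"
  have cball_subset: "cball x d \<subseteq> cball 0 ((1 + norm x) / 2)"
  proof
    fix y assume "y \<in> cball x d"
    thus "y \<in> cball 0 ((1 + norm x) / 2)"
      using norm_triangle_sub[of y x] by (simp add: d_def dist_norm norm_minus_commute field_simps)
  qed
  show "\<exists>d>0. cball x d \<subseteq> ball 0 1 \<and>
      uniform_limit (cball x d) (\<lambda>n q. \<Prod>k<n. 1 - q ^ Suc k) euler_prod sequentially"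
  proof (intro exI conjI)
    show "d > 0" using norm_x by (simp add: d_def)
    have "cball 0 ((1 + norm x) / 2) \<subseteq> ball (0::complex) 1" using norm_x by auto
    thus "cball x d \<subseteq> ball 0 1" using cball_subset by blast
    show "uniform_limit (cball x d) (\<lambda>n q. \<Prod>k<n. 1 - q ^ Suc k) euler_prod sequentially"
      by (rule uniform_limit_on_subset[OF euler_prod_uniform_limit cball_subset])
         (use norm_x in simp)
  qed
qed

lemma euler_prod_logderiv_sums:
  assumes norm_q: "norm q < 1"
  shows "(\<lambda>k. of_nat (Suc k) * q ^ Suc k / (1 - q ^ Suc k)) sums
      (- (q * deriv euler_prod q / euler_prod q))"
proof -
  obtain r where r_between: "norm q < r" "r < 1" using dense[OF norm_q] by blast
  have "uniform_limit (ball 0 r) (\<lambda>n q. \<Prod>k<n. 1 - q ^ Suc k) euler_prod sequentially"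
    by (rule uniform_limit_on_subset[OF euler_prod_uniform_limit[OF r_between(2)] ball_subset_cball])
  hence "(\<lambda>k. deriv (\<lambda>q. 1 - q ^ Suc k) q / (1 - q ^ Suc k)) sums
      (deriv euler_prod q / euler_prod q)"
    by (rule logderiv_prodinf_complex_uniform_limit)
       (use r_between norm_q in
         \<open>auto intro!: holomorphic_intros euler_prod_nonzero simp del: power_Suc\<close>)
  moreover have "deriv (\<lambda>q. 1 - q ^ Suc k) q = - (of_nat (Suc k) * q ^ k)" for k
    by (rule DERIV_imp_deriv) (rule derivative_eq_intros refl | simp)+
  ultimately have "(\<lambda>k. - (of_nat (Suc k) * q ^ k) / (1 - q ^ Suc k)) sums
      (deriv euler_prod q / euler_prod q)"
    by (simp only:)
  from sums_minus[OF sums_mult[OF this, of q]] show ?thesis by (simp add: mult_ac)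
qed

section \<open>Theta functions\<close>

definition phi :: "complex \<Rightarrow> complex" where
  "phi q = euler_prod (q\<^sup>2) ^ 5 / (euler_prod q ^ 2 * euler_prod (q ^ 4) ^ 2)"

definition psi :: "complex \<Rightarrow> complex" where
  "psi q = euler_prod (q\<^sup>2) ^ 2 / euler_prod q"

lemma phi_0 [simp]: "phi 0 = 1" and psi_0 [simp]: "psi 0 = 1"
  by (simp_all add: phi_def psi_def)

lemma qpoch_inf_odd:
  assumes "norm q < 1"
  shows "qpoch_inf q (q\<^sup>2) = euler_prod q / euler_prod (q\<^sup>2)"
  using qpoch_inf_even_odd[OF assms, of q] euler_prod_power_nonzero[OF assms, of 2]
  by (simp add: euler_prod_def field_simps flip: power2_eq_square)

lemma qpoch_inf_uminus_self:
  assumes "norm q < 1"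
  shows "qpoch_inf (- q) q = euler_prod (q\<^sup>2) / euler_prod q"
  using qpoch_inf_mult_uminus[OF assms, of q] euler_prod_nonzero[OF assms]
  by (simp add: euler_prod_def field_simps)

lemma phi_eq_qpoch_inf:
  assumes norm_q: "norm q < 1"
  shows "phi q = euler_prod (q\<^sup>2) * (qpoch_inf (- q) (q\<^sup>2))\<^sup>2"
proof -
  have norm_q2: "norm (q\<^sup>2) < 1" using norm_power_less_1[OF norm_q, of 2] by simp
  have nonzero: "euler_prod q \<noteq> 0" "euler_prod (q\<^sup>2) \<noteq> 0" "euler_prod (q ^ 4) \<noteq> 0"
    using norm_q by (simp_all add: euler_prod_nonzero euler_prod_power_nonzero)
  have "qpoch_inf q (q\<^sup>2) * qpoch_inf (- q) (q\<^sup>2) = qpoch_inf (q\<^sup>2) ((q\<^sup>2)\<^sup>2)"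
    by (rule qpoch_inf_mult_uminus[OF norm_q2])
  hence "euler_prod q / euler_prod (q\<^sup>2) * qpoch_inf (- q) (q\<^sup>2) =
      euler_prod (q\<^sup>2) / euler_prod (q ^ 4)"
    unfolding qpoch_inf_odd[OF norm_q] qpoch_inf_odd[OF norm_q2] by (simp flip: power_mult)
  hence odd_plus: "qpoch_inf (- q) (q\<^sup>2) = euler_prod (q\<^sup>2) ^ 2 / (euler_prod q * euler_prod (q ^ 4))"
    using nonzero by (simp add: field_simps power2_eq_square)
  show ?thesis unfolding phi_def odd_plus
    by (simp add: power_divide power_mult_distrib flip: power_mult power_Suc)
qed

lemma phi_uminus:
  assumes norm_q: "norm q < 1"
  shows "phi (- q) = euler_prod q ^ 2 / euler_prod (q\<^sup>2)"
proof -
  have "phi (- q) = euler_prod (q\<^sup>2) * (euler_prod q / euler_prod (q\<^sup>2))\<^sup>2"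
    using phi_eq_qpoch_inf[of "- q"] norm_q by (simp add: qpoch_inf_odd)
  thus ?thesis by (simp add: power2_eq_square[of "_ / _"] power2_eq_square[of "euler_prod q"])
qed

lemma phi_nonzero: "norm q < 1 \<Longrightarrow> phi q \<noteq> 0"
  and psi_nonzero: "norm q < 1 \<Longrightarrow> psi q \<noteq> 0"
  by (simp_all add: phi_def psi_def euler_prod_nonzero euler_prod_power_nonzero)

lemma psi_square: "norm q < 1 \<Longrightarrow> psi q ^ 2 = phi q * psi (q\<^sup>2)"
  using euler_prod_nonzero[of q] euler_prod_power_nonzero[of q 2] euler_prod_power_nonzero[of q 4]
  by (simp add: psi_def phi_def field_simps eval_nat_numeral)

lemma phi_uminus_square: "norm q < 1 \<Longrightarrow> phi (- (q\<^sup>2)) ^ 2 = phi q * phi (- q)"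
  using euler_prod_nonzero[of q] euler_prod_power_nonzero[of q 2] euler_prod_power_nonzero[of q 4]
  by (simp add: phi_uminus norm_power_less_1) (simp add: phi_def field_simps eval_nat_numeral)

lemma phi_has_sum:
  assumes norm_q: "norm q < 1"
  shows "((\<lambda>n::int. q ^ nat (n\<^sup>2)) has_sum phi q) UNIV"
    "(\<lambda>n::int. norm (q ^ nat (n\<^sup>2))) summable_on UNIV"
  using jacobi_triple_product[OF norm_q, of 1] theta_abs_summable[OF norm_q, of 1]
  by (simp_all add: phi_eq_qpoch_inf[OF norm_q] euler_prod_def power2_eq_square mult.assoc)

lemma square_plus_self_nonneg: "0 \<le> n\<^sup>2 + (n::int)"
proof -
  have "0 \<le> n * (n + 1)" by (simp add: zero_le_mult_iff) linarith
  thus ?thesis by (simp add: power2_eq_square algebra_simps)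
qed

lemma psi_has_sum:
  assumes q_punctured: "norm q < 1" "q \<noteq> 0"
  shows "((\<lambda>n::int. q ^ nat (n\<^sup>2 + n)) has_sum (2 * psi (q\<^sup>2))) UNIV"
    "(\<lambda>n::int. norm (q ^ nat (n\<^sup>2 + n))) summable_on UNIV"
proof -
  have norm_q2: "norm (q\<^sup>2) < 1" using norm_power_less_1[OF q_punctured(1), of 2] by simp
  have summand: "q ^ nat (n\<^sup>2) * q powi n = q ^ nat (n\<^sup>2 + n)" for n :: int
  proof -
    have "q ^ nat (n\<^sup>2 + n) = q powi (n\<^sup>2 + n)"
      using square_plus_self_nonneg[of n] by (simp add: power_int_def)
    also have "\<dots> = q powi n\<^sup>2 * q powi n" using q_punctured by (simp add: power_int_add)
    finally show ?thesis by (simp add: power_int_def)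
  qed
  have "qpoch_inf (- 1) (q\<^sup>2) = 2 * (euler_prod ((q\<^sup>2)\<^sup>2) / euler_prod (q\<^sup>2))"
    using qpoch_inf_Suc[OF norm_q2, of "- 1"] qpoch_inf_uminus_self[OF norm_q2] by simp
  moreover have "qpoch_inf (- (q * q)) (q\<^sup>2) = euler_prod ((q\<^sup>2)\<^sup>2) / euler_prod (q\<^sup>2)"
    using qpoch_inf_uminus_self[OF norm_q2] by (simp flip: power2_eq_square)
  ultimately have "qpoch_inf (q\<^sup>2) (q\<^sup>2) * qpoch_inf (- (q * q)) (q\<^sup>2) * qpoch_inf (- (q / q)) (q\<^sup>2) =
      2 * psi (q\<^sup>2)"
    using euler_prod_nonzero[OF norm_q2] q_punctured
    by (simp add: psi_def power2_eq_square[of "euler_prod _"] flip: euler_prod_def)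
  thus "((\<lambda>n::int. q ^ nat (n\<^sup>2 + n)) has_sum (2 * psi (q\<^sup>2))) UNIV"
    "(\<lambda>n::int. norm (q ^ nat (n\<^sup>2 + n))) summable_on UNIV"
    using jacobi_triple_product[OF q_punctured] theta_abs_summable[OF q_punctured(1), of q]
    by (simp_all add: summand)
qed

lemma has_sum_Times:
  fixes f :: "'a \<Rightarrow> 'c::{real_normed_field, banach}" and g :: "'b \<Rightarrow> 'c"
  assumes f_sum: "(f has_sum a) A" "(\<lambda>x. norm (f x)) summable_on A"
    and g_sum: "(g has_sum b) B" "(\<lambda>x. norm (g x)) summable_on B"
  shows "((\<lambda>(x, y). f x * g y) has_sum (a * b)) (A \<times> B)"
proof (rule has_sum_SigmaI)
  show "((\<lambda>y. case (x, y) of (x, y) \<Rightarrow> f x * g y) has_sum (f x * b)) B" for x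
    using has_sum_cmult_right[OF g_sum(1), of "f x"] by simp
  show "((\<lambda>x. f x * b) has_sum (a * b)) A" by (rule has_sum_cmult_left[OF f_sum(1)])
  have "(\<lambda>p. norm (case p of (x, y) \<Rightarrow> f x * g y)) summable_on A \<times> B"
    unfolding Infinite_Sum.abs_summable_on_Sigma_iff
    using f_sum(2) g_sum(2)
    by (auto simp: norm_mult infsum_cmult_right' abs_mult
        intro!: summable_on_cmult_right summable_on_cmult_left)
  thus "(\<lambda>(x, y). f x * g y) summable_on A \<times> B" by (rule abs_summable_summable)
qed

lemma has_sum_int_pairs_by_parity:
  fixes h :: "int \<times> int \<Rightarrow> 'a::topological_comm_monoid_add"
  assumes "((\<lambda>(s, t). h (s + t, s - t)) has_sum a) UNIV"
    "((\<lambda>(s, t). h (s + t + 1, s - t)) has_sum b) UNIV"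
  shows "(h has_sum (a + b)) UNIV"
proof -
  define ev od :: "int \<times> int \<Rightarrow> int \<times> int"
    where "ev = (\<lambda>(s, t). (s + t, s - t))" and "od = (\<lambda>(s, t). (s + t + 1, s - t))"
  have "((h \<circ> ev) has_sum a) UNIV" "((h \<circ> od) has_sum b) UNIV"
    using assms by (simp_all add: ev_def od_def comp_def case_prod_unfold)
  hence "(h has_sum a) (range ev)" "(h has_sum b) (range od)"
    by (subst has_sum_reindex; simp add: ev_def od_def inj_def)+
  moreover have "range ev \<inter> range od = {}" by (auto simp: ev_def od_def) presburger
  ultimately have "(h has_sum (a + b)) (range ev \<union> range od)" by (rule has_sum_Un_disjoint)
  moreover have "(m, n) \<in> range ev \<union> range od" for m n
  proof (cases "even (m + n)")
    case True
    then obtain s where "m + n = 2 * s" by (elim evenE)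
    hence "(m, n) = ev (s, m - s)" by (simp add: ev_def)
    thus ?thesis by blast
  next
    case False
    then obtain s where "m + n = 2 * s + 1" by (elim oddE)
    hence "(m, n) = od (s, m - s - 1)" by (simp add: od_def)
    thus ?thesis by blast
  qed
  hence "range ev \<union> range od = UNIV" by auto
  ultimately show ?thesis by simp
qed

lemma phi_square_decomp:
  assumes norm_q: "norm q < 1"
  shows "phi q ^ 2 = phi (q\<^sup>2) ^ 2 + 4 * q * psi (q ^ 4) ^ 2"
proof (cases "q = 0")
  case False
  have q2_punctured: "norm (q\<^sup>2) < 1" "q\<^sup>2 \<noteq> 0" using norm_power_less_1[OF norm_q, of 2] False by auto
  define h where "h = (\<lambda>(m::int, n::int). q ^ nat (m\<^sup>2 + n\<^sup>2))"
  have total: "(h has_sum phi q * phi q) UNIV"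
    using has_sum_Times[OF phi_has_sum[OF norm_q] phi_has_sum[OF norm_q]]
    by (simp add: h_def case_prod_unfold nat_add_distrib power_add)
  have "h (s + t, s - t) = (q\<^sup>2) ^ nat (s\<^sup>2) * (q\<^sup>2) ^ nat (t\<^sup>2)" for s t
  proof -
    have squares: "(s + t)\<^sup>2 + (s - t)\<^sup>2 = 2 * (s\<^sup>2 + t\<^sup>2)"
      by (simp add: power2_eq_square algebra_simps)
    show ?thesis unfolding h_def prod.case squares
      by (simp add: nat_mult_distrib nat_add_distrib power_mult power_add del: distrib_left_numeral)
  qed
  hence even_part: "((\<lambda>(s, t). h (s + t, s - t)) has_sum phi (q\<^sup>2) * phi (q\<^sup>2)) UNIV"
    using has_sum_Times[OF phi_has_sum[OF q2_punctured(1)] phi_has_sum[OF q2_punctured(1)]] by simp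
  have "h (s + t + 1, s - t) = q * ((q\<^sup>2) ^ nat (s\<^sup>2 + s) * (q\<^sup>2) ^ nat (t\<^sup>2 + t))" for s t
  proof -
    have squares: "(s + t + 1)\<^sup>2 + (s - t)\<^sup>2 = 1 + 2 * ((s\<^sup>2 + s) + (t\<^sup>2 + t))"
      by (simp add: power2_eq_square algebra_simps)
    show ?thesis unfolding h_def prod.case squares
      using square_plus_self_nonneg[of s] square_plus_self_nonneg[of t]
      by (simp add: nat_mult_distrib nat_add_distrib power_mult power_add del: distrib_left_numeral)
  qed
  hence odd_part: "((\<lambda>(s, t). h (s + t + 1, s - t)) has_sum
      q * (2 * psi ((q\<^sup>2)\<^sup>2) * (2 * psi ((q\<^sup>2)\<^sup>2)))) UNIV"
    using has_sum_cmult_right[OF has_sum_Times[OF psi_has_sum psi_has_sum], of "q\<^sup>2"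
      "q\<^sup>2" q] q2_punctured
    by (simp add: case_prod_unfold)
  have "(q\<^sup>2)\<^sup>2 = q ^ 4" by (simp flip: power_mult)
  thus ?thesis
    using has_sum_unique[OF total has_sum_int_pairs_by_parity[OF even_part odd_part]]
    by (simp add: power2_eq_square[of "_ (_ :: complex)"])
qed simp

lemma phi_uminus_square_decomp:
  assumes norm_q: "norm q < 1"
  shows "phi (- q) ^ 2 = phi (q\<^sup>2) ^ 2 - 4 * q * psi (q ^ 4) ^ 2"
  using phi_square_decomp[of "- q"] norm_q by simp

lemma jacobi_quartic:
  assumes norm_q: "norm q < 1"
  shows "phi q ^ 4 = phi (- q) ^ 4 + 16 * q * psi (q\<^sup>2) ^ 4"
proof -
  have "psi (q\<^sup>2) ^ 2 = phi (q\<^sup>2) * psi (q ^ 4)"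
    using psi_square[OF norm_power_less_1[OF norm_q, of 2]] by (simp flip: power_mult)
  thus ?thesis using phi_square_decomp[OF norm_q] phi_uminus_square_decomp[OF norm_q] by algebra
qed

lemma holomorphic_on_power_arg:
  assumes "f holomorphic_on ball (0::complex) 1" "n > 0"
  shows "(\<lambda>q. f (q ^ n)) holomorphic_on ball 0 1"
proof -
  have "(\<lambda>q::complex. q ^ n) ` ball 0 1 \<subseteq> ball 0 1" using assms(2) norm_power_less_1 by auto
  thus ?thesis using holomorphic_on_compose_gen[of "\<lambda>q. q ^ n" "ball 0 1" f "ball 0 1"] assms(1)
    by (simp add: comp_def holomorphic_intros)
qed

lemma phi_holomorphic: "phi holomorphic_on ball 0 1"
  unfolding phi_def[abs_def]
  by (intro holomorphic_intros holomorphic_on_power_arg euler_prod_holomorphic)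
     (auto simp: euler_prod_nonzero euler_prod_power_nonzero)

lemma psi_holomorphic: "psi holomorphic_on ball 0 1"
  unfolding psi_def[abs_def]
  by (intro holomorphic_intros holomorphic_on_power_arg euler_prod_holomorphic)
     (auto simp: euler_prod_nonzero)

lemma holomorphic_tendsto_compose_at_0:
  assumes "f holomorphic_on ball 0 1" "(g \<longlongrightarrow> 0) F"
  shows "((\<lambda>x. f (g x)) \<longlongrightarrow> f (0::complex)) F"
proof -
  have "isCont f 0"
    using holomorphic_on_imp_continuous_on[OF assms(1)]
    by (simp add: continuous_on_eq_continuous_at)
  thus ?thesis using assms(2) by (rule isCont_tendsto_compose)
qed

lemma phi_tendsto: "(g \<longlongrightarrow> 0) F \<Longrightarrow> ((\<lambda>x. phi (g x)) \<longlongrightarrow> 1) F"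
  using holomorphic_tendsto_compose_at_0[OF phi_holomorphic] by simp

lemma psi_tendsto: "(g \<longlongrightarrow> 0) F \<Longrightarrow> ((\<lambda>x. psi (g x)) \<longlongrightarrow> 1) F"
  using holomorphic_tendsto_compose_at_0[OF psi_holomorphic] by simp

section \<open>Functions near 0 under \<open>Q \<mapsto> Q\<^sup>2\<close>\<close>

lemma filterlim_square_at_0: "filterlim (\<lambda>Q::complex. Q\<^sup>2) (at 0) (at 0)"
  by (auto simp: filterlim_at eventually_at_filter intro!: tendsto_eq_intros)

lemma eventually_at_0_norm_less: "r > 0 \<Longrightarrow> \<forall>\<^sub>F Q in at (0::complex). norm Q < r"
  unfolding eventually_at by (intro exI[of _ r]) simp

lemma filterlim_power_two_power_at_0:
  fixes Q :: complex
  assumes "norm Q < 1" "Q \<noteq> 0"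
  shows "filterlim (\<lambda>n. Q ^ 2 ^ n) (at 0) sequentially"
  using filterlim_compose[OF LIMSEQ_power_zero[OF assms(1)] filterlim_subseq[of "\<lambda>n. 2 ^ n :: nat"]]
    assms(2)
  by (simp add: filterlim_at strict_mono_def)

lemma eventually_at_0_square_orbit:
  assumes "\<forall>\<^sub>F Q in at (0::complex). P Q"
  shows "\<forall>\<^sub>F Q in at 0. \<forall>n. P (Q ^ 2 ^ n)"
proof -
  obtain r where r_ball: "r > 0" "\<And>Q. Q \<noteq> 0 \<Longrightarrow> norm Q < r \<Longrightarrow> P Q"
    using assms by (auto simp: eventually_at)
  have "\<forall>\<^sub>F Q in at (0::complex). norm Q < min r 1 \<and> Q \<noteq> 0"
    using r_ball(1)
    by (intro eventually_conj eventually_at_0_norm_less) (auto simp: eventually_at_filter)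
  thus ?thesis
  proof eventually_elim
    case (elim Q)
    have "P (Q ^ 2 ^ n)" for n
    proof (rule r_ball(2))
      have "norm (Q ^ 2 ^ n) \<le> norm Q"
        using elim power_decreasing[of 1 "2 ^ n" "norm Q"] by (simp add: norm_power)
      thus "norm (Q ^ 2 ^ n) < r" using elim by linarith
    qed (use elim in simp)
    thus ?case by blast
  qed
qed

lemma square_invariant_imp_constant:
  fixes G :: "complex \<Rightarrow> 'a::t2_space"
  assumes lim: "(G \<longlongrightarrow> c) (at 0)" and invariant: "\<forall>\<^sub>F Q in at 0. G Q = G (Q\<^sup>2)"
  shows "\<forall>\<^sub>F Q in at 0. G Q = c"
  using eventually_at_0_square_orbit[OF invariant] eventually_at_0_norm_less[OF zero_less_one]
    eventually_neq_at_within[of 0 0]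
proof eventually_elim
  case (elim Q)
  have "G (Q ^ 2 ^ n) = G Q" for n
    using elim(1) by (induction n) (simp_all add: mult.commute flip: power_mult)
  moreover have "(\<lambda>n. G (Q ^ 2 ^ n)) \<longlonglongrightarrow> c"
    using elim by (intro filterlim_compose[OF lim] filterlim_power_two_power_at_0) auto
  ultimately show ?case by (simp add: LIMSEQ_const_iff)
qed

lemma square_contraction_imp_zero:
  fixes l :: "complex \<Rightarrow> complex"
  assumes l_lim: "(l \<longlongrightarrow> L) (at 0)" and g_lim: "(g \<longlongrightarrow> \<gamma>) (at 0)" "norm \<gamma> < 1"
    and step: "\<forall>\<^sub>F Q in at 0. l Q = g Q * l (Q\<^sup>2)"
  shows "\<forall>\<^sub>F Q in at 0. l Q = 0"
proof -
  obtain c where c_between: "norm \<gamma> < c" "c < 1" using dense[OF g_lim(2)] by blast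
  have "\<forall>\<^sub>F Q in at 0. norm (g Q) < c"
    by (rule order_tendstoD(2)[OF tendsto_norm[OF g_lim(1)] c_between(1)])
  with step have "\<forall>\<^sub>F Q in at 0. norm (l Q) \<le> c * norm (l (Q\<^sup>2))"
    by eventually_elim (simp add: norm_mult mult_right_mono)
  from eventually_at_0_square_orbit[OF this] eventually_at_0_norm_less[OF zero_less_one]
    eventually_neq_at_within[of 0 0]
  show ?thesis
  proof eventually_elim
    case (elim Q)
    have "norm (l Q) \<le> c ^ n * norm (l (Q ^ 2 ^ n))" for n
    proof (induction n)
      case (Suc n)
      have "c ^ n * norm (l (Q ^ 2 ^ n)) \<le> c ^ n * (c * norm (l ((Q ^ 2 ^ n)\<^sup>2)))"
        using elim(1) c_between(1)
        by (intro mult_left_mono zero_le_power)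
           (auto intro: order_trans[OF norm_ge_zero less_imp_le])
      with Suc show ?case by (simp add: mult_ac flip: power_mult)
    qed simp
    moreover have "(\<lambda>n. c ^ n * norm (l (Q ^ 2 ^ n))) \<longlonglongrightarrow> 0 * norm L"
      using c_between order_trans[OF norm_ge_zero less_imp_le[OF c_between(1)]] elim(2,3)
      by (intro tendsto_mult LIMSEQ_power_zero tendsto_norm filterlim_compose[OF l_lim]
          filterlim_power_two_power_at_0) auto
    ultimately have "norm (l Q) \<le> 0 * norm L" by (intro LIMSEQ_le_const) auto
    thus ?case by simp
  qed
qed

section \<open>Legendre's modular equation of degree 3\<close>

lemma duplication_relations:
  fixes Q :: complex
  assumes norm_Q: "norm Q < 1"
  shows "phi Q ^ 2 = phi (Q\<^sup>2) ^ 2 + 4 * Q * psi (Q ^ 4) ^ 2"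
    "phi (- Q) ^ 2 = phi (Q\<^sup>2) ^ 2 - 4 * Q * psi (Q ^ 4) ^ 2"
    "psi (Q\<^sup>2) ^ 2 = phi (Q\<^sup>2) * psi (Q ^ 4)"
    "phi (- (Q\<^sup>2)) ^ 2 = phi Q * phi (- Q)"
    "phi (Q ^ 3) ^ 2 = phi (Q ^ 6) ^ 2 + 4 * Q ^ 3 * psi (Q ^ 12) ^ 2"
    "phi (- (Q ^ 3)) ^ 2 = phi (Q ^ 6) ^ 2 - 4 * Q ^ 3 * psi (Q ^ 12) ^ 2"
    "psi (Q ^ 6) ^ 2 = phi (Q ^ 6) * psi (Q ^ 12)"
    "phi (- (Q ^ 6)) ^ 2 = phi (Q ^ 3) * phi (- (Q ^ 3))"
proof -
  have "norm (Q ^ 3) < 1" "norm (Q\<^sup>2) < 1" "norm (Q ^ 6) < 1"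
    using norm_power_less_1[OF norm_Q] by simp_all
  note powers = norm_Q this
  show "phi Q ^ 2 = phi (Q\<^sup>2) ^ 2 + 4 * Q * psi (Q ^ 4) ^ 2"
    "phi (- Q) ^ 2 = phi (Q\<^sup>2) ^ 2 - 4 * Q * psi (Q ^ 4) ^ 2"
    "phi (- (Q\<^sup>2)) ^ 2 = phi Q * phi (- Q)"
    by (rule phi_square_decomp phi_uminus_square_decomp phi_uminus_square; rule norm_Q)+
  show "phi (Q ^ 3) ^ 2 = phi (Q ^ 6) ^ 2 + 4 * Q ^ 3 * psi (Q ^ 12) ^ 2"
    "phi (- (Q ^ 3)) ^ 2 = phi (Q ^ 6) ^ 2 - 4 * Q ^ 3 * psi (Q ^ 12) ^ 2"
    "phi (- (Q ^ 6)) ^ 2 = phi (Q ^ 3) * phi (- (Q ^ 3))"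
    using phi_square_decomp[OF powers(2)] phi_uminus_square_decomp[OF powers(2)]
      phi_uminus_square[OF powers(2)]
    by (simp_all flip: power_mult)
  show "psi (Q\<^sup>2) ^ 2 = phi (Q\<^sup>2) * psi (Q ^ 4)" "psi (Q ^ 6) ^ 2 = phi (Q ^ 6) * psi (Q ^ 12)"
    using psi_square[OF powers(3)] psi_square[OF powers(4)] by (simp_all flip: power_mult)
qed

lemma phi_odd_part_tendsto: "((\<lambda>q. (phi q - phi (- q)) / q) \<longlongrightarrow> 4) (at 0)"
proof (rule Lim_transform_eventually)
  have sum_lim: "((\<lambda>q. phi q + phi (- q)) \<longlongrightarrow> 2) (at 0)"
    by (rule tendsto_eq_intros phi_tendsto refl | simp)+
  show "((\<lambda>q. 8 * psi (q ^ 4) ^ 2 / (phi q + phi (- q))) \<longlongrightarrow> 4) (at 0)"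
    by (rule tendsto_eq_intros psi_tendsto sum_lim refl | simp)+
  have "\<forall>\<^sub>F q in at 0. phi q + phi (- q) \<noteq> 0" by (rule tendsto_imp_eventually_ne[OF sum_lim]) simp
  thus "\<forall>\<^sub>F q in at 0. 8 * psi (q ^ 4) ^ 2 / (phi q + phi (- q)) = (phi q - phi (- q)) / q"
    using eventually_at_0_norm_less[OF zero_less_one] eventually_neq_at_within[of 0 0]
  proof eventually_elim
    case (elim q)
    have "(phi q - phi (- q)) * (phi q + phi (- q)) = 8 * psi (q ^ 4) ^ 2 * q"
      using duplication_relations(1,2)[OF elim(2)] by algebra
    thus ?case using elim by (simp add: frac_eq_eq)
  qed
qed

lemma phi_cubic_odd_part_tendsto:
  "((\<lambda>Q. (phi Q * phi (Q ^ 3) - phi (- Q) * phi (- (Q ^ 3))) / Q) \<longlongrightarrow> 4) (at 0)"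
proof (rule Lim_transform_eventually)
  have "filterlim (\<lambda>Q::complex. Q ^ 3) (at 0) (at 0)"
    by (auto simp: filterlim_at eventually_at_filter intro!: tendsto_eq_intros)
  note cube = filterlim_compose[OF phi_odd_part_tendsto this]
  show "((\<lambda>Q. (phi Q - phi (- Q)) / Q * phi (Q ^ 3) +
      phi (- Q) * ((phi (Q ^ 3) - phi (- (Q ^ 3))) / Q ^ 3) * Q\<^sup>2) \<longlongrightarrow> 4) (at 0)"
    by (rule tendsto_eq_intros phi_tendsto phi_odd_part_tendsto cube refl | simp)+
  show "\<forall>\<^sub>F Q in at 0. (phi Q - phi (- Q)) / Q * phi (Q ^ 3) +
      phi (- Q) * ((phi (Q ^ 3) - phi (- (Q ^ 3))) / Q ^ 3) * Q\<^sup>2 =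
      (phi Q * phi (Q ^ 3) - phi (- Q) * phi (- (Q ^ 3))) / Q"
    using eventually_neq_at_within[of 0 0]
    by eventually_elim (simp add: field_simps power2_eq_square power3_eq_cube)
qed

definition legendre_defect :: "complex \<Rightarrow> complex" where
  "legendre_defect Q = phi Q * phi (Q ^ 3) - phi (- Q) * phi (- (Q ^ 3))
      - 4 * Q * psi (Q\<^sup>2) * psi (Q ^ 6)"

lemma legendre_defect_square:
  assumes "norm Q < 1"
  shows "legendre_defect Q *
       (phi Q * phi (Q ^ 3) - phi (- Q) * phi (- (Q ^ 3)) + 4 * Q * psi (Q\<^sup>2) * psi (Q ^ 6)) =
     2 * legendre_defect (Q\<^sup>2) *
       (phi (Q\<^sup>2) * phi (Q ^ 6) - 4 * Q\<^sup>2 * psi (Q ^ 4) * psi (Q ^ 12)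
        + phi (- (Q\<^sup>2)) * phi (- (Q ^ 6)))"
proof -
  have "legendre_defect (Q\<^sup>2) =
      phi (Q\<^sup>2) * phi (Q ^ 6) - phi (- (Q\<^sup>2)) * phi (- (Q ^ 6)) - 4 * Q\<^sup>2 * psi (Q ^ 4) * psi (Q ^ 12)"
    by (simp add: legendre_defect_def flip: power_mult)
  thus ?thesis unfolding legendre_defect_def[of Q] using duplication_relations[OF assms] by algebra
qed

definition legendre_factor :: "complex \<Rightarrow> complex" where
  "legendre_factor Q = 2 * Q *
     (phi (Q\<^sup>2) * phi (Q ^ 6) - 4 * Q\<^sup>2 * psi (Q ^ 4) * psi (Q ^ 12) +
     phi (- (Q\<^sup>2)) * phi (- (Q ^ 6))) /
     (phi Q * phi (Q ^ 3) - phi (- Q) * phi (- (Q ^ 3)) + 4 * Q * psi (Q\<^sup>2) * psi (Q ^ 6))"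

lemma legendre_denominator_tendsto:
  "((\<lambda>Q. (phi Q * phi (Q ^ 3) - phi (- Q) * phi (- (Q ^ 3)) + 4 * Q * psi (Q\<^sup>2) * psi (Q ^ 6)) / Q)
     \<longlongrightarrow> 8) (at 0)"
proof (rule Lim_transform_eventually)
  show "((\<lambda>Q. (phi Q * phi (Q ^ 3) - phi (- Q) * phi (- (Q ^ 3))) / Q + 4 * psi (Q\<^sup>2) * psi (Q ^ 6))
      \<longlongrightarrow> 8) (at 0)"
    by (rule tendsto_eq_intros psi_tendsto phi_cubic_odd_part_tendsto refl | simp)+
qed (use eventually_neq_at_within[of 0 0] in \<open>eventually_elim, simp add: add_divide_distrib\<close>)

lemma legendre_factor_tendsto: "(legendre_factor \<longlongrightarrow> 1 / 2) (at 0)"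
proof (rule Lim_transform_eventually)
  show "((\<lambda>Q. 2 *
      (phi (Q\<^sup>2) * phi (Q ^ 6) - 4 * Q\<^sup>2 * psi (Q ^ 4) * psi (Q ^ 12) +
      phi (- (Q\<^sup>2)) * phi (- (Q ^ 6))) /
      ((phi Q * phi (Q ^ 3) - phi (- Q) * phi (- (Q ^ 3)) + 4 * Q * psi (Q\<^sup>2) * psi (Q ^ 6)) / Q))
      \<longlongrightarrow> 1 / 2) (at 0)"
    by (rule tendsto_eq_intros phi_tendsto psi_tendsto legendre_denominator_tendsto refl | simp)+
qed (simp add: legendre_factor_def mult_ac)

lemma legendre_defect_over_ident_tendsto: "((\<lambda>Q. legendre_defect Q / Q) \<longlongrightarrow> 0) (at 0)"
proof (rule Lim_transform_eventually)
  show "((\<lambda>Q. (phi Q * phi (Q ^ 3) - phi (- Q) * phi (- (Q ^ 3))) / Q - 4 * psi (Q\<^sup>2) * psi (Q ^ 6))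
      \<longlongrightarrow> 0) (at 0)"
    by (rule tendsto_eq_intros psi_tendsto phi_cubic_odd_part_tendsto refl | simp)+
qed (use eventually_neq_at_within[of 0 0] in
      \<open>eventually_elim, simp add: legendre_defect_def diff_divide_distrib\<close>)

lemma legendre_defect_over_ident_square:
  "\<forall>\<^sub>F Q in at 0. legendre_defect Q / Q = legendre_factor Q * (legendre_defect (Q\<^sup>2) / Q\<^sup>2)"
proof -
  have "\<forall>\<^sub>F Q in at 0.
      (phi Q * phi (Q ^ 3) - phi (- Q) * phi (- (Q ^ 3)) + 4 * Q * psi (Q\<^sup>2) * psi (Q ^ 6)) / Q \<noteq> 0"
    by (rule tendsto_imp_eventually_ne[OF legendre_denominator_tendsto]) simp
  thus ?thesis
    using eventually_at_0_norm_less[OF zero_less_one]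
  proof eventually_elim
    case (elim Q)
    define d k where "d = phi Q * phi (Q ^ 3) - phi (- Q) * phi (- (Q ^ 3)) +
        4 * Q * psi (Q\<^sup>2) * psi (Q ^ 6)"
      and "k = phi (Q\<^sup>2) * phi (Q ^ 6) - 4 * Q\<^sup>2 * psi (Q ^ 4) * psi (Q ^ 12) +
          phi (- (Q\<^sup>2)) * phi (- (Q ^ 6))"
    have "legendre_defect Q * d = 2 * legendre_defect (Q\<^sup>2) * k"
      unfolding d_def k_def by (rule legendre_defect_square[OF elim(2)])
    moreover have "d \<noteq> 0" "Q \<noteq> 0" using elim(1) unfolding d_def by auto
    ultimately show ?case
      unfolding legendre_factor_def d_def[symmetric] k_def[symmetric]
      by (simp add: field_simps power2_eq_square)
  qed
qed

theorem legendre_cubic: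
  "\<forall>\<^sub>F Q in at 0. phi Q * phi (Q ^ 3) = phi (- Q) * phi (- (Q ^ 3)) + 4 * Q * psi (Q\<^sup>2) * psi (Q ^ 6)"
proof -
  have "\<forall>\<^sub>F Q in at 0. legendre_defect Q / Q = 0"
    by (rule square_contraction_imp_zero[OF legendre_defect_over_ident_tendsto
        legendre_factor_tendsto _ legendre_defect_over_ident_square]) simp
  thus ?thesis using eventually_neq_at_within[of 0 0]
    by eventually_elim (simp add: legendre_defect_def diff_eq_eq add.commute)
qed

text \<open>The quotient of the two sides is invariant under \<open>Q \<mapsto> Q\<^sup>2\<close> and tends to 1 at 0.\<close>

theorem cubic_multiplier_relation:
  "\<forall>\<^sub>F Q in at 0. phi Q * phi (- Q) * phi (- (Q ^ 3)) * psi (Q\<^sup>2) =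
     phi (Q ^ 3) ^ 3 * psi (Q\<^sup>2) - 4 * Q\<^sup>2 * phi Q * psi (Q ^ 6) ^ 3"
proof -
  define N where "N = (\<lambda>Q. phi Q * phi (- Q) * phi (- (Q ^ 3)) * psi (Q\<^sup>2))"
  define D where "D = (\<lambda>Q. phi (Q ^ 3) ^ 3 * psi (Q\<^sup>2) - 4 * Q\<^sup>2 * phi Q * psi (Q ^ 6) ^ 3)"
  have D_lim: "(D \<longlongrightarrow> 1) (at 0)"
    unfolding D_def by (rule tendsto_eq_intros phi_tendsto psi_tendsto refl | simp)+
  have quotient_lim: "((\<lambda>Q. N Q / D Q) \<longlongrightarrow> 1) (at 0)"
    unfolding N_def by (rule tendsto_eq_intros phi_tendsto psi_tendsto D_lim refl | simp)+
  have D_nonzero: "\<forall>\<^sub>F Q in at 0. D Q \<noteq> 0" by (rule tendsto_imp_eventually_ne[OF D_lim]) simp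
  have "\<forall>\<^sub>F Q in at 0. N Q / D Q = N (Q\<^sup>2) / D (Q\<^sup>2)"
    using D_nonzero eventually_compose_filterlim[OF D_nonzero filterlim_square_at_0]
      legendre_cubic eventually_compose_filterlim[OF legendre_cubic filterlim_square_at_0]
      eventually_at_0_norm_less[OF zero_less_one] eventually_neq_at_within[of 0 0]
  proof eventually_elim
    case (elim Q)
    have powers: "(Q\<^sup>2) ^ 3 = Q ^ 6" "(Q\<^sup>2)\<^sup>2 = Q ^ 4" "(Q\<^sup>2) ^ 6 = Q ^ 12"
      by (simp_all flip: power_mult)
    define b2 where "b2 = phi (- (Q\<^sup>2)) * phi (- (Q ^ 6))"
    note relations = duplication_relations[OF elim(5)]
    have b2_square: "b2\<^sup>2 = phi Q * phi (- Q) * (phi (Q ^ 3) * phi (- (Q ^ 3)))"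
      unfolding b2_def power_mult_distrib relations by (simp add: mult_ac)
    have b2_eq: "b2 = phi (Q\<^sup>2) * phi (Q ^ 6) - 4 * Q\<^sup>2 * psi (Q ^ 4) * psi (Q ^ 12)"
      using elim(4) unfolding powers b2_def by simp
    have "phi (Q ^ 3) * psi (Q\<^sup>2) * D Q = D (Q\<^sup>2) * b2"
      unfolding D_def powers using b2_square b2_eq elim(3) relations(1,3,5,7) by algebra
    moreover have "N (Q\<^sup>2) * b2 = N Q * phi (Q ^ 3) * psi (Q\<^sup>2)"
      unfolding N_def powers b2_def using relations(3,4,8) by algebra
    moreover have "phi (Q ^ 3) * psi (Q\<^sup>2) * b2 \<noteq> 0"
      unfolding b2_def using elim(5) by (simp add: phi_nonzero psi_nonzero norm_power_less_1)
    ultimately have "N Q * D (Q\<^sup>2) = N (Q\<^sup>2) * D Q" by algebra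
    thus ?case using elim(1,2) by (simp add: frac_eq_eq)
  qed
  with quotient_lim have "\<forall>\<^sub>F Q in at 0. N Q / D Q = 1" by (rule square_invariant_imp_constant)
  with D_nonzero show ?thesis by eventually_elim (simp add: N_def D_def)
qed

section \<open>Functions of level 6\<close>

definition v_fun :: "complex \<Rightarrow> complex" where "v_fun Q = Q * psi (Q ^ 6) ^ 2 / psi (Q\<^sup>2) ^ 2"

definition w_fun :: "complex \<Rightarrow> complex" where "w_fun Q = Q * psi (Q ^ 3) ^ 4 / psi Q ^ 4"

definition N_fun :: "complex \<Rightarrow> complex" where "N_fun Q = psi Q ^ 6 / psi (Q ^ 3) ^ 2"

definition u_fun :: "complex \<Rightarrow> complex" where
  "u_fun Q = Q * (euler_prod (Q\<^sup>2) * euler_prod (Q ^ 6) / (euler_prod Q * euler_prod (Q ^ 3))) ^ 6"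

lemma w_fun_square: "w_fun (Q\<^sup>2) = v_fun Q ^ 2"
  unfolding w_fun_def v_fun_def by (simp add: power_mult_distrib power_divide flip: power_mult)

lemma v_fun_tendsto: "(v_fun \<longlongrightarrow> 0) (at 0)"
  unfolding v_fun_def[abs_def] by (rule tendsto_eq_intros psi_tendsto refl | simp)+

lemma w_fun_tendsto: "(w_fun \<longlongrightarrow> 0) (at 0)"
  unfolding w_fun_def[abs_def] by (rule tendsto_eq_intros psi_tendsto refl | simp)+

lemma N_fun_tendsto: "(N_fun \<longlongrightarrow> 1) (at 0)"
  unfolding N_fun_def[abs_def] by (rule tendsto_eq_intros psi_tendsto refl | simp)+

lemma N_fun_nonzero: "norm Q < 1 \<Longrightarrow> N_fun Q \<noteq> 0"
  unfolding N_fun_def by (simp add: psi_nonzero norm_power_less_1)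

lemma w_fun_holomorphic: "w_fun holomorphic_on ball 0 1"
  and v_fun_holomorphic: "v_fun holomorphic_on ball 0 1"
  unfolding w_fun_def[abs_def] v_fun_def[abs_def]
  by (intro holomorphic_intros holomorphic_on_power_arg[OF psi_holomorphic] psi_holomorphic;
      simp add: psi_nonzero norm_power_less_1)+

lemma eventually_punctured_unit_disc: "\<forall>\<^sub>F Q in at (0::complex). norm Q < 1 \<and> Q \<noteq> 0"
  using eventually_at_0_norm_less[OF zero_less_one] eventually_neq_at_within[of 0 0]
  by eventually_elim simp

lemma v_fun_factors_nonzero:
  "\<forall>\<^sub>F Q in at 0. v_fun Q \<noteq> 0 \<and> 1 - v_fun Q \<noteq> 0 \<and> 1 + v_fun Q \<noteq> 0 \<and> 1 - 3 * v_fun Q \<noteq> 0 \<and>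
      1 + 3 * v_fun Q \<noteq> 0"
proof -
  have "\<forall>\<^sub>F Q in at 0. 1 + c * v_fun Q \<noteq> 0" for c
    by (rule eventually_compose_filterlim[OF eventually_one_plus_nonzero v_fun_tendsto])
  from this[of "- 1"] this[of 1] this[of "- 3"] this[of 3] eventually_punctured_unit_disc
  show ?thesis
    by eventually_elim (auto simp: v_fun_def psi_nonzero norm_power_less_1)
qed

lemma theta_quartic_relation:
  "\<forall>\<^sub>F Q in at 0. phi Q * phi (Q ^ 3) * psi (Q\<^sup>2) * psi (Q ^ 6) * (phi (- Q) * phi (- (Q ^ 3)))\<^sup>2 =
     (phi (Q ^ 3) ^ 2 * psi (Q\<^sup>2) ^ 2 - Q * phi Q ^ 2 * psi (Q ^ 6) ^ 2)\<^sup>2"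
  using legendre_cubic eventually_punctured_unit_disc
proof eventually_elim
  case (elim Q)
  define a A s S where "a = phi Q" and "A = phi (Q ^ 3)" and "s = psi (Q\<^sup>2)" and "S = psi (Q ^ 6)"
  note defs = this
  have norm_Q3: "norm (Q ^ 3) < 1" using norm_power_less_1[of Q 3] elim by simp
  have bB_eq: "phi (- Q) * phi (- (Q ^ 3)) = a * A - 4 * Q * s * S" using elim by (simp add: defs)
  have "(a * A - 4 * Q * s * S) ^ 4 = phi (- Q) ^ 4 * phi (- (Q ^ 3)) ^ 4"
    unfolding bB_eq[symmetric] by (rule power_mult_distrib)
  also have "\<dots> = (a ^ 4 - 16 * Q * s ^ 4) * (A ^ 4 - 16 * Q ^ 3 * S ^ 4)"
    using jacobi_quartic[of Q] jacobi_quartic[OF norm_Q3] elim by (simp add: defs flip: power_mult)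
  finally have "(16 * Q) * (a * A * s * S * (a * A - 4 * Q * s * S)\<^sup>2) =
      (16 * Q) * (A\<^sup>2 * s\<^sup>2 - Q * a\<^sup>2 * S\<^sup>2)\<^sup>2"
    by algebra
  hence "a * A * s * S * (a * A - 4 * Q * s * S)\<^sup>2 = (A\<^sup>2 * s\<^sup>2 - Q * a\<^sup>2 * S\<^sup>2)\<^sup>2" using elim by simp
  thus ?case unfolding bB_eq defs .
qed

text \<open>Up to the normalising factors \<open>psi (Q\<^sup>2)\<close> and \<open>phi (Q\<^sup>3)\<close>, all theta values are functions
  of \<open>v\<close>.\<close>

lemma theta_parametrization:
  "\<forall>\<^sub>F Q in at 0. phi Q ^ 2 * (1 - v_fun Q) = phi (Q ^ 3) ^ 2 * (1 + 3 * v_fun Q) \<and>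
     phi (Q ^ 3) ^ 3 * psi (Q ^ 6) = phi Q * psi (Q\<^sup>2) ^ 3 * (1 - v_fun Q)\<^sup>2"
  using legendre_cubic cubic_multiplier_relation theta_quartic_relation
    eventually_punctured_unit_disc
proof eventually_elim
  case (elim Q)
  define a b A B s S v where "a = phi Q" and "b = phi (- Q)" and "A = phi (Q ^ 3)"
    and "B = phi (- (Q ^ 3))"
    and "s = psi (Q\<^sup>2)" and "S = psi (Q ^ 6)" and "v = v_fun Q"
  note defs = this
  define W where "W = A\<^sup>2 * s\<^sup>2 - Q * a\<^sup>2 * S\<^sup>2"
  have nonzero: "a \<noteq> 0" "b \<noteq> 0" "A \<noteq> 0" "B \<noteq> 0" "s \<noteq> 0" "S \<noteq> 0"
    unfolding defs using elim by (auto simp: phi_nonzero psi_nonzero norm_power_less_1)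
  have v_eq: "Q * S\<^sup>2 = v * s\<^sup>2" using nonzero by (simp add: v_fun_def defs)
  have legendre: "a * A = b * B + 4 * Q * s * S" using elim(1) unfolding defs .
  have multiplier: "a * b * B * s = A ^ 3 * s - 4 * Q\<^sup>2 * a * S ^ 3" using elim(2) unfolding defs .
  have quartic: "a * A * s * S * (b * B)\<^sup>2 = W\<^sup>2" using elim(3) unfolding defs W_def .
  have "W \<noteq> 0" using quartic nonzero by auto
  have difference: "A * s * (a\<^sup>2 - A\<^sup>2) = 4 * Q * a * S * (s\<^sup>2 * (1 - v))"
    using multiplier legendre v_eq by algebra
  hence bB_eq: "b * B * (a * (s\<^sup>2 * (1 - v))) = A * W"
    unfolding W_def using legendre v_eq by algebra
  have "(W\<^sup>2 * a) * (A ^ 3 * s * S) = (W\<^sup>2 * a) * (a * (s\<^sup>2 * (1 - v))\<^sup>2)"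
    using quartic bB_eq by algebra
  hence product: "A ^ 3 * s * S = a * (s\<^sup>2 * (1 - v))\<^sup>2" using \<open>W \<noteq> 0\<close> nonzero by simp
  hence "s * (A ^ 3 * S) = s * (a * s ^ 3 * (1 - v)\<^sup>2)" by algebra
  moreover have "(A * s ^ 3) * (a\<^sup>2 * (1 - v)) = (A * s ^ 3) * (A\<^sup>2 * (1 + 3 * v))"
    using difference product v_eq by algebra
  ultimately show ?case using nonzero unfolding defs by simp
qed

lemma w_fun_N_fun_eq_phi_psi:
  assumes "norm Q < 1"
  shows "w_fun Q = v_fun Q * phi (Q ^ 3) ^ 2 / phi Q ^ 2"
    and "N_fun Q = (phi Q * psi (Q\<^sup>2)) ^ 3 / (phi (Q ^ 3) * psi (Q ^ 6))"
proof -
  have square: "psi Q ^ 2 = phi Q * psi (Q\<^sup>2)" by (rule psi_square[OF assms])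
  have square3: "psi (Q ^ 3) ^ 2 = phi (Q ^ 3) * psi (Q ^ 6)"
    using psi_square[of "Q ^ 3"] assms by (simp add: norm_power_less_1 flip: power_mult)
  have "psi Q ^ 4 = (phi Q * psi (Q\<^sup>2))\<^sup>2" "psi (Q ^ 3) ^ 4 = (phi (Q ^ 3) * psi (Q ^ 6))\<^sup>2"
    using square square3 by algebra+
  moreover have "psi (Q\<^sup>2) \<noteq> 0" using assms by (simp add: psi_nonzero norm_power_less_1)
  ultimately show "w_fun Q = v_fun Q * phi (Q ^ 3) ^ 2 / phi Q ^ 2"
    by (simp add: w_fun_def v_fun_def power_mult_distrib mult_ac)
  have "psi Q ^ 6 = (phi Q * psi (Q\<^sup>2)) ^ 3" using square by algebra
  thus "N_fun Q = (phi Q * psi (Q\<^sup>2)) ^ 3 / (phi (Q ^ 3) * psi (Q ^ 6))"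
    unfolding N_fun_def square3 by simp
qed

lemma w_fun_eq_R_map: "\<forall>\<^sub>F Q in at 0. w_fun Q = R_map (v_fun Q)"
  using theta_parametrization v_fun_factors_nonzero eventually_punctured_unit_disc
proof eventually_elim
  case (elim Q)
  have "phi Q \<noteq> 0" using elim by (simp add: phi_nonzero)
  thus ?case using elim unfolding R_map_def
    by (subst w_fun_N_fun_eq_phi_psi(1), simp, subst frac_eq_eq) (auto simp: mult.commute)
qed

lemma N_fun_square: "\<forall>\<^sub>F Q in at 0. N_fun Q = (1 + 3 * v_fun Q)\<^sup>2 * N_fun (Q\<^sup>2)"
  using theta_parametrization eventually_punctured_unit_disc
proof eventually_elim
  case (elim Q)
  define a A s S v where "a = phi Q" and "A = phi (Q ^ 3)" and "s = psi (Q\<^sup>2)" and "S = psi (Q ^ 6)"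
    and "v = v_fun Q"
  note defs = this
  have nonzero: "A \<noteq> 0" "S \<noteq> 0"
    unfolding defs using elim by (auto simp: phi_nonzero psi_nonzero norm_power_less_1)
  have N_eq: "N_fun Q = (a * s) ^ 3 / (A * S)"
    using w_fun_N_fun_eq_phi_psi(2)[of Q] elim by (simp add: defs)
  have N_square_eq: "N_fun (Q\<^sup>2) = s ^ 6 / S\<^sup>2" by (simp add: N_fun_def defs flip: power_mult)
  have "a\<^sup>2 * (1 - v) = A\<^sup>2 * (1 + 3 * v)" "A ^ 3 * S = a * s ^ 3 * (1 - v)\<^sup>2"
    using elim(1) unfolding defs by auto
  hence "A ^ 3 * (a ^ 3 * S) = A ^ 3 * (A * s ^ 3 * (1 + 3 * v)\<^sup>2)" by algebra
  hence "a ^ 3 * S = A * s ^ 3 * (1 + 3 * v)\<^sup>2" using nonzero by simp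
  hence "(a * s) ^ 3 * S\<^sup>2 = ((1 + 3 * v)\<^sup>2 * s ^ 6) * (A * S)" by algebra
  thus ?case unfolding N_eq N_square_eq v_def[symmetric] using nonzero by (simp add: frac_eq_eq)
qed

lemma theta_euler_products:
  assumes "norm Q < 1"
  shows "phi (- Q) * phi (- (Q ^ 3)) =
      (euler_prod Q * euler_prod (Q ^ 3))\<^sup>2 / (euler_prod (Q\<^sup>2) * euler_prod (Q ^ 6))"
    and "phi Q * phi (Q ^ 3) * psi (Q\<^sup>2) * psi (Q ^ 6) =
      ((euler_prod (Q\<^sup>2) * euler_prod (Q ^ 6))\<^sup>2 / (euler_prod Q * euler_prod (Q ^ 3)))\<^sup>2"
proof -
  have norm_Q3: "norm (Q ^ 3) < 1" using norm_power_less_1[OF assms, of 3] by simp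
  show "phi (- Q) * phi (- (Q ^ 3)) =
      (euler_prod Q * euler_prod (Q ^ 3))\<^sup>2 / (euler_prod (Q\<^sup>2) * euler_prod (Q ^ 6))"
    unfolding phi_uminus[OF assms] phi_uminus[OF norm_Q3]
    by (simp add: power_mult_distrib flip: power_mult)
  have "phi Q * phi (Q ^ 3) * psi (Q\<^sup>2) * psi (Q ^ 6) = (psi Q * psi (Q ^ 3))\<^sup>2"
    using psi_square[OF assms] psi_square[OF norm_Q3]
    by (simp add: power_mult_distrib flip: power_mult)
  thus "phi Q * phi (Q ^ 3) * psi (Q\<^sup>2) * psi (Q ^ 6) =
      ((euler_prod (Q\<^sup>2) * euler_prod (Q ^ 6))\<^sup>2 / (euler_prod Q * euler_prod (Q ^ 3)))\<^sup>2"
    by (simp add: psi_def power_mult_distrib flip: power_mult)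
qed

lemma theta_quartic_root_eq:
  "\<forall>\<^sub>F Q in at 0. (phi (Q ^ 3) ^ 2 * psi (Q\<^sup>2) ^ 2 - Q * phi Q ^ 2 * psi (Q ^ 6) ^ 2) *
      (1 - v_fun Q) =
     phi (Q ^ 3) ^ 2 * psi (Q\<^sup>2) ^ 2 * ((1 + v_fun Q) * (1 - 3 * v_fun Q))"
  using theta_parametrization eventually_punctured_unit_disc
proof eventually_elim
  case (elim Q)
  have "Q * psi (Q ^ 6) ^ 2 = v_fun Q * psi (Q\<^sup>2) ^ 2"
    using elim by (simp add: v_fun_def psi_nonzero norm_power_less_1)
  thus ?case using elim(1) by algebra
qed

lemma u_fun_mult_eq_w_fun: "\<forall>\<^sub>F Q in at 0. u_fun Q * ((1 - w_fun Q) * (1 - 9 * w_fun Q)) = w_fun Q"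
  using theta_quartic_relation theta_quartic_root_eq theta_parametrization w_fun_eq_R_map
    v_fun_factors_nonzero eventually_punctured_unit_disc
proof eventually_elim
  case (elim Q)
  define v b where "v = v_fun Q" and "b = phi (- Q) * phi (- (Q ^ 3))"
  define a A s S where "a = phi Q" and "A = phi (Q ^ 3)" and "s = psi (Q\<^sup>2)" and "S = psi (Q ^ 6)"
  note defs = v_def b_def this
  have nonzero: "A \<noteq> 0" "s \<noteq> 0"
    unfolding defs using elim by (auto simp: phi_nonzero psi_nonzero norm_power_less_1)
  have factors: "1 + 3 * v \<noteq> 0" using elim unfolding defs by blast
  have v_eq: "Q * S\<^sup>2 = v * s\<^sup>2" using nonzero by (simp add: v_fun_def defs)
  have "u_fun Q * b\<^sup>2 = Q * (a * A * s * S)"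
  proof -
    have "(f / e) ^ 6 * (e\<^sup>2 / f)\<^sup>2 = (f\<^sup>2 / e)\<^sup>2" if "e \<noteq> 0" "f \<noteq> 0" for e f :: complex
      using that by (simp add: field_simps eval_nat_numeral)
    thus ?thesis using theta_euler_products[of Q] elim unfolding defs u_fun_def
      by (simp add: euler_prod_nonzero euler_prod_power_nonzero)
  qed
  hence "u_fun Q * (A\<^sup>2 * s\<^sup>2 - Q * a\<^sup>2 * S\<^sup>2)\<^sup>2 = Q * (a * A * s * S)\<^sup>2"
    using elim(1) unfolding defs[symmetric] by algebra
  hence "(A ^ 4 * s ^ 4) * (u_fun Q * ((1 + v) * (1 - 3 * v))\<^sup>2) =
      (A ^ 4 * s ^ 4) * (v * (1 - v) * (1 + 3 * v))"
    using elim(2,3) v_eq unfolding defs[symmetric] by algebra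
  hence "u_fun Q * ((1 + v) * (1 - 3 * v))\<^sup>2 = v * (1 - v) * (1 + 3 * v)" using nonzero by simp
  hence "u_fun Q * (((1 + v)\<^sup>2 / (1 + 3 * v)) * ((1 - 3 * v)\<^sup>2 / (1 + 3 * v))) =
      v * (1 - v) / (1 + 3 * v)"
    using factors by (simp add: power_mult_distrib power2_eq_square[of "1 + 3 * v"])
  thus ?case
    unfolding elim(4) defs(1)[symmetric] R_map_factors[OF factors] by (simp add: R_map_def)
qed

lemma euler_prod_square_eq_p_cubic:
  "\<forall>\<^sub>F Q in at 0. Q * (euler_prod Q * euler_prod (Q\<^sup>2) * euler_prod (Q ^ 3) * euler_prod (Q ^ 6))\<^sup>2
     = (N_fun Q)\<^sup>2 * p_cubic (w_fun Q)"
  using theta_quartic_relation theta_quartic_root_eq theta_parametrization w_fun_eq_R_map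
    v_fun_factors_nonzero eventually_punctured_unit_disc
proof eventually_elim
  case (elim Q)
  define v where "v = v_fun Q"
  define a A s S where "a = phi Q" and "A = phi (Q ^ 3)" and "s = psi (Q\<^sup>2)" and "S = psi (Q ^ 6)"
  define W where "W = A\<^sup>2 * s\<^sup>2 - Q * a\<^sup>2 * S\<^sup>2"
  note defs = v_def a_def A_def s_def S_def
  have nonzero: "a \<noteq> 0" "A \<noteq> 0" "s \<noteq> 0" "S \<noteq> 0"
    unfolding defs using elim by (auto simp: phi_nonzero psi_nonzero norm_power_less_1)
  have factors: "1 + 3 * v \<noteq> 0" "1 - v \<noteq> 0" using elim unfolding defs by blast+
  have v_eq: "Q * S\<^sup>2 = v * s\<^sup>2" using nonzero by (simp add: v_fun_def defs)
  have "(f\<^sup>2 / e)\<^sup>2 * (e\<^sup>2 / f)\<^sup>2 = (e * f)\<^sup>2" if "e \<noteq> 0" "f \<noteq> 0" for e f :: complex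
    using that by (simp add: field_simps eval_nat_numeral)
  hence product: "(euler_prod Q * euler_prod (Q\<^sup>2) * euler_prod (Q ^ 3) * euler_prod (Q ^ 6))\<^sup>2 = W\<^sup>2"
    using theta_euler_products[of Q] elim(1,6) unfolding W_def defs
    by (simp add: euler_prod_nonzero euler_prod_power_nonzero mult_ac)
  have "(N_fun Q)\<^sup>2 * w_fun Q = ((a * s) ^ 3 / (A * S))\<^sup>2 * (v * A\<^sup>2 / a\<^sup>2)"
    using w_fun_N_fun_eq_phi_psi[of Q] elim by (simp add: defs)
  also have "\<dots> = a ^ 4 * s ^ 4 * (v * s\<^sup>2) / S\<^sup>2"
    using nonzero by (simp add: field_simps eval_nat_numeral)
  also have "\<dots> = Q * (a ^ 4 * s ^ 4)" unfolding v_eq[symmetric] using nonzero by simp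
  finally have "(N_fun Q)\<^sup>2 * p_cubic (w_fun Q) =
      Q * (a ^ 4 * s ^ 4) * ((1 - w_fun Q) * (1 - 9 * w_fun Q))"
    unfolding p_cubic_def by (simp add: mult_ac)
  also have "\<dots> = Q * (a ^ 4 * s ^ 4 * ((1 + v) * (1 - 3 * v))\<^sup>2) / (1 + 3 * v)\<^sup>2"
    unfolding elim(4) defs(1)[symmetric] R_map_factors[OF factors(1)]
    by (simp add: power_mult_distrib power2_eq_square[of "1 + 3 * v"])
  also have "a ^ 4 * s ^ 4 * ((1 + v) * (1 - 3 * v))\<^sup>2 = W\<^sup>2 * (1 + 3 * v)\<^sup>2"
  proof -
    have "(1 - v)\<^sup>2 * (a ^ 4 * s ^ 4 * ((1 + v) * (1 - 3 * v))\<^sup>2) = (1 - v)\<^sup>2 * (W\<^sup>2 * (1 + 3 * v)\<^sup>2)"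
      using elim(2,3) unfolding defs[symmetric] W_def[symmetric] by algebra
    thus ?thesis using factors by simp
  qed
  finally show ?case unfolding product using factors by simp
qed

section \<open>The Eisenstein series\<close>

lemma deriv_along_log_mult:
  "deriv_along P f (a * f z) z \<Longrightarrow> deriv_along P g (b * g z) z \<Longrightarrow>
     deriv_along P (\<lambda>z. f z * g z) ((a + b) * (f z * g z)) z"
  by (drule (1) deriv_along_mult, erule deriv_along_eq_rhs) (simp add: algebra_simps)

lemma deriv_along_log_divide:
  "deriv_along P f (a * f z) z \<Longrightarrow> deriv_along P g (b * g z) z \<Longrightarrow> g z \<noteq> 0 \<Longrightarrow>
     deriv_along P (\<lambda>z. f z / g z) ((a - b) * (f z / g z)) z"
  by (drule (2) deriv_along_divide, erule deriv_along_eq_rhs)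
     (simp add: field_simps power2_eq_square)

lemma deriv_along_log_power:
  "deriv_along P f (a * f z) z \<Longrightarrow> deriv_along P (\<lambda>z. f z ^ n) (of_nat n * a * f z ^ n) z"
  by (drule deriv_along_power[of _ _ _ _ n], erule deriv_along_eq_rhs) (cases n; simp add: mult_ac)

lemma deriv_along_log_ident: "deriv_along (\<lambda>Q. Q) (\<lambda>Q. Q) (1 * Q) Q"
  using deriv_along_ident[of "\<lambda>Q. Q" Q] by simp

lemma holomorphic_deriv_along:
  assumes "f holomorphic_on ball 0 1" "norm Q < 1"
  shows "deriv_along (\<lambda>Q. Q) f (Q * deriv f Q) Q"
  by (rule deriv_alongI[OF holomorphic_derivI[OF assms(1) open_ball]]) (use assms in auto)

definition euler_logderiv :: "complex \<Rightarrow> complex" where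
  "euler_logderiv q = q * deriv euler_prod q / euler_prod q"

definition Z_fun :: "complex \<Rightarrow> complex" where
  "Z_fun Q = 1 / 4 *
     (6 * ramanujan_P (Q ^ 6) - 3 * ramanujan_P (Q ^ 3) + 2 * ramanujan_P (Q\<^sup>2) - ramanujan_P Q)"

lemma ramanujan_P_eq_euler_logderiv:
  assumes "norm q < 1"
  shows "ramanujan_P q = 1 + 24 * euler_logderiv q"
proof -
  have "(\<Sum>j. of_nat (Suc j) * q ^ Suc j / (1 - q ^ Suc j)) = - euler_logderiv q"
    using euler_prod_logderiv_sums[OF assms]
    unfolding euler_logderiv_def by (rule sums_unique[symmetric])
  thus ?thesis unfolding ramanujan_P_def by simp
qed

lemma Z_fun_eq_euler_logderiv:
  assumes "norm Q < 1"
  shows "Z_fun Q = 1 + 6 *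
      (6 * euler_logderiv (Q ^ 6) - 3 * euler_logderiv (Q ^ 3) + 2 * euler_logderiv (Q\<^sup>2)
      - euler_logderiv Q)"
  unfolding Z_fun_def using assms
  by (simp add: ramanujan_P_eq_euler_logderiv norm_power_less_1 algebra_simps)

lemma euler_logderiv_tendsto:
  assumes "(g \<longlongrightarrow> 0) F"
  shows "((\<lambda>x. euler_logderiv (g x)) \<longlongrightarrow> 0) F"
proof -
  have "euler_logderiv holomorphic_on ball 0 1" unfolding euler_logderiv_def[abs_def]
    by (intro holomorphic_intros holomorphic_deriv euler_prod_holomorphic)
       (auto simp: euler_prod_nonzero)
  from holomorphic_tendsto_compose_at_0[OF this assms] show ?thesis
    by (simp add: euler_logderiv_def)
qed

lemma Z_fun_tendsto: "(Z_fun \<longlongrightarrow> 1) (at 0)"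
proof (rule Lim_transform_eventually)
  show "((\<lambda>Q. 1 + 6 * (6 * euler_logderiv (Q ^ 6) - 3 * euler_logderiv (Q ^ 3)
      + 2 * euler_logderiv (Q\<^sup>2) - euler_logderiv Q)) \<longlongrightarrow> 1) (at 0)"
    by (rule tendsto_eq_intros euler_logderiv_tendsto refl | simp)+
  show "\<forall>\<^sub>F Q in at 0. 1 + 6 *
      (6 * euler_logderiv (Q ^ 6) - 3 * euler_logderiv (Q ^ 3) + 2 * euler_logderiv (Q\<^sup>2)
      - euler_logderiv Q) = Z_fun Q"
    using eventually_at_0_norm_less[OF zero_less_one]
    by eventually_elim (simp add: Z_fun_eq_euler_logderiv)
qed

lemma euler_prod_power_deriv_along:
  assumes norm_Q: "norm Q < 1" and n_pos: "n > 0"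
  shows "deriv_along (\<lambda>Q. Q) (\<lambda>Q. euler_prod (Q ^ n))
      (of_nat n * euler_logderiv (Q ^ n) * euler_prod (Q ^ n)) Q"
proof -
  have "deriv_along (\<lambda>Q. Q) euler_prod (Q ^ n * deriv euler_prod (Q ^ n)) (Q ^ n)"
    by (rule holomorphic_deriv_along[OF euler_prod_holomorphic norm_power_less_1[OF norm_Q n_pos]])
  moreover have "deriv_along (\<lambda>Q. Q) (\<lambda>Q. Q ^ n) (of_nat n * Q ^ n) Q"
    using deriv_along_log_power[OF deriv_along_log_ident, of n Q] by simp
  ultimately have "deriv_along (\<lambda>Q. Q) (\<lambda>Q. euler_prod (Q ^ n))
      (of_nat n * (Q ^ n * deriv euler_prod (Q ^ n))) Q"
    by (rule deriv_along_compose)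
  thus ?thesis
    by (rule deriv_along_eq_rhs)
       (use euler_prod_power_nonzero[OF norm_Q n_pos] in \<open>simp add: euler_logderiv_def\<close>)
qed

lemma u_fun_deriv_along:
  assumes norm_Q: "norm Q < 1"
  shows "deriv_along (\<lambda>Q. Q) u_fun (Z_fun Q * u_fun Q) Q"
proof -
  note euler_prod_derivs = euler_prod_power_deriv_along[OF norm_Q]
  have "euler_prod (Q ^ 1) * euler_prod (Q ^ 3) \<noteq> 0"
    using norm_Q by (simp add: euler_prod_nonzero euler_prod_power_nonzero)
  hence "deriv_along (\<lambda>Q. Q)
      (\<lambda>Q. Q * (euler_prod (Q\<^sup>2) * euler_prod (Q ^ 6) / (euler_prod (Q ^ 1) * euler_prod (Q ^ 3))) ^ 6)
      ((1 + of_nat 6 * ((of_nat 2 * euler_logderiv (Q\<^sup>2) + of_nat 6 * euler_logderiv (Q ^ 6))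
         - (of_nat 1 * euler_logderiv (Q ^ 1) + of_nat 3 * euler_logderiv (Q ^ 3)))) *
       (Q * (euler_prod (Q\<^sup>2) * euler_prod (Q ^ 6) / (euler_prod (Q ^ 1) * euler_prod (Q ^ 3))) ^ 6)) Q"
    by (intro deriv_along_log_ident deriv_along_log_mult deriv_along_log_power
        deriv_along_log_divide euler_prod_derivs) simp_all
  thus ?thesis unfolding u_fun_def[abs_def] Z_fun_eq_euler_logderiv[OF norm_Q]
    by (simp add: algebra_simps)
qed

lemma eventually_at_0_imp_eventually_nhds:
  "\<forall>\<^sub>F Q in at (0::complex). P Q \<Longrightarrow> \<forall>\<^sub>F Q in at 0. \<forall>\<^sub>F x in nhds Q. P x"
  unfolding eventually_at_filter
  by (subst (asm) eventually_eventually[symmetric], erule eventually_mono)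
     (auto elim: eventually_elim2[OF _ t1_space_nhds])

lemma p_cubic_w_fun_nonzero: "\<forall>\<^sub>F Q in at 0. p_cubic (w_fun Q) \<noteq> 0"
  using w_fun_eq_R_map v_fun_factors_nonzero by eventually_elim (simp add: p_cubic_R_map)

lemma w_fun_over_ident_tendsto: "((\<lambda>Q. w_fun Q / Q) \<longlongrightarrow> 1) (at 0)"
proof (rule Lim_transform_eventually)
  show "((\<lambda>Q. psi (Q ^ 3) ^ 4 / psi Q ^ 4) \<longlongrightarrow> 1) (at 0)"
    by (rule tendsto_eq_intros psi_tendsto refl | simp)+
  show "\<forall>\<^sub>F Q in at 0. psi (Q ^ 3) ^ 4 / psi Q ^ 4 = w_fun Q / Q"
    using eventually_neq_at_within[of 0 0] by eventually_elim (simp add: w_fun_def)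
qed

lemma deriv_w_fun_tendsto: "(deriv w_fun \<longlongrightarrow> 1) (at 0)"
proof -
  have "deriv w_fun 0 = 1"
    by (rule DERIV_imp_deriv)
       (use w_fun_over_ident_tendsto in \<open>simp add: DERIV_def w_fun_def[of 0]\<close>)
  moreover have "deriv w_fun holomorphic_on ball 0 1"
    by (intro holomorphic_deriv w_fun_holomorphic open_ball)
  ultimately show ?thesis
    using holomorphic_tendsto_compose_at_0[of "deriv w_fun" "\<lambda>Q. Q" "at 0"] by simp
qed

lemma deriv_w_fun_quotient_tendsto:
  "((\<lambda>Q. Q * deriv w_fun Q / (N_fun Q * p_cubic (w_fun Q))) \<longlongrightarrow> 1) (at 0)"
proof (rule Lim_transform_eventually)
  show "((\<lambda>Q. deriv w_fun Q /
      (N_fun Q * (w_fun Q / Q * (1 - w_fun Q) * (1 - 9 * w_fun Q)))) \<longlongrightarrow> 1) (at 0)"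
    by (rule tendsto_eq_intros N_fun_tendsto w_fun_tendsto w_fun_over_ident_tendsto
        deriv_w_fun_tendsto refl | simp)+
  show "\<forall>\<^sub>F Q in at 0. deriv w_fun Q
      / (N_fun Q * (w_fun Q / Q * (1 - w_fun Q) * (1 - 9 * w_fun Q))) =
      Q * deriv w_fun Q / (N_fun Q * p_cubic (w_fun Q))"
    using eventually_neq_at_within[of 0 0] by eventually_elim (simp add: p_cubic_def)
qed

lemma w_fun_square_deriv:
  assumes norm_Q: "norm Q < 1" and v_deriv: "deriv_along (\<lambda>Q. Q) v_fun d Q"
  shows "Q\<^sup>2 * deriv w_fun (Q\<^sup>2) = v_fun Q * d"
proof -
  have norm_Q2: "norm (Q\<^sup>2) < 1" using norm_power_less_1[OF norm_Q, of 2] by simp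
  have "deriv_along (\<lambda>Q. Q) (\<lambda>Q. w_fun (Q\<^sup>2)) (of_nat 2 * (Q\<^sup>2 * deriv w_fun (Q\<^sup>2))) Q"
    using deriv_along_compose[of "\<lambda>Q. Q" w_fun _ "\<lambda>Q. Q\<^sup>2" Q]
      holomorphic_deriv_along[OF w_fun_holomorphic norm_Q2]
      deriv_along_log_power[OF deriv_along_log_ident, of 2 Q] by simp
  moreover have "deriv_along (\<lambda>Q. Q) (\<lambda>Q. w_fun (Q\<^sup>2)) (2 * v_fun Q * d) Q"
    unfolding w_fun_square using deriv_along_power[OF v_deriv, of 2] by simp
  ultimately have "of_nat 2 * (Q\<^sup>2 * deriv w_fun (Q\<^sup>2)) = 2 * v_fun Q * d"
    by (rule deriv_along_unique)
  thus ?thesis by simp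
qed

lemma w_fun_derivs_proportional:
  "\<forall>\<^sub>F Q in at 0. \<exists>c. Q * deriv w_fun Q = c * p_cubic (w_fun Q) \<and>
     Q\<^sup>2 * deriv w_fun (Q\<^sup>2) * (1 + 3 * v_fun Q)\<^sup>2 = c * p_cubic (w_fun (Q\<^sup>2))"
  using eventually_at_0_imp_eventually_nhds[OF w_fun_eq_R_map] v_fun_factors_nonzero
    eventually_punctured_unit_disc
proof eventually_elim
  case (elim Q)
  define v where "v = v_fun Q"
  have nonzero: "v \<noteq> 0" "1 - v \<noteq> 0" "1 + v \<noteq> 0" "1 - 3 * v \<noteq> 0" "1 + 3 * v \<noteq> 0"
    using elim(2) unfolding v_def by auto
  define c where "c = Q * deriv v_fun Q / p_pullback v"
  have "1 - v\<^sup>2 = (1 + v) * (1 - v)" by (simp add: algebra_simps power2_eq_square)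
  hence c_eq: "Q * deriv v_fun Q = c * p_pullback v"
    unfolding c_def using nonzero by (simp add: p_pullback_def)
  have v_deriv: "deriv_along (\<lambda>Q. Q) v_fun (c * p_pullback v) Q"
    using holomorphic_deriv_along[OF v_fun_holomorphic, of Q] elim unfolding c_eq by simp
  hence "deriv_along (\<lambda>Q. Q) (\<lambda>Q. R_map (v_fun Q)) (c * p_cubic (R_map v)) Q"
    using deriv_along_compose[of p_pullback R_map _ v_fun Q] R_map_deriv_along[OF nonzero(5)]
    unfolding v_def by blast
  moreover have "deriv_along (\<lambda>Q. Q) (\<lambda>Q. R_map (v_fun Q)) (Q * deriv w_fun Q) Q"
    by (rule deriv_along_cong[OF holomorphic_deriv_along[OF w_fun_holomorphic] elim(1)])
       (use elim in simp)
  ultimately have "Q * deriv w_fun Q = c * p_cubic (R_map v)"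
    by (rule deriv_along_unique[symmetric])
  moreover have "w_fun Q = R_map v" using eventually_nhds_x_imp_x[OF elim(1)] by (simp add: v_def)
  moreover have "Q\<^sup>2 * deriv w_fun (Q\<^sup>2) * (1 + 3 * v)\<^sup>2 = c * p_cubic (w_fun (Q\<^sup>2))"
    using w_fun_square_deriv[OF _ v_deriv] elim nonzero(5)
    unfolding w_fun_square v_def[symmetric] p_pullback_def p_cubic_def
    by (simp add: field_simps) algebra
  ultimately show ?case unfolding v_def by auto
qed

text \<open>The quotient of the two sides is invariant under \<open>Q \<mapsto> Q\<^sup>2\<close>.\<close>

lemma w_fun_ode: "\<forall>\<^sub>F Q in at 0. Q * deriv w_fun Q = N_fun Q * p_cubic (w_fun Q)"
proof -
  define G where "G = (\<lambda>Q. Q * deriv w_fun Q / (N_fun Q * p_cubic (w_fun Q)))"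
  have "\<forall>\<^sub>F Q in at 0. G Q = G (Q\<^sup>2)"
    using w_fun_derivs_proportional N_fun_square v_fun_factors_nonzero p_cubic_w_fun_nonzero
      eventually_compose_filterlim[OF p_cubic_w_fun_nonzero filterlim_square_at_0]
      eventually_punctured_unit_disc
  proof eventually_elim
    case (elim Q)
    then obtain c where derivs: "Q * deriv w_fun Q = c * p_cubic (w_fun Q)"
      "Q\<^sup>2 * deriv w_fun (Q\<^sup>2) * (1 + 3 * v_fun Q)\<^sup>2 = c * p_cubic (w_fun (Q\<^sup>2))" by blast
    have "N_fun (Q\<^sup>2) \<noteq> 0" using elim(6) by (simp add: N_fun_nonzero norm_power_less_1)
    moreover have "1 + 3 * v_fun Q \<noteq> 0" using elim(3) by blast
    ultimately have "c / N_fun Q = G (Q\<^sup>2)"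
      unfolding G_def elim(2) using elim(5) derivs(2) by (subst frac_eq_eq) (auto simp: mult.assoc)
    thus ?case unfolding G_def derivs(1) using elim(4) by simp
  qed
  with deriv_w_fun_quotient_tendsto have "\<forall>\<^sub>F Q in at 0. G Q = 1"
    unfolding G_def by (rule square_invariant_imp_constant)
  thus ?thesis using p_cubic_w_fun_nonzero eventually_punctured_unit_disc
    by eventually_elim (simp add: G_def N_fun_nonzero)
qed

lemma Z_fun_eq_N_fun: "\<forall>\<^sub>F Q in at 0. Z_fun Q = N_fun Q * (1 - 9 * (w_fun Q)\<^sup>2)"
  using w_fun_ode eventually_at_0_imp_eventually_nhds[OF u_fun_mult_eq_w_fun]
    p_cubic_w_fun_nonzero eventually_punctured_unit_disc
proof eventually_elim
  case (elim Q)
  define w k where "w = w_fun Q" and "k = (1 - w_fun Q) * (1 - 9 * w_fun Q)"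
  note defs = this
  have w_deriv: "deriv_along (\<lambda>Q. Q) w_fun (N_fun Q * p_cubic w) Q"
    using holomorphic_deriv_along[OF w_fun_holomorphic, of Q] elim by (simp add: defs)
  have "deriv_along (\<lambda>Q. Q) (\<lambda>Q. u_fun Q * ((1 - w_fun Q) * (1 - 9 * w_fun Q)))
      (Z_fun Q * u_fun Q * k + u_fun Q * ((18 * w - 10) * (N_fun Q * p_cubic w))) Q"
    using u_fun_deriv_along[of Q] elim unfolding defs
    by (intro deriv_along_eq_rhs[OF deriv_along_mult])
       (rule deriv_along_eq_intros w_deriv refl | simp add: defs algebra_simps)+
  hence "deriv_along (\<lambda>Q. Q) w_fun
      (Z_fun Q * u_fun Q * k + u_fun Q * ((18 * w - 10) * (N_fun Q * p_cubic w))) Q"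
    by (rule deriv_along_cong[OF _ elim(2)])
  hence "Z_fun Q * u_fun Q * k + u_fun Q * ((18 * w - 10) * (N_fun Q * p_cubic w)) =
      N_fun Q * p_cubic w"
    using w_deriv by (rule deriv_along_unique)
  moreover have "u_fun Q * k = w" using eventually_nhds_x_imp_x[OF elim(2)] by (simp add: defs)
  moreover have p_cubic_eq: "p_cubic w = w * k" by (simp add: p_cubic_def defs)
  moreover have "k = 1 - 10 * w + 9 * w\<^sup>2" by (simp add: defs algebra_simps power2_eq_square)
  ultimately have "(w * k) * Z_fun Q = (w * k) * (N_fun Q * (1 - 9 * w\<^sup>2))" by algebra
  moreover have "w * k \<noteq> 0" using elim(3) p_cubic_eq unfolding w_def by simp
  ultimately show ?case unfolding w_def by simp
qed

lemma T_fun_w_fun: "\<forall>\<^sub>F Q in at 0. T_fun (w_fun Q) = N_fun Q"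
proof -
  have "(T_fun \<longlongrightarrow> 1) (nhds 0)"
    using sym_square_isCont[OF sym_square_T_fun]
    unfolding isCont_def tendsto_at_iff_tendsto_nhds by simp
  hence "((\<lambda>Q. T_fun (w_fun Q)) \<longlongrightarrow> 1) (at 0)" using w_fun_tendsto by (rule filterlim_compose)
  hence quotient_lim: "((\<lambda>Q. T_fun (w_fun Q) / N_fun Q) \<longlongrightarrow> 1) (at 0)"
    using tendsto_divide[OF _ N_fun_tendsto] by fastforce
  have "\<forall>\<^sub>F Q in at 0. T_fun (w_fun Q) / N_fun Q = T_fun (w_fun (Q\<^sup>2)) / N_fun (Q\<^sup>2)"
    using eventually_compose_filterlim[OF T_fun_functional_equation v_fun_tendsto]
      w_fun_eq_R_map N_fun_square v_fun_factors_nonzero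
    by eventually_elim (simp add: w_fun_square)
  with quotient_lim have "\<forall>\<^sub>F Q in at 0. T_fun (w_fun Q) / N_fun Q = 1"
    by (rule square_invariant_imp_constant)
  thus ?thesis using eventually_punctured_unit_disc by eventually_elim (simp add: N_fun_nonzero)
qed

theorem level_six_series:
  "\<forall>\<^sub>F Q in at 0. b_series 0
      (Q * (euler_prod Q * euler_prod (Q\<^sup>2) * euler_prod (Q ^ 3) * euler_prod (Q ^ 6))\<^sup>2 / (Z_fun Q)\<^sup>2)
    = Z_fun Q"
  using euler_prod_square_eq_p_cubic Z_fun_eq_N_fun T_fun_w_fun
    tendsto_imp_eventually_ne[OF Z_fun_tendsto one_neq_zero]
proof eventually_elim
  case (elim Q)
  hence nonzero: "N_fun Q \<noteq> 0" "1 - 9 * (w_fun Q)\<^sup>2 \<noteq> 0" by auto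
  have "(N_fun Q)\<^sup>2 * p_cubic (w_fun Q) / (N_fun Q * (1 - 9 * (w_fun Q)\<^sup>2))\<^sup>2 = y_of (w_fun Q)"
    using nonzero by (simp add: y_of_def power_mult_distrib)
  moreover have "b_series 0 (y_of (w_fun Q)) = N_fun Q * (1 - 9 * (w_fun Q)\<^sup>2)"
    using elim(3) nonzero by (simp add: T_fun_def nonzero_divide_eq_eq)
  ultimately show ?case unfolding elim(1,2) by simp
qed

section \<open>The expansion in \<open>x\<close>\<close>

lemma eta_product_eq_euler_prods:
  "eta_product \<tau> = qpar \<tau> *
     (euler_prod ((qpar \<tau>)\<^sup>2) * euler_prod (qpar \<tau> ^ 4) *
      euler_prod (qpar \<tau> ^ 6) * euler_prod (qpar \<tau> ^ 12))"
proof -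
  have qpar_scaled: "qpar (of_nat k * \<tau>) = qpar \<tau> ^ k" for k
    unfolding qpar_def exp_of_nat_mult[symmetric] by (simp add: mult_ac)
  have eta_scaled: "dedekind_eta (of_nat k * \<tau>) =
      exp (2 * of_real pi * \<i> * (of_nat k * \<tau>) / 24) * euler_prod (qpar \<tau> ^ k)" for k
    unfolding dedekind_eta_def qpar_scaled euler_prod_def qpoch_inf_def by simp
  have "exp (2 * of_real pi * \<i> * (2 * \<tau>) / 24) * exp (2 * of_real pi * \<i> * (4 * \<tau>) / 24) *
      exp (2 * of_real pi * \<i> * (6 * \<tau>) / 24) * exp (2 * of_real pi * \<i> * (12 * \<tau>) / 24) = qpar \<tau>"
    unfolding qpar_def exp_add[symmetric] by (rule arg_cong[of _ _ exp]) (simp add: field_simps)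
  thus ?thesis unfolding eta_product_def
    using eta_scaled[of 2] eta_scaled[of 4] eta_scaled[of 6] eta_scaled[of 12]
    by (simp add: mult_ac)
qed

lemma z_fun_eq_Z_fun: "z_fun \<tau> = Z_fun ((qpar \<tau>)\<^sup>2) + 2 * eta_product \<tau>"
  unfolding z_fun_def Z_fun_def Let_def by (simp flip: power_mult)

lemma t_coeff_sums_quotient:
  assumes "Z \<noteq> 0" "Z + 2 * e \<noteq> 0" "norm (e / (Z + 2 * e)) < 1 / 10" "b_series 0 (e\<^sup>2 / Z\<^sup>2) = Z"
  shows "(\<lambda>n. of_nat (t_coeff n) * (e / (Z + 2 * e)) ^ n) sums (Z + 2 * e)"
proof -
  have "1 - 2 * (e / (Z + 2 * e)) = Z / (Z + 2 * e)" using assms(2) by (simp add: field_simps)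
  moreover from this have "(e / (Z + 2 * e) / (1 - 2 * (e / (Z + 2 * e))))\<^sup>2 = e\<^sup>2 / Z\<^sup>2"
    using assms(1,2) by (simp add: power_divide)
  ultimately show ?thesis
    using t_coeff_sums[OF assms(3)] assms(1,4) by (simp add: b_series_def)
qed

lemma eventually_t_coeff_sums:
  "\<forall>\<^sub>F q in at 0.
     let e = q * (euler_prod (q\<^sup>2) * euler_prod (q ^ 4) * euler_prod (q ^ 6) * euler_prod (q ^ 12));
         z = Z_fun (q\<^sup>2) + 2 * e
     in z \<noteq> 0 \<and> (\<lambda>n. of_nat (t_coeff n) * (e / z) ^ n) sums z"
proof -
  define e where "e = (\<lambda>q. q *
      (euler_prod (q\<^sup>2) * euler_prod (q ^ 4) * euler_prod (q ^ 6) * euler_prod (q ^ 12)))"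
  have euler_prod_lim: "(g \<longlongrightarrow> 0) F \<Longrightarrow> ((\<lambda>q. euler_prod (g q)) \<longlongrightarrow> 1) F" for g and F :: "complex filter"
    using holomorphic_tendsto_compose_at_0[OF euler_prod_holomorphic] by simp
  have e_lim: "(e \<longlongrightarrow> 0) (at 0)"
    unfolding e_def by (rule tendsto_eq_intros euler_prod_lim refl | simp)+
  have Z_lim: "((\<lambda>q. Z_fun (q\<^sup>2)) \<longlongrightarrow> 1) (at 0)"
    by (rule filterlim_compose[OF Z_fun_tendsto filterlim_square_at_0])
  have z_lim: "((\<lambda>q. Z_fun (q\<^sup>2) + 2 * e q) \<longlongrightarrow> 1) (at 0)"
    by (rule tendsto_eq_intros e_lim Z_lim refl | simp)+
  have "((\<lambda>q. norm (e q / (Z_fun (q\<^sup>2) + 2 * e q))) \<longlongrightarrow> 0) (at 0)"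
    by (rule tendsto_eq_intros e_lim z_lim refl | simp)+
  hence "\<forall>\<^sub>F q in at 0. norm (e q / (Z_fun (q\<^sup>2) + 2 * e q)) < 1 / 10" by (rule order_tendstoD) simp
  moreover have "\<forall>\<^sub>F q in at 0. Z_fun (q\<^sup>2) \<noteq> 0" "\<forall>\<^sub>F q in at 0. Z_fun (q\<^sup>2) + 2 * e q \<noteq> 0"
    by (rule tendsto_imp_eventually_ne[OF Z_lim one_neq_zero]
        tendsto_imp_eventually_ne[OF z_lim one_neq_zero])+
  moreover have "\<forall>\<^sub>F q in at 0. b_series 0 ((e q)\<^sup>2 / (Z_fun (q\<^sup>2))\<^sup>2) = Z_fun (q\<^sup>2)"
    using eventually_compose_filterlim[OF level_six_series filterlim_square_at_0]
    by eventually_elim (simp add: e_def power_mult_distrib flip: power_mult)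
  ultimately show ?thesis
    unfolding Let_def e_def[THEN fun_cong, symmetric]
    by eventually_elim (simp add: t_coeff_sums_quotient)
qed

theorem theorem3p1:
  "\<exists>r>0. \<forall>\<tau>. Im \<tau> > 0 \<and> norm (qpar \<tau>) < r \<longrightarrow>
     z_fun \<tau> \<noteq> 0 \<and> (\<lambda>n. of_nat (t_coeff n) * x_fun \<tau> ^ n) sums z_fun \<tau>"
proof -
  obtain r where "r > 0" and expansion: "\<And>q. q \<noteq> 0 \<Longrightarrow> norm q < r \<Longrightarrow>
      let e = q * (euler_prod (q\<^sup>2) * euler_prod (q ^ 4) * euler_prod (q ^ 6) * euler_prod (q ^ 12));
          z = Z_fun (q\<^sup>2) + 2 * e
      in z \<noteq> 0 \<and> (\<lambda>n. of_nat (t_coeff n) * (e / z) ^ n) sums z"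
    using eventually_t_coeff_sums unfolding eventually_at dist_0_norm dist_commute[of _ 0] by blast
  have "z_fun \<tau> \<noteq> 0 \<and> (\<lambda>n. of_nat (t_coeff n) * x_fun \<tau> ^ n) sums z_fun \<tau>"
    if "norm (qpar \<tau>) < r" for \<tau>
  proof -
    have "qpar \<tau> \<noteq> 0" by (simp add: qpar_def)
    from expansion[OF this that] show ?thesis
      unfolding x_fun_def z_fun_eq_Z_fun eta_product_eq_euler_prods Let_def .
  qed
  thus ?thesis using \<open>r > 0\<close> by blast
qed

end
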